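(* Let $M$ be a left $R$-module and $n\geq 1$. Then $\mathrm{co}\Omega^{i}(M)$ is $i$-$C$-cotorsionfree for every $1\leq i\leq n$ if and only if $\mathrm{cograde}_C\,\mathrm{Ext}_R^i(C,M)\geq i-1$ for every $1\leq i\leq n$.
   Context: $R$ and $S$ are fixed associative unital rings; $\mathrm{Mod}\, R$ denotes the left $R$-modules. ${}_RC_S$ is a fixed semidualizing $(R,S)$-bimodule, i.e.: ${}_RC$ and $C_S$ each admit a projective resolution (over $R$, resp. over $S$ on the right) with all terms finitely generated; the homothety maps $R\to \mathrm{Hom}_{S}(C,C)$ and $S\to \mathrm{Hom}_R(C,C)$ are isomorphisms; and $\mathrm{Ext}^{i}_R(C,C)=0=\mathrm{Ext}^{i}_{S}(C,C)$ for all $i\geq 1$. Write $(-)_*=\mathrm{Hom}_R(C,-)$, a functor from left $R$-modules to left $S$-modules; likewise $\mathrm{Ext}^i_R(C,M)$ is a left $S$-module. For $M\in\mathrm{Mod}\, R$ let $0\to M\to I^0(M)\xrightarrow{f^0} I^1(M)\xrightarrow{f^1}\cdots$ be its minimal injective resolution. For $i\ge1$, $\mathrm{co}\Omega^i(M):=\mathrm{Im} f^{i-1}$ is the $i$-th cosyzygy of $M$. The cotranspose of $M$ is the left $S$-module $\mathrm{cTr}_C M:=\mathrm{Coker}(f^0_*: I^0(M)_*\to I^1(M)_* )$. $M$ is $n$-$C$-cotorsionfree ($n\ge 1$) if $\mathrm{Tor}^S_i(C,\mathrm{cTr}_C M)=0$ for all $1\leq i\leq n$. For a left $S$-module $N$,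 $\mathrm{cograde}_C N:=\inf\{i\ge 0\mid \mathrm{Tor}^S_i(C,N)\neq 0\}$ (with $\inf\emptyset=\infty$). *)

theory Defs
  imports "HOL-Algebra.Module" "HOL-Algebra.AbelCoset" "HOL-Algebra.Elementary_Groups"
    "HOL-Algebra.Free_Abelian_Groups" "HOL-Library.Extended_Nat"
begin

section \<open>Modules over arbitrary associative unital rings\<close>

text \<open>
  The locale \<^locale>\<open>module\<close> of HOL-Algebra requires a commutative ring of scalars, so only its
  record type is reused. As for abelian groups in HOL-Algebra, the fields \<open>mult\<close> and \<open>one\<close> of
  that record are irrelevant.
\<close>

locale left_module = R?: ring R + M?: abelian_group M
  for R :: "('r, 'k) ring_scheme" (structure) and M :: "('r, 'a, 'm) module_scheme" (structure) +
  assumes smult_closed: "\<lbrakk>r \<in> carrier R; x \<in> carrier M\<rbrakk> \<Longrightarrow> r \<odot>\<^bsub>M\<^esub> x \<in> carrier M"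
    and smult_l_distr: "\<lbrakk>r \<in> carrier R; s \<in> carrier R; x \<in> carrier M\<rbrakk> \<Longrightarrow>
      (r \<oplus>\<^bsub>R\<^esub> s) \<odot>\<^bsub>M\<^esub> x = r \<odot>\<^bsub>M\<^esub> x \<oplus>\<^bsub>M\<^esub> s \<odot>\<^bsub>M\<^esub> x"
    and smult_r_distr: "\<lbrakk>r \<in> carrier R; x \<in> carrier M; y \<in> carrier M\<rbrakk> \<Longrightarrow>
      r \<odot>\<^bsub>M\<^esub> (x \<oplus>\<^bsub>M\<^esub> y) = r \<odot>\<^bsub>M\<^esub> x \<oplus>\<^bsub>M\<^esub> r \<odot>\<^bsub>M\<^esub> y"
    and smult_assoc: "\<lbrakk>r \<in> carrier R; s \<in> carrier R; x \<in> carrier M\<rbrakk> \<Longrightarrow>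
      (r \<otimes>\<^bsub>R\<^esub> s) \<odot>\<^bsub>M\<^esub> x = r \<odot>\<^bsub>M\<^esub> (s \<odot>\<^bsub>M\<^esub> x)"
    and smult_one: "x \<in> carrier M \<Longrightarrow> \<one>\<^bsub>R\<^esub> \<odot>\<^bsub>M\<^esub> x = x"

text \<open>Right \<open>S\<close>-modules are treated as left modules over the opposite ring of \<open>S\<close>.\<close>

definition opposite_ring :: "('s, 'k) ring_scheme \<Rightarrow> ('s, 'k) ring_scheme" where
  "opposite_ring S = S\<lparr>monoid.mult := (\<lambda>x y. y \<otimes>\<^bsub>S\<^esub> x)\<rparr>"

record ('r, 's, 'c) bimodule = "('r, 'c) module" +
  rsmult :: "'c \<Rightarrow> 's \<Rightarrow> 'c"

definition right_mod :: "('r, 's, 'c) bimodule \<Rightarrow> ('s, 'c) module" where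
  "right_mod C = \<lparr>carrier = carrier C, monoid.mult = monoid.mult C, one = one C,
     ring.zero = ring.zero C, add = add C, smult = (\<lambda>s c. rsmult C c s)\<rparr>"

definition is_bimodule :: "'r ring \<Rightarrow> 's ring \<Rightarrow> ('r, 's, 'c) bimodule \<Rightarrow> bool" where
  "is_bimodule R S C \<longleftrightarrow>
     ring R \<and> ring S \<and> left_module R C \<and> left_module (opposite_ring S) (right_mod C) \<and>
     (\<forall>r\<in>carrier R. \<forall>s\<in>carrier S. \<forall>c\<in>carrier C.
        rsmult C (r \<odot>\<^bsub>C\<^esub> c) s = r \<odot>\<^bsub>C\<^esub> rsmult C c s)"

text \<open>Maps are extensional, so that equality in a Hom set is equality of maps on the carrier.\<close>

definition lhom ::
  "('r, 'k) ring_scheme \<Rightarrow> ('r, 'a, 'm) module_scheme \<Rightarrow> ('r, 'b, 'n) module_scheme \<Rightarrow> ('a \<Rightarrow> 'b) set"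
where
  "lhom R A B = {h \<in> carrier A \<rightarrow>\<^sub>E carrier B.
     (\<forall>x\<in>carrier A. \<forall>y\<in>carrier A. h (x \<oplus>\<^bsub>A\<^esub> y) = h x \<oplus>\<^bsub>B\<^esub> h y) \<and>
     (\<forall>r\<in>carrier R. \<forall>x\<in>carrier A. h (r \<odot>\<^bsub>A\<^esub> x) = r \<odot>\<^bsub>B\<^esub> h x)}"

definition quotient_module :: "('r, 'a) module \<Rightarrow> 'a set \<Rightarrow> ('r, 'a set) module" where
  "quotient_module M N = \<lparr>carrier = a_rcosets\<^bsub>M\<^esub> N, monoid.mult = undefined, one = undefined,
     ring.zero = N, add = (\<lambda>X Y. X <+>\<^bsub>M\<^esub> Y),
     smult = (\<lambda>r X. N <+>\<^bsub>M\<^esub> ((\<lambda>x. r \<odot>\<^bsub>M\<^esub> x) ` X))\<rparr>"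

definition finitely_generated_module ::
  "('r, 'k) ring_scheme \<Rightarrow> ('r, 'a, 'm) module_scheme \<Rightarrow> bool" where
  "finitely_generated_module R M \<longleftrightarrow>
     (\<exists>X. finite X \<and> X \<subseteq> carrier M \<and> \<Inter>{N. submodule N R M \<and> X \<subseteq> N} = carrier M)"

section \<open>Projective and injective modules, resolutions\<close>

text \<open>
  The lifting and extension properties below can only range over test modules with elements of
  a fixed type. Nothing is lost: the free module on the set of elements of \<open>P\<close> consists of
  functions \<open>'p \<Rightarrow> 'r\<close>, and the left ideals of \<open>R\<close> (Baer's criterion) have elements in \<open>'r\<close>.
\<close>

definition projective_module :: "('r, 'k) ring_scheme \<Rightarrow> ('r, 'p) module \<Rightarrow> bool" where
  "projective_module R P \<longleftrightarrow> left_module R P \<and>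
     (\<forall>(A :: ('r, 'p \<Rightarrow> 'r) module) (B :: ('r, 'p) module) p h.
        left_module R A \<and> left_module R B \<and> p \<in> lhom R A B \<and> p ` carrier A = carrier B \<and>
        h \<in> lhom R P B \<longrightarrow>
        (\<exists>g\<in>lhom R P A. \<forall>x\<in>carrier P. p (g x) = h x))"

definition injective_module :: "('r, 'k) ring_scheme \<Rightarrow> ('r, 'e) module \<Rightarrow> bool" where
  "injective_module R E \<longleftrightarrow> left_module R E \<and>
     (\<forall>(A :: ('r, 'r + 'e) module) (B :: ('r, 'r + 'e) module) j h.
        left_module R A \<and> left_module R B \<and> j \<in> lhom R A B \<and> inj_on j (carrier A) \<and>
        h \<in> lhom R A E \<longrightarrow>
        (\<exists>g\<in>lhom R B E. \<forall>x\<in>carrier A. g (j x) = h x))"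

text \<open>The exact sequence \<open>\<dots> \<rightarrow> P 1 \<rightarrow> P 0 \<rightarrow> A \<rightarrow> 0\<close> with differentials \<open>d i : P (i + 1) \<rightarrow> P i\<close>.\<close>

definition projective_resolution ::
  "('r, 'k) ring_scheme \<Rightarrow> ('r, 'a, 'm) module_scheme \<Rightarrow> (nat \<Rightarrow> ('r, 'p) module) \<Rightarrow>
   ('p \<Rightarrow> 'a) \<Rightarrow> (nat \<Rightarrow> 'p \<Rightarrow> 'p) \<Rightarrow> bool"
where
  "projective_resolution R A P \<epsilon> d \<longleftrightarrow>
     left_module R A \<and> (\<forall>i. projective_module R (P i)) \<and>
     \<epsilon> \<in> lhom R (P 0) A \<and> (\<forall>i. d i \<in> lhom R (P (Suc i)) (P i)) \<and>
     \<epsilon> ` carrier (P 0) = carrier A \<and>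
     d 0 ` carrier (P 1) = a_kernel (P 0) A \<epsilon> \<and>
     (\<forall>i. d (Suc i) ` carrier (P (Suc (Suc i))) = a_kernel (P (Suc i)) (P i) (d i))"

text \<open>The exact sequence \<open>0 \<rightarrow> M \<rightarrow> I 0 \<rightarrow> I 1 \<rightarrow> \<dots>\<close> with differentials \<open>f i : I i \<rightarrow> I (i + 1)\<close>.\<close>

definition injective_resolution ::
  "('r, 'k) ring_scheme \<Rightarrow> ('r, 'a, 'm) module_scheme \<Rightarrow> (nat \<Rightarrow> ('r, 'e) module) \<Rightarrow>
   ('a \<Rightarrow> 'e) \<Rightarrow> (nat \<Rightarrow> 'e \<Rightarrow> 'e) \<Rightarrow> bool"
where
  "injective_resolution R M I \<eta> f \<longleftrightarrow>
     left_module R M \<and> (\<forall>i. injective_module R (I i)) \<and>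
     \<eta> \<in> lhom R M (I 0) \<and> (\<forall>i. f i \<in> lhom R (I i) (I (Suc i))) \<and>
     inj_on \<eta> (carrier M) \<and>
     \<eta> ` carrier M = a_kernel (I 0) (I 1) (f 0) \<and>
     (\<forall>i. f i ` carrier (I i) = a_kernel (I (Suc i)) (I (Suc (Suc i))) (f (Suc i)))"

definition essential_in ::
  "('r, 'k) ring_scheme \<Rightarrow> 'e set \<Rightarrow> ('r, 'e, 'm) module_scheme \<Rightarrow> bool" where
  "essential_in R K E \<longleftrightarrow> submodule K R E \<and>
     (\<forall>N. submodule N R E \<and> N \<noteq> {\<zero>\<^bsub>E\<^esub>} \<longrightarrow> N \<inter> K \<noteq> {\<zero>\<^bsub>E\<^esub>})"

text \<open>Minimality: every \<open>I i\<close> is an injective envelope of the kernel of its differential.\<close>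

definition minimal_injective_resolution ::
  "('r, 'k) ring_scheme \<Rightarrow> ('r, 'a, 'm) module_scheme \<Rightarrow> (nat \<Rightarrow> ('r, 'e) module) \<Rightarrow>
   ('a \<Rightarrow> 'e) \<Rightarrow> (nat \<Rightarrow> 'e \<Rightarrow> 'e) \<Rightarrow> bool"
where
  "minimal_injective_resolution R M I \<eta> f \<longleftrightarrow>
     injective_resolution R M I \<eta> f \<and>
     essential_in R (\<eta> ` carrier M) (I 0) \<and>
     (\<forall>i. essential_in R (f i ` carrier (I i)) (I (Suc i)))"

text \<open>
  Every module with elements in \<open>'a\<close> over a ring with elements in \<open>'r\<close> has a free resolution in
  which each term has a basis indexed by a subset of \<open>('r + 'a) list\<close>, hence a projective
  resolution whose terms have elements in the following type; likewise each finitely generated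
  projective module has an isomorphic copy there.
\<close>

type_synonym ('r, 'a) res_elem = "('r + 'a) list \<Rightarrow> 'r"

definition has_fg_projective_resolution ::
  "('r, 'k) ring_scheme \<Rightarrow> ('r, 'a, 'm) module_scheme \<Rightarrow> bool" where
  "has_fg_projective_resolution R A \<longleftrightarrow>
     (\<exists>(P :: nat \<Rightarrow> ('r, ('r, 'a) res_elem) module) \<epsilon> d.
        projective_resolution R A P \<epsilon> d \<and> (\<forall>i. finitely_generated_module R (P i)))"

definition proj_res ::
  "('r, 'k) ring_scheme \<Rightarrow> ('r, 'a, 'm) module_scheme \<Rightarrow>
   (nat \<Rightarrow> ('r, ('r, 'a) res_elem) module) \<times>
   (nat \<Rightarrow> ('r, 'a) res_elem \<Rightarrow> ('r, 'a) res_elem)"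
where
  "proj_res R A = (SOME (P, d). \<exists>\<epsilon>. projective_resolution R A P \<epsilon> d)"

section \<open>Homology, Ext and Tor as abelian groups\<close>

text \<open>Groups are written multiplicatively here, as in the library.\<close>

definition homology_at :: "'a monoid \<Rightarrow> 'a set \<Rightarrow> 'a set \<Rightarrow> 'a set monoid" where
  "homology_at G Z B = (G\<lparr>carrier := Z\<rparr>) Mod B"

definition Hom_group ::
  "('r, 'k) ring_scheme \<Rightarrow> ('r, 'a, 'm) module_scheme \<Rightarrow> ('r, 'b, 'n) module_scheme \<Rightarrow> ('a \<Rightarrow> 'b) monoid"
where
  "Hom_group R A B = \<lparr>carrier = lhom R A B,
     monoid.mult = (\<lambda>g h. \<lambda>x\<in>carrier A. g x \<oplus>\<^bsub>B\<^esub> h x),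
     one = (\<lambda>x\<in>carrier A. \<zero>\<^bsub>B\<^esub>)\<rparr>"

definition Ext_group ::
  "('r, 'k) ring_scheme \<Rightarrow> ('r, 'a, 'm) module_scheme \<Rightarrow> ('r, 'b, 'n) module_scheme \<Rightarrow> nat \<Rightarrow>
   (('r, 'a) res_elem \<Rightarrow> 'b) set monoid"
where
  "Ext_group R A B i =
     (let (P, d) = proj_res R A;
          H = (\<lambda>j. Hom_group R (P j) B);
          \<delta> = (\<lambda>j h. compose (carrier (P (Suc j))) h (d j))
      in homology_at (H i) (kernel (H i) (H (Suc i)) (\<delta> i))
           (case i of 0 \<Rightarrow> {\<one>\<^bsub>H 0\<^esub>} | Suc j \<Rightarrow> \<delta> j ` carrier (H j)))"

text \<open>
  \<open>A\<close> is a right and \<open>B\<close> a left \<open>S\<close>-module; the scalar multiplication \<open>s \<odot>\<^bsub>A\<^esub> a\<close> stands for \<open>a s\<close>.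
\<close>

definition tensor_relations ::
  "('s, 'k) ring_scheme \<Rightarrow> ('s, 'a, 'm) module_scheme \<Rightarrow> ('s, 'b, 'n) module_scheme \<Rightarrow>
   ('a \<times> 'b \<Rightarrow>\<^sub>0 int) set"
where
  "tensor_relations S A B = generate (free_Abelian_group (carrier A \<times> carrier B))
     ({frag_of (a \<oplus>\<^bsub>A\<^esub> a', b) - frag_of (a, b) - frag_of (a', b) | a a' b.
         a \<in> carrier A \<and> a' \<in> carrier A \<and> b \<in> carrier B} \<union>
      {frag_of (a, b \<oplus>\<^bsub>B\<^esub> b') - frag_of (a, b) - frag_of (a, b') | a b b'.
         a \<in> carrier A \<and> b \<in> carrier B \<and> b' \<in> carrier B} \<union>
      {frag_of (s \<odot>\<^bsub>A\<^esub> a, b) - frag_of (a, s \<odot>\<^bsub>B\<^esub> b) | s a b.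
         s \<in> carrier S \<and> a \<in> carrier A \<and> b \<in> carrier B})"

definition tensor_group ::
  "('s, 'k) ring_scheme \<Rightarrow> ('s, 'a, 'm) module_scheme \<Rightarrow> ('s, 'b, 'n) module_scheme \<Rightarrow>
   ('a \<times> 'b \<Rightarrow>\<^sub>0 int) set monoid"
where
  "tensor_group S A B =
     free_Abelian_group (carrier A \<times> carrier B) Mod tensor_relations S A B"

text \<open>The map \<open>h \<otimes> B\<close> into \<open>A' \<otimes> B\<close>, for \<open>h : A \<rightarrow> A'\<close>; its arguments are cosets.\<close>

definition tensor_map ::
  "('s, 'k) ring_scheme \<Rightarrow> ('s, 'a, 'm) module_scheme \<Rightarrow> ('s, 'b, 'n) module_scheme \<Rightarrow> ('c \<Rightarrow> 'a) \<Rightarrow>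
   ('c \<times> 'b \<Rightarrow>\<^sub>0 int) set \<Rightarrow> ('a \<times> 'b \<Rightarrow>\<^sub>0 int) set"
where
  "tensor_map S A' B h X =
     tensor_relations S A' B <#>\<^bsub>free_Abelian_group (carrier A' \<times> carrier B)\<^esub>
     (frag_extend (\<lambda>(a, b). frag_of (h a, b)) ` X)"

text \<open>\<open>Tor S A B i\<close> is defined for a right \<open>S\<close>-module \<open>A\<close> (in the form above) and a left one \<open>B\<close>.\<close>

definition Tor ::
  "('s, 'k) ring_scheme \<Rightarrow> ('s, 'a, 'm) module_scheme \<Rightarrow> ('s, 'b, 'n) module_scheme \<Rightarrow> nat \<Rightarrow>
   (('s, 'a) res_elem \<times> 'b \<Rightarrow>\<^sub>0 int) set set monoid"
where
  "Tor S A B i =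
     (let (P, d) = proj_res (opposite_ring S) A;
          T = (\<lambda>j. tensor_group S (P j) B);
          D = (\<lambda>j. tensor_map S (P j) B (d j))
      in homology_at (T i)
           (case i of 0 \<Rightarrow> carrier (T 0) | Suc j \<Rightarrow> kernel (T (Suc j)) (T j) (D j))
           (D i ` carrier (T (Suc i))))"

section \<open>Semidualizing bimodules and the notions relative to them\<close>

text \<open>The homothety maps are always additive and multiplicative, so only bijectivity is required.\<close>

definition semidualizing :: "'r ring \<Rightarrow> 's ring \<Rightarrow> ('r, 's, 'c) bimodule \<Rightarrow> bool" where
  "semidualizing R S C \<longleftrightarrow>
     is_bimodule R S C \<and>
     has_fg_projective_resolution R C \<and>
     has_fg_projective_resolution (opposite_ring S) (right_mod C) \<and>
     bij_betw (\<lambda>r. \<lambda>c\<in>carrier C. r \<odot>\<^bsub>C\<^esub> c) (carrier R)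
       (lhom (opposite_ring S) (right_mod C) (right_mod C)) \<and>
     bij_betw (\<lambda>s. \<lambda>c\<in>carrier C. rsmult C c s) (carrier S) (lhom R C C) \<and>
     (\<forall>i\<ge>1. trivial_group (Ext_group R C C i)) \<and>
     (\<forall>i\<ge>1. trivial_group (Ext_group (opposite_ring S) (right_mod C) (right_mod C) i))"

text \<open>The left \<open>S\<close>-module \<open>Hom\<^sub>R(C, M)\<close>, with \<open>(s h) c = h (c s)\<close>, and the action on maps.\<close>

definition Hom_from ::
  "'r ring \<Rightarrow> ('r, 's, 'c) bimodule \<Rightarrow> ('r, 'a) module \<Rightarrow> ('s, 'c \<Rightarrow> 'a) module" where
  "Hom_from R C M = \<lparr>carrier = lhom R C M, monoid.mult = undefined, one = undefined,
     ring.zero = (\<lambda>c\<in>carrier C. \<zero>\<^bsub>M\<^esub>),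
     add = (\<lambda>g h. \<lambda>c\<in>carrier C. g c \<oplus>\<^bsub>M\<^esub> h c),
     smult = (\<lambda>s h. \<lambda>c\<in>carrier C. h (rsmult C c s))\<rparr>"

definition Hom_from_map ::
  "('r, 's, 'c) bimodule \<Rightarrow> ('a \<Rightarrow> 'b) \<Rightarrow> ('c \<Rightarrow> 'a) \<Rightarrow> ('c \<Rightarrow> 'b)" where
  "Hom_from_map C g h = compose (carrier C) g h"

text \<open>
  Computing Ext as follows from the second variable, rather than from the first as in
  \<^const>\<open>Ext_group\<close>, is what makes its \<open>S\<close>-module structure visible; the underlying
  groups are isomorphic.
  For an injective resolution \<open>(I, f)\<close> of \<open>M\<close>, the left \<open>S\<close>-module \<open>Ext\<^sup>i\<^sub>R(C, M)\<close>, that is, the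
  \<open>i\<close>-th right derived functor of \<open>Hom\<^sub>R(C, -)\<close> at \<open>M\<close>. The resolution is an argument because it
  need not live in the type of elements of \<open>M\<close>.
\<close>

definition Ext_module ::
  "'r ring \<Rightarrow> ('r, 's, 'c) bimodule \<Rightarrow> (nat \<Rightarrow> ('r, 'e) module) \<Rightarrow> (nat \<Rightarrow> 'e \<Rightarrow> 'e) \<Rightarrow> nat \<Rightarrow>
   ('s, ('c \<Rightarrow> 'e) set) module"
where
  "Ext_module R C I f i =
     (let H = (\<lambda>j. Hom_from R C (I j));
          Z = a_kernel (H i) (H (Suc i)) (Hom_from_map C (f i));
          B = (case i of 0 \<Rightarrow> {\<zero>\<^bsub>H 0\<^esub>} | Suc j \<Rightarrow> Hom_from_map C (f j) ` carrier (H j))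
      in quotient_module ((H i)\<lparr>carrier := Z\<rparr>) B)"

text \<open>The \<open>i\<close>-th cosyzygy, for \<open>i \<ge> 1\<close>, of the module with minimal injective resolution \<open>(I, f)\<close>.\<close>

definition cosyzygy ::
  "(nat \<Rightarrow> ('r, 'e) module) \<Rightarrow> (nat \<Rightarrow> 'e \<Rightarrow> 'e) \<Rightarrow> nat \<Rightarrow> ('r, 'e) module" where
  "cosyzygy I f i = (I i)\<lparr>carrier := f (i - 1) ` carrier (I (i - 1))\<rparr>"

text \<open>
  The minimal injective resolution is unique up to isomorphism; it is chosen with elements in the
  type of elements of \<open>M\<close>. If that type carries a minimal injective resolution \<open>(I, f)\<close> of some
  module, then it also carries those of all cosyzygies, given by the truncations of \<open>(I, f)\<close>.
\<close>

definition min_inj_res ::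
  "'r ring \<Rightarrow> ('r, 'a) module \<Rightarrow> (nat \<Rightarrow> ('r, 'a) module) \<times> (nat \<Rightarrow> 'a \<Rightarrow> 'a)" where
  "min_inj_res R M = (SOME (I, f). \<exists>\<eta>. minimal_injective_resolution R M I \<eta> f)"

definition cTr ::
  "'r ring \<Rightarrow> ('r, 's, 'c) bimodule \<Rightarrow> ('r, 'a) module \<Rightarrow> ('s, ('c \<Rightarrow> 'a) set) module" where
  "cTr R C M =
     (let (I, f) = min_inj_res R M
      in quotient_module (Hom_from R C (I 1))
           (Hom_from_map C (f 0) ` carrier (Hom_from R C (I 0))))"

definition cotorsionfree ::
  "'r ring \<Rightarrow> 's ring \<Rightarrow> ('r, 's, 'c) bimodule \<Rightarrow> nat \<Rightarrow> ('r, 'a) module \<Rightarrow> bool" where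
  "cotorsionfree R S C n M \<longleftrightarrow>
     (\<forall>i\<in>{1..n}. trivial_group (Tor S (right_mod C) (cTr R C M) i))"

definition cograde :: "'s ring \<Rightarrow> ('r, 's, 'c) bimodule \<Rightarrow> ('s, 'b) module \<Rightarrow> enat" where
  "cograde S C N = Inf {enat i | i. \<not> trivial_group (Tor S (right_mod C) N i)}"

end

theory Submission
  imports Defs "HOL-Library.Product_Plus"
begin

text \<open>
  Let \<open>P\<close> be a projective resolution of \<open>C\<^sub>S\<close>, and for an \<open>R\<close>-module \<open>K\<close> let \<open>X(K)\<close> be the complex
  \<open>P \<otimes> Hom(C, K) \<rightarrow> K \<rightarrow> 0\<close> augmented by the evaluation. If \<open>K\<close> is injective, then \<open>X(K)\<close> is exact:
  for a resolution \<open>Q\<close> with finitely generated terms, \<open>Q \<otimes> Hom(C, K)\<close> is \<open>Hom(Hom(Q, C), K)\<close>, and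
  \<open>Hom(Q, C)\<close> is a resolution of \<open>Hom\<^sub>S(C, C) = R\<close>. Let \<open>B\<close> be the image of
  \<open>Hom(C, I\<^sup>0) \<rightarrow> Hom(C, I\<^sup>1)\<close> for an injective resolution \<open>0 \<rightarrow> K \<rightarrow> I\<^sup>0 \<rightarrow> I\<^sup>1 \<rightarrow> \<dots>\<close>. The sequences
  \<open>0 \<rightarrow> Hom(C, K) \<rightarrow> Hom(C, I\<^sup>0) \<rightarrow> B \<rightarrow> 0\<close> and \<open>0 \<rightarrow> B \<rightarrow> Hom(C, I\<^sup>1) \<rightarrow> cTr K \<rightarrow> 0\<close> shift degrees by two, so
  \<open>K\<close> is \<open>n\<close>-cotorsionfree if and only if \<open>X(K)\<close> is exact in its \<open>n\<close> lowest degrees; no minimality is involved.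
  Finally, \<open>0 \<rightarrow> B \<rightarrow> Hom(C, co\<Omega> K) \<rightarrow> Ext\<^sup>1(C, K) \<rightarrow> 0\<close> shows that if \<open>X(K)\<close> is exact in its \<open>m\<close>
  lowest degrees, then \<open>X(co\<Omega> K)\<close> is exact in its \<open>m + 1\<close> lowest degrees if and only if
  \<open>Tor\<^sub>j(C, Ext\<^sup>1(C, K)) = 0\<close> for all \<open>j < m\<close>. Induction on \<open>i\<close> with \<open>K = co\<Omega>\<^sup>i\<^sup>-\<^sup>1 M\<close> gives the theorem.
\<close>

section \<open>The long exact homology sequence, by diagram chases on representatives\<close>

section \<open>Complexes of subquotients\<close>

text \<open>A carrier in HOL-Algebra is a set and need not be a type of class
  \<open>ab_group_add\<close>. The diagram chases therefore run on representatives in free abelian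
  groups: a group of a complex is a pair of subgroups standing for a quotient, and even
  \<open>K\<close> enters as formal sums of its elements modulo those summing to zero.
  \<open>Hom_exact K k\<close> counts from the end of the complex: k = 0 is surjectivity of C
  \<otimes> Hom(C, K) \<rightarrow> K, k = 1 is its injectivity, and k = j + 2 is the vanishing of
  Tor_{j+1}(C, Hom(C, K)). Two obstacles shape the development. Tor and Ext are computed from the
  resolution that \<open>proj_res\<close> picks, whereas the duality for injective modules needs
  finitely generated terms; so resolutions are compared by chain maps and homotopies. The
  definitions of projective and injective modules draw their test modules from a single type; so
  lifting is derived anew from dual bases, and extension from Baer's criterion and Zorn's lemma, for
  modules of any type.\<close>

definition diff_closed :: "'x::ab_group_add set \<Rightarrow> bool" where
  "diff_closed H \<longleftrightarrow> 0 \<in> H \<and> (\<forall>x\<in>H. \<forall>y\<in>H. x - y \<in> H)"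

lemma diff_closed_zero: "diff_closed H \<Longrightarrow> 0 \<in> H"
  and diff_closed_diff: "diff_closed H \<Longrightarrow> x \<in> H \<Longrightarrow> y \<in> H \<Longrightarrow> x - y \<in> H"
  by (auto simp: diff_closed_def)

lemma diff_closed_uminus: "diff_closed H \<Longrightarrow> x \<in> H \<Longrightarrow> - x \<in> H"
  using diff_closed_diff[of H 0 x] by (simp add: diff_closed_zero)

lemma diff_closed_add: "diff_closed H \<Longrightarrow> x \<in> H \<Longrightarrow> y \<in> H \<Longrightarrow> x + y \<in> H"
  using diff_closed_diff[of H x "- y"] by (simp add: diff_closed_uminus)

lemma diff_closed_sum: "diff_closed H \<Longrightarrow> (\<And>i. i \<in> A \<Longrightarrow> f i \<in> H) \<Longrightarrow> sum f A \<in> H"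
  by (induction A rule: infinite_finite_induct) (auto simp: diff_closed_zero diff_closed_add)

text \<open>The groups of the complex are the quotients \<open>U k / V k\<close>.\<close>

locale subquotient_complex =
  fixes U V :: "nat \<Rightarrow> 'x::ab_group_add set" and d :: "nat \<Rightarrow> 'x \<Rightarrow> 'x"
  assumes U: "diff_closed (U k)" and V: "diff_closed (V k)"
    and d_diff: "d k (x - y) = d k x - d k y"
    and dU: "x \<in> U (Suc k) \<Longrightarrow> d k x \<in> U k" and dV: "x \<in> V (Suc k) \<Longrightarrow> d k x \<in> V k"
    and dd: "x \<in> U (Suc (Suc k)) \<Longrightarrow> d k (d (Suc k) x) \<in> V k"
begin

text \<open>Exactness at index \<open>k + 1\<close>, so that \<open>d k\<close> is always defined.\<close>

definition exact_at :: "nat \<Rightarrow> bool" where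
  "exact_at k \<longleftrightarrow> (\<forall>x\<in>U (Suc k). d k x \<in> V k \<longrightarrow> (\<exists>y\<in>U (Suc (Suc k)). x - d (Suc k) y \<in> V (Suc k)))"

lemma exact_atD:
  assumes "exact_at k" "x \<in> U (Suc k)" "d k x \<in> V k"
  obtains y where "y \<in> U (Suc (Suc k))" "x - d (Suc k) y \<in> V (Suc k)"
  using assms unfolding exact_at_def by blast

lemma d_add: "d k (x + y) = d k x + d k y"
  using d_diff[of k "x + y" y] by simp

end

text \<open>The last four assumptions make 0 \<rightarrow> U/V \<rightarrow> U'/V' \<rightarrow>
  U''/V'' \<rightarrow> 0 exact in every degree. The squares commute modulo \<open>V'\<close> and
  \<open>V''\<close>, as befits maps of quotients.\<close>

locale complex_ses =
  X: subquotient_complex U V d + Y: subquotient_complex U' V' d' + Z: subquotient_complex U'' V'' d''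
  for U V :: "nat \<Rightarrow> 'x::ab_group_add set" and d
    and U' V' :: "nat \<Rightarrow> 'y::ab_group_add set" and d'
    and U'' V'' :: "nat \<Rightarrow> 'z::ab_group_add set" and d'' +
  fixes \<alpha> :: "'x \<Rightarrow> 'y" and \<beta> :: "'y \<Rightarrow> 'z"
  assumes \<alpha>_diff: "\<alpha> (x - x') = \<alpha> x - \<alpha> x'" and \<beta>_diff: "\<beta> (y - y') = \<beta> y - \<beta> y'"
    and \<alpha>U: "x \<in> U k \<Longrightarrow> \<alpha> x \<in> U' k" and \<alpha>V: "x \<in> V k \<Longrightarrow> \<alpha> x \<in> V' k"
    and \<beta>U: "y \<in> U' k \<Longrightarrow> \<beta> y \<in> U'' k" and \<beta>V: "y \<in> V' k \<Longrightarrow> \<beta> y \<in> V'' k"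
    and \<alpha>_comm: "x \<in> U (Suc k) \<Longrightarrow> \<alpha> (d k x) - d' k (\<alpha> x) \<in> V' k"
    and \<beta>_comm: "y \<in> U' (Suc k) \<Longrightarrow> \<beta> (d' k y) - d'' k (\<beta> y) \<in> V'' k"
    and inj: "x \<in> U k \<Longrightarrow> \<alpha> x \<in> V' k \<Longrightarrow> x \<in> V k"
    and mid: "y \<in> U' k \<Longrightarrow> \<beta> y \<in> V'' k \<Longrightarrow> \<exists>x\<in>U k. y - \<alpha> x \<in> V' k"
    and \<beta>\<alpha>: "x \<in> U k \<Longrightarrow> \<beta> (\<alpha> x) \<in> V'' k"
    and surj: "z \<in> U'' k \<Longrightarrow> \<exists>y\<in>U' k. z - \<beta> y \<in> V'' k"
begin

lemmas V_intros = diff_closed_add[OF X.V] diff_closed_diff[OF X.V]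
  diff_closed_add[OF Y.V] diff_closed_diff[OF Y.V] diff_closed_add[OF Z.V] diff_closed_diff[OF Z.V]

lemmas U_intros = diff_closed_add[OF X.U] diff_closed_diff[OF X.U]
  diff_closed_add[OF Y.U] diff_closed_diff[OF Y.U] diff_closed_add[OF Z.U] diff_closed_diff[OF Z.U]

lemma d''_\<beta>: "y \<in> U' (Suc k) \<Longrightarrow> \<beta> (d' k y) \<in> V'' k \<longleftrightarrow> d'' k (\<beta> y) \<in> V'' k"
  using \<beta>_comm[of y k] V_intros(5)[of "\<beta> (d' k y) - d'' k (\<beta> y)" k "d'' k (\<beta> y)"]
    V_intros(6)[of "\<beta> (d' k y)" k "\<beta> (d' k y) - d'' k (\<beta> y)"] by auto

lemma d'_\<alpha>: "x \<in> U (Suc k) \<Longrightarrow> \<alpha> (d k x) \<in> V' k \<longleftrightarrow> d' k (\<alpha> x) \<in> V' k"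
  using \<alpha>_comm[of x k] V_intros(3)[of "\<alpha> (d k x) - d' k (\<alpha> x)" k "d' k (\<alpha> x)"]
    V_intros(4)[of "\<alpha> (d k x)" k "\<alpha> (d k x) - d' k (\<alpha> x)"] by auto

text \<open>The chase shared by \<open>exact_mid\<close> and \<open>exact_left\<close>: lift
  \<open>z\<close> to \<open>y2\<close>; then \<beta> sends \<open>y\<close> minus the boundary of
  \<open>y2\<close> into \<open>V''\<close>, and exactness in the middle yields
  \<open>x\<close>.\<close>

lemma lift_boundary:
  assumes y: "y \<in> U' (Suc k)" and z: "z \<in> U'' (Suc (Suc k))" "\<beta> y - d'' (Suc k) z \<in> V'' (Suc k)"
  obtains x y2 where "x \<in> U (Suc k)" "y2 \<in> U' (Suc (Suc k))" "(y - d' (Suc k) y2) - \<alpha> x \<in> V' (Suc k)"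
proof -
  obtain y2 where y2: "y2 \<in> U' (Suc (Suc k))" "z - \<beta> y2 \<in> V'' (Suc (Suc k))"
    using surj z by blast
  have "\<beta> (y - d' (Suc k) y2) = (\<beta> y - d'' (Suc k) z) + d'' (Suc k) (z - \<beta> y2)
      - (\<beta> (d' (Suc k) y2) - d'' (Suc k) (\<beta> y2))"
    by (simp add: \<beta>_diff Z.d_diff)
  also have "\<dots> \<in> V'' (Suc k)"
    by (intro V_intros z y2 Z.dV \<beta>_comm)
  finally obtain x where "x \<in> U (Suc k)" "(y - d' (Suc k) y2) - \<alpha> x \<in> V' (Suc k)"
    using mid[OF U_intros(4)[OF y Y.dU[OF y2(1)]]] by blast
  then show ?thesis
    using that y2 by blast
qed

lemma exact_mid:
  assumes "X.exact_at k" "Z.exact_at k"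
  shows "Y.exact_at k"
  unfolding Y.exact_at_def
proof (intro ballI impI)
  fix y assume y: "y \<in> U' (Suc k)" "d' k y \<in> V' k"
  have "d'' k (\<beta> y) \<in> V'' k"
    using y \<beta>V d''_\<beta> by blast
  then obtain z where "z \<in> U'' (Suc (Suc k))" "\<beta> y - d'' (Suc k) z \<in> V'' (Suc k)"
    using Z.exact_atD[OF assms(2)] y \<beta>U by blast
  then obtain x y2 where *: "x \<in> U (Suc k)" "y2 \<in> U' (Suc (Suc k))"
      "(y - d' (Suc k) y2) - \<alpha> x \<in> V' (Suc k)"
    using lift_boundary y by blast
  have "d' k (\<alpha> x) = d' k y - d' k (d' (Suc k) y2) - d' k ((y - d' (Suc k) y2) - \<alpha> x)"
    by (simp add: Y.d_diff)
  also have "\<dots> \<in> V' k"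
    by (intro V_intros y * Y.dV Y.dd)
  finally have "d k x \<in> V k"
    using * inj d'_\<alpha> X.dU by blast
  then obtain x2 where x2: "x2 \<in> U (Suc (Suc k))" "x - d (Suc k) x2 \<in> V (Suc k)"
    using X.exact_atD[OF assms(1)] * by blast
  have "y - d' (Suc k) (y2 + \<alpha> x2) = ((y - d' (Suc k) y2) - \<alpha> x) + \<alpha> (x - d (Suc k) x2)
      + (\<alpha> (d (Suc k) x2) - d' (Suc k) (\<alpha> x2))"
    by (simp add: Y.d_add \<alpha>_diff)
  also have "\<dots> \<in> V' (Suc k)"
    by (intro V_intros * \<alpha>V x2 \<alpha>_comm)
  finally show "\<exists>y'\<in>U' (Suc (Suc k)). y - d' (Suc k) y' \<in> V' (Suc k)"
    using U_intros(3)[OF *(2) \<alpha>U[OF x2(1)]] by blast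
qed

text \<open>Moving \<open>y\<close> by \<open>\<alpha> x\<close> does not change its class in the
  third complex, so it suffices that \<open>y - \<alpha> x\<close> be a cycle. In the lowest degree
  x = 0 serves; above it \<open>x\<close> cancels the connecting class.\<close>

lemma exact_right_aux:
  assumes "Y.exact_at k" and y: "y \<in> U' (Suc k)" and x: "x \<in> U (Suc k)"
    and yx: "d' k (y - \<alpha> x) \<in> V' k"
  shows "\<exists>z2\<in>U'' (Suc (Suc k)). \<beta> y - d'' (Suc k) z2 \<in> V'' (Suc k)"
proof -
  obtain y2 where y2: "y2 \<in> U' (Suc (Suc k))" "y - \<alpha> x - d' (Suc k) y2 \<in> V' (Suc k)"
    using Y.exact_atD[OF assms(1) U_intros(4)[OF y \<alpha>U[OF x]] yx] by blast
  have "\<beta> y - d'' (Suc k) (\<beta> y2) = \<beta> (y - \<alpha> x - d' (Suc k) y2) + \<beta> (\<alpha> x)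
      + (\<beta> (d' (Suc k) y2) - d'' (Suc k) (\<beta> y2))"
    by (simp add: \<beta>_diff)
  also have "\<dots> \<in> V'' (Suc k)"
    by (intro V_intros y2 \<beta>V \<beta>\<alpha> x \<beta>_comm)
  finally show ?thesis
    using y2 \<beta>U by blast
qed

lemma exact_right_from_lift:
  assumes "\<And>y. y \<in> U' (Suc k) \<Longrightarrow> d'' k (\<beta> y) \<in> V'' k \<Longrightarrow>
      \<exists>z2\<in>U'' (Suc (Suc k)). \<beta> y - d'' (Suc k) z2 \<in> V'' (Suc k)"
  shows "Z.exact_at k"
  unfolding Z.exact_at_def
proof (intro ballI impI)
  fix z assume z: "z \<in> U'' (Suc k)" "d'' k z \<in> V'' k"
  obtain y where y: "y \<in> U' (Suc k)" "z - \<beta> y \<in> V'' (Suc k)"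
    using surj z by blast
  have "d'' k (\<beta> y) = d'' k z - d'' k (z - \<beta> y)"
    by (simp add: Z.d_diff)
  also have "\<dots> \<in> V'' k"
    by (intro V_intros z Z.dV y)
  finally obtain z2 where z2: "z2 \<in> U'' (Suc (Suc k))" "\<beta> y - d'' (Suc k) z2 \<in> V'' (Suc k)"
    using assms y by blast
  have "z - d'' (Suc k) z2 = (z - \<beta> y) + (\<beta> y - d'' (Suc k) z2)"
    by simp
  also have "\<dots> \<in> V'' (Suc k)"
    by (intro V_intros y z2)
  finally show "\<exists>z2\<in>U'' (Suc (Suc k)). z - d'' (Suc k) z2 \<in> V'' (Suc k)"
    using z2 by blast
qed

text \<open>Below the lowest degree the middle complex is zero, so every lift \<open>y\<close> is a
  cycle and no connecting map intervenes.\<close>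

lemma exact_right_0:
  assumes "Y.exact_at 0" "U' 0 \<subseteq> V' 0"
  shows "Z.exact_at 0"
proof (rule exact_right_from_lift)
  fix y assume y: "y \<in> U' (Suc 0)"
  show "\<exists>z2\<in>U'' (Suc (Suc 0)). \<beta> y - d'' (Suc 0) z2 \<in> V'' (Suc 0)"
    using exact_right_aux[OF assms(1) y diff_closed_zero[OF X.U]]
      Y.dU[OF U_intros(4)[OF y \<alpha>U[OF diff_closed_zero[OF X.U]]]] assms(2) by blast
qed

text \<open>The connecting map sends the class of \<open>\<beta> y\<close> to that of
  \<open>x\<close>, where \<open>\<alpha> x\<close> represents the boundary of \<open>y\<close>. By
  exactness of the first complex \<open>x\<close> is itself the boundary of some \<open>x2\<close>,
  and then \<open>y - \<alpha> x2\<close> is a cycle.\<close>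

lemma exact_right:
  assumes "Y.exact_at (Suc k)" "X.exact_at k"
  shows "Z.exact_at (Suc k)"
proof (rule exact_right_from_lift)
  fix y assume y: "y \<in> U' (Suc (Suc k))" "d'' (Suc k) (\<beta> y) \<in> V'' (Suc k)"
  then have "\<beta> (d' (Suc k) y) \<in> V'' (Suc k)"
    using d''_\<beta> by blast
  then obtain x where x: "x \<in> U (Suc k)" "d' (Suc k) y - \<alpha> x \<in> V' (Suc k)"
    using mid Y.dU y by blast
  have "d' k (\<alpha> x) = d' k (d' (Suc k) y) - d' k (d' (Suc k) y - \<alpha> x)"
    by (simp add: Y.d_diff)
  also have "\<dots> \<in> V' k"
    by (intro V_intros x y Y.dV Y.dd)
  finally have "d k x \<in> V k"
    using x inj d'_\<alpha> X.dU by blast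
  then obtain x2 where x2: "x2 \<in> U (Suc (Suc k))" "x - d (Suc k) x2 \<in> V (Suc k)"
    using X.exact_atD[OF assms(2)] x by blast
  have "d' (Suc k) (y - \<alpha> x2) = (d' (Suc k) y - \<alpha> x) + \<alpha> (x - d (Suc k) x2)
      + (\<alpha> (d (Suc k) x2) - d' (Suc k) (\<alpha> x2))"
    by (simp add: Y.d_diff \<alpha>_diff)
  also have "\<dots> \<in> V' (Suc k)"
    by (intro V_intros x x2 \<alpha>V \<alpha>_comm)
  finally show "\<exists>z2\<in>U'' (Suc (Suc (Suc k))). \<beta> y - d'' (Suc (Suc k)) z2 \<in> V'' (Suc (Suc k))"
    using exact_right_aux[OF assms(1)] y x2 by blast
qed

text \<open>The connecting map read backwards: \<open>\<alpha> x\<close> is the boundary of some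
  \<open>y\<close> whose image is a cycle of the third complex. Exactness there lets
  \<open>y\<close> be corrected to come from some \<open>x2\<close>, and \<open>x\<close> is the
  boundary of this \<open>x2\<close>.\<close>

lemma exact_left:
  assumes "Z.exact_at (Suc k)" "Y.exact_at k"
  shows "X.exact_at k"
  unfolding X.exact_at_def
proof (intro ballI impI)
  fix x assume x: "x \<in> U (Suc k)" "d k x \<in> V k"
  then have "d' k (\<alpha> x) \<in> V' k"
    using d'_\<alpha> \<alpha>V by blast
  then obtain y where y: "y \<in> U' (Suc (Suc k))" "\<alpha> x - d' (Suc k) y \<in> V' (Suc k)"
    using Y.exact_atD[OF assms(2)] x \<alpha>U by blast
  have "\<beta> (d' (Suc k) y) = \<beta> (\<alpha> x) - \<beta> (\<alpha> x - d' (Suc k) y)"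
    by (simp add: \<beta>_diff)
  also have "\<dots> \<in> V'' (Suc k)"
    by (intro V_intros x y \<beta>V \<beta>\<alpha>)
  finally have "d'' (Suc k) (\<beta> y) \<in> V'' (Suc k)"
    using d''_\<beta> y by blast
  then obtain z where "z \<in> U'' (Suc (Suc (Suc k)))" "\<beta> y - d'' (Suc (Suc k)) z \<in> V'' (Suc (Suc k))"
    using Z.exact_atD[OF assms(1)] y \<beta>U by blast
  then obtain x2 y2 where *: "x2 \<in> U (Suc (Suc k))" "y2 \<in> U' (Suc (Suc (Suc k)))"
      "(y - d' (Suc (Suc k)) y2) - \<alpha> x2 \<in> V' (Suc (Suc k))"
    using lift_boundary y by blast
  have "\<alpha> (x - d (Suc k) x2) = (\<alpha> x - d' (Suc k) y) + d' (Suc k) (d' (Suc (Suc k)) y2)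
      + d' (Suc k) ((y - d' (Suc (Suc k)) y2) - \<alpha> x2)
      - (\<alpha> (d (Suc k) x2) - d' (Suc k) (\<alpha> x2))"
    by (simp add: Y.d_diff \<alpha>_diff)
  also have "\<dots> \<in> V' (Suc k)"
    by (intro V_intros y * \<alpha>_comm Y.dV Y.dd)
  finally show "\<exists>x2\<in>U (Suc (Suc k)). x - d (Suc k) x2 \<in> V (Suc k)"
    using inj[OF U_intros(2)[OF x(1) X.dU[OF *(1)]]] *(1) by blast
qed

end

section \<open>Left modules over an arbitrary ring: submodules, homomorphisms, kernels and
  images\<close>

section \<open>Modules and homomorphisms\<close>

context left_module
begin

lemma smult_r_null: "r \<in> carrier R \<Longrightarrow> r \<odot>\<^bsub>M\<^esub> \<zero>\<^bsub>M\<^esub> = \<zero>\<^bsub>M\<^esub>"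
  using smult_r_distr[of r "\<zero>\<^bsub>M\<^esub>" "\<zero>\<^bsub>M\<^esub>"] smult_closed[of r "\<zero>\<^bsub>M\<^esub>"]
  by (simp add: M.add.r_cancel_one')

lemma smult_l_null: "x \<in> carrier M \<Longrightarrow> \<zero>\<^bsub>R\<^esub> \<odot>\<^bsub>M\<^esub> x = \<zero>\<^bsub>M\<^esub>"
  using smult_l_distr[of "\<zero>\<^bsub>R\<^esub>" "\<zero>\<^bsub>R\<^esub>" x] smult_closed[of "\<zero>\<^bsub>R\<^esub>" x]
  by (simp add: M.add.r_cancel_one')

lemma smult_r_minus: "r \<in> carrier R \<Longrightarrow> x \<in> carrier M \<Longrightarrow> r \<odot>\<^bsub>M\<^esub> (\<ominus>\<^bsub>M\<^esub> x) = \<ominus>\<^bsub>M\<^esub> (r \<odot>\<^bsub>M\<^esub> x)"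
  using smult_r_distr[of r "\<ominus>\<^bsub>M\<^esub> x" x] smult_closed[of r x] smult_closed[of r "\<ominus>\<^bsub>M\<^esub> x"]
    M.add.inv_equality[of "r \<odot>\<^bsub>M\<^esub> (\<ominus>\<^bsub>M\<^esub> x)" "r \<odot>\<^bsub>M\<^esub> x"]
  by (simp add: M.l_neg smult_r_null)

lemma smult_finsum:
  assumes "r \<in> carrier R" "finite A" "f \<in> A \<rightarrow> carrier M"
  shows "r \<odot>\<^bsub>M\<^esub> finsum M f A = finsum M (\<lambda>i. r \<odot>\<^bsub>M\<^esub> f i) A"
  using assms(2,3,1)
  by (induction A rule: finite_induct)
    (auto simp: smult_r_null smult_r_distr smult_closed Pi_def M.finsum_closed)

lemma submoduleI:
  assumes "H \<subseteq> carrier M" "\<zero>\<^bsub>M\<^esub> \<in> H"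
    and "\<And>x y. x \<in> H \<Longrightarrow> y \<in> H \<Longrightarrow> x \<oplus>\<^bsub>M\<^esub> y \<in> H"
    and "\<And>r x. r \<in> carrier R \<Longrightarrow> x \<in> H \<Longrightarrow> r \<odot>\<^bsub>M\<^esub> x \<in> H"
  shows "submodule H R M"
proof -
  have "\<ominus>\<^bsub>M\<^esub> x \<in> H" if "x \<in> H" for x
  proof -
    have x: "x \<in> carrier M" using that assms by auto
    have "(\<ominus>\<^bsub>R\<^esub> \<one>\<^bsub>R\<^esub>) \<odot>\<^bsub>M\<^esub> x \<oplus>\<^bsub>M\<^esub> x = \<zero>\<^bsub>M\<^esub>"
      using smult_l_distr[of "\<ominus>\<^bsub>R\<^esub> \<one>\<^bsub>R\<^esub>" "\<one>\<^bsub>R\<^esub>" x] x by (simp add: smult_one R.l_neg smult_l_null)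
    then have "\<ominus>\<^bsub>M\<^esub> x = (\<ominus>\<^bsub>R\<^esub> \<one>\<^bsub>R\<^esub>) \<odot>\<^bsub>M\<^esub> x"
      using x smult_closed[of "\<ominus>\<^bsub>R\<^esub> \<one>\<^bsub>R\<^esub>" x] M.add.inv_equality by simp
    then show ?thesis using assms that by simp
  qed
  then show ?thesis
    using assms by (intro submodule.intro subgroup.intro) (auto simp: submodule_axioms_def a_inv_def)
qed

lemma submoduleD:
  assumes "submodule H R M"
  shows "H \<subseteq> carrier M" "\<zero>\<^bsub>M\<^esub> \<in> H"
    and "x \<in> H \<Longrightarrow> y \<in> H \<Longrightarrow> x \<oplus>\<^bsub>M\<^esub> y \<in> H"
    and "x \<in> H \<Longrightarrow> \<ominus>\<^bsub>M\<^esub> x \<in> H"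
    and "r \<in> carrier R \<Longrightarrow> x \<in> H \<Longrightarrow> r \<odot>\<^bsub>M\<^esub> x \<in> H"
proof -
  interpret submodule H R M by fact
  show "H \<subseteq> carrier M" "\<zero>\<^bsub>M\<^esub> \<in> H"
     "x \<in> H \<Longrightarrow> y \<in> H \<Longrightarrow> x \<oplus>\<^bsub>M\<^esub> y \<in> H"
     "x \<in> H \<Longrightarrow> \<ominus>\<^bsub>M\<^esub> x \<in> H"
     "r \<in> carrier R \<Longrightarrow> x \<in> H \<Longrightarrow> r \<odot>\<^bsub>M\<^esub> x \<in> H"
    using subset one_closed m_closed m_inv_closed by (auto simp: a_inv_def)
qed

lemma submodule_left_module:
  assumes "submodule H R M"
  shows "left_module R (M\<lparr>carrier := H\<rparr>)"
proof -
  note H = submoduleD[OF assms] and HM = subsetD[OF submoduleD(1)[OF assms]]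
  have "abelian_group (M\<lparr>carrier := H\<rparr>)"
  proof (rule abelian_groupI)
    fix x assume "x \<in> carrier (M\<lparr>carrier := H\<rparr>)"
    then show "\<exists>y\<in>carrier (M\<lparr>carrier := H\<rparr>). y \<oplus>\<^bsub>M\<lparr>carrier := H\<rparr>\<^esub> x = \<zero>\<^bsub>M\<lparr>carrier := H\<rparr>\<^esub>"
      using H(4)[of x] HM M.l_neg by auto
  qed (use H HM in \<open>auto simp: M.add.m_ac\<close>)
  then show ?thesis
    unfolding left_module_def left_module_axioms_def
    using H HM R.ring_axioms by (auto simp: smult_l_distr smult_r_distr smult_assoc smult_one)
qed

end

lemma left_moduleI:
  assumes "ring R" "abelian_group M"
    and "\<And>r x. r \<in> carrier R \<Longrightarrow> x \<in> carrier M \<Longrightarrow> r \<odot>\<^bsub>M\<^esub> x \<in> carrier M"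
    and "\<And>r s x. \<lbrakk>r \<in> carrier R; s \<in> carrier R; x \<in> carrier M\<rbrakk> \<Longrightarrow>
      (r \<oplus>\<^bsub>R\<^esub> s) \<odot>\<^bsub>M\<^esub> x = r \<odot>\<^bsub>M\<^esub> x \<oplus>\<^bsub>M\<^esub> s \<odot>\<^bsub>M\<^esub> x"
    and "\<And>r x y. \<lbrakk>r \<in> carrier R; x \<in> carrier M; y \<in> carrier M\<rbrakk> \<Longrightarrow>
      r \<odot>\<^bsub>M\<^esub> (x \<oplus>\<^bsub>M\<^esub> y) = r \<odot>\<^bsub>M\<^esub> x \<oplus>\<^bsub>M\<^esub> r \<odot>\<^bsub>M\<^esub> y"
    and "\<And>r s x. \<lbrakk>r \<in> carrier R; s \<in> carrier R; x \<in> carrier M\<rbrakk> \<Longrightarrow>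
      (r \<otimes>\<^bsub>R\<^esub> s) \<odot>\<^bsub>M\<^esub> x = r \<odot>\<^bsub>M\<^esub> (s \<odot>\<^bsub>M\<^esub> x)"
    and "\<And>x. x \<in> carrier M \<Longrightarrow> \<one>\<^bsub>R\<^esub> \<odot>\<^bsub>M\<^esub> x = x"
  shows "left_module R M"
  using assms unfolding left_module_def left_module_axioms_def by auto

lemma lhom_closed: "h \<in> lhom R A B \<Longrightarrow> x \<in> carrier A \<Longrightarrow> h x \<in> carrier B"
  and lhom_add: "h \<in> lhom R A B \<Longrightarrow> x \<in> carrier A \<Longrightarrow> y \<in> carrier A \<Longrightarrow> h (x \<oplus>\<^bsub>A\<^esub> y) = h x \<oplus>\<^bsub>B\<^esub> h y"
  and lhom_smult: "h \<in> lhom R A B \<Longrightarrow> r \<in> carrier R \<Longrightarrow> x \<in> carrier A \<Longrightarrow> h (r \<odot>\<^bsub>A\<^esub> x) = r \<odot>\<^bsub>B\<^esub> h x"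
  and lhom_extensional: "h \<in> lhom R A B \<Longrightarrow> h \<in> extensional (carrier A)"
  unfolding lhom_def by (auto simp: PiE_def)

lemma lhom_restrictI:
  assumes "left_module R A"
    and "\<And>x. x \<in> carrier A \<Longrightarrow> f x \<in> carrier B"
    and "\<And>x y. x \<in> carrier A \<Longrightarrow> y \<in> carrier A \<Longrightarrow> f (x \<oplus>\<^bsub>A\<^esub> y) = f x \<oplus>\<^bsub>B\<^esub> f y"
    and "\<And>r x. r \<in> carrier R \<Longrightarrow> x \<in> carrier A \<Longrightarrow> f (r \<odot>\<^bsub>A\<^esub> x) = r \<odot>\<^bsub>B\<^esub> f x"
  shows "(\<lambda>x\<in>carrier A. f x) \<in> lhom R A B"
proof -
  interpret A: left_module R A by fact
  show ?thesis
    unfolding lhom_def using assms(2-) A.smult_closed by auto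
qed

lemma lhom_eqI:
  assumes "g \<in> lhom R A B" "h \<in> lhom R A B'" "\<And>x. x \<in> carrier A \<Longrightarrow> g x = h x"
  shows "g = h"
  using lhom_extensional[OF assms(1)] lhom_extensional[OF assms(2)] assms(3)
  by (rule extensionalityI)

lemma lhom_compose:
  assumes "left_module R A" "f \<in> lhom R A B" "g \<in> lhom R B C"
  shows "compose (carrier A) g f \<in> lhom R A C"
  unfolding compose_def
  by (rule lhom_restrictI[OF assms(1)])
    (auto simp: assms lhom_closed[OF assms(2)] lhom_add[OF assms(2)] lhom_smult[OF assms(2)]
      lhom_closed[OF assms(3)] lhom_add[OF assms(3)] lhom_smult[OF assms(3)])

lemma lhom_id: "left_module R A \<Longrightarrow> (\<lambda>x\<in>carrier A. x) \<in> lhom R A A"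
  by (rule lhom_restrictI) auto

lemma lhom_zero:
  assumes "left_module R A" "left_module R B" "h \<in> lhom R A B"
  shows "h \<zero>\<^bsub>A\<^esub> = \<zero>\<^bsub>B\<^esub>"
proof -
  interpret A: left_module R A by fact
  interpret B: left_module R B by fact
  show ?thesis
    using lhom_add[OF assms(3), of "\<zero>\<^bsub>A\<^esub>" "\<zero>\<^bsub>A\<^esub>"] lhom_closed[OF assms(3), of "\<zero>\<^bsub>A\<^esub>"]
    by (simp add: B.M.add.r_cancel_one')
qed

lemma lhom_minus:
  assumes "left_module R A" "left_module R B" "h \<in> lhom R A B" "x \<in> carrier A"
  shows "h (\<ominus>\<^bsub>A\<^esub> x) = \<ominus>\<^bsub>B\<^esub> h x"
proof -
  interpret A: left_module R A by fact
  interpret B: left_module R B by fact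
  have "h (\<ominus>\<^bsub>A\<^esub> x) \<oplus>\<^bsub>B\<^esub> h x = \<zero>\<^bsub>B\<^esub>"
    using lhom_add[OF assms(3), of "\<ominus>\<^bsub>A\<^esub> x" x] assms lhom_zero[OF assms(1-3)] by (simp add: A.M.l_neg)
  then show ?thesis
    using lhom_closed[OF assms(3)] assms(4) B.M.add.inv_equality by simp
qed

lemma lhom_diff:
  assumes "left_module R A" "left_module R B" "h \<in> lhom R A B" "x \<in> carrier A" "y \<in> carrier A"
  shows "h (x \<ominus>\<^bsub>A\<^esub> y) = h x \<ominus>\<^bsub>B\<^esub> h y"
proof -
  interpret A: left_module R A by fact
  show ?thesis
    using assms by (simp add: a_minus_def lhom_add[OF assms(3)] lhom_minus[OF assms(1-3)])
qed

lemma lhom_finsum: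
  assumes "left_module R A" "left_module R B" "h \<in> lhom R A B" "finite X" "f \<in> X \<rightarrow> carrier A"
  shows "h (finsum A f X) = finsum B (\<lambda>i. h (f i)) X"
proof -
  interpret A: left_module R A by fact
  interpret B: left_module R B by fact
  show ?thesis
    using assms(4,5)
  proof (induction X rule: finite_induct)
    case empty
    then show ?case by (simp add: lhom_zero[OF assms(1-3)])
  next
    case (insert x X)
    then have "f \<in> X \<rightarrow> carrier A" "f x \<in> carrier A" by auto
    with insert show ?case
      by (simp add: Pi_def lhom_closed[OF assms(3)] lhom_add[OF assms(3)] A.M.finsum_closed)
  qed
qed

lemma mem_a_kernel: "x \<in> a_kernel A B h \<longleftrightarrow> x \<in> carrier A \<and> h x = \<zero>\<^bsub>B\<^esub>"
  by (simp add: a_kernel_def kernel_def)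

lemma submodule_kernel:
  assumes "left_module R A" "left_module R B" "h \<in> lhom R A B"
  shows "submodule (a_kernel A B h) R A"
proof -
  interpret A: left_module R A by fact
  interpret B: left_module R B by fact
  show ?thesis
    by (rule A.submoduleI)
      (auto simp: mem_a_kernel lhom_zero[OF assms] lhom_add[OF assms(3)] lhom_smult[OF assms(3)]
        A.smult_closed B.smult_r_null)
qed

lemma submodule_image:
  assumes "left_module R A" "left_module R B" "h \<in> lhom R A B"
  shows "submodule (h ` carrier A) R B"
proof -
  interpret A: left_module R A by fact
  interpret B: left_module R B by fact
  show ?thesis
  proof (rule B.submoduleI)
    show "\<zero>\<^bsub>B\<^esub> \<in> h ` carrier A"
      using lhom_zero[OF assms] by force
  qed (auto simp: lhom_closed[OF assms(3)] lhom_add[OF assms(3), symmetric]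
      lhom_smult[OF assms(3), symmetric] A.smult_closed)
qed

lemma lhom_restrict_codomain:
  "h \<in> lhom R A (B\<lparr>carrier := H\<rparr>) \<longleftrightarrow> h ` carrier A \<subseteq> H \<and> h \<in> extensional (carrier A) \<and>
    (\<forall>x\<in>carrier A. \<forall>y\<in>carrier A. h (x \<oplus>\<^bsub>A\<^esub> y) = h x \<oplus>\<^bsub>B\<^esub> h y) \<and>
    (\<forall>r\<in>carrier R. \<forall>x\<in>carrier A. h (r \<odot>\<^bsub>A\<^esub> x) = r \<odot>\<^bsub>B\<^esub> h x)"
  by (auto simp: lhom_def PiE_def)

section \<open>Cosets and the induced module structure\<close>

section \<open>Quotient modules\<close>

locale left_submodule = left_module R M for R :: "('r, 'k) ring_scheme" and M :: "('r, 'a) module" +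
  fixes N
  assumes sub: "submodule N R M"
begin

sublocale Q: abelian_subgroup N M
  by (intro abelian_subgroupI3 additive_subgroupI)
    (use sub M.abelian_group_axioms in \<open>auto simp: submodule_def\<close>)

abbreviation cls where "cls x \<equiv> N +>\<^bsub>M\<^esub> x"

lemma N: "N \<subseteq> carrier M" "\<zero>\<^bsub>M\<^esub> \<in> N" "x \<in> N \<Longrightarrow> y \<in> N \<Longrightarrow> x \<oplus>\<^bsub>M\<^esub> y \<in> N"
    "x \<in> N \<Longrightarrow> \<ominus>\<^bsub>M\<^esub> x \<in> N" "r \<in> carrier R \<Longrightarrow> x \<in> N \<Longrightarrow> r \<odot>\<^bsub>M\<^esub> x \<in> N"
  using submoduleD[OF sub] by auto

lemma carrier_quotient: "carrier (quotient_module M N) = cls ` carrier M"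
  by (auto simp: quotient_module_def A_RCOSETS_def')

lemma cls_add:
  "x \<in> carrier M \<Longrightarrow> y \<in> carrier M \<Longrightarrow> cls x \<oplus>\<^bsub>quotient_module M N\<^esub> cls y = cls (x \<oplus>\<^bsub>M\<^esub> y)"
  by (simp add: quotient_module_def Q.a_rcos_sum)

text \<open>Multiplying a coset by \<open>r\<close> elementwise may give only part of a coset;
  adding \<open>N\<close>, as \<open>quotient_module\<close> does, completes it.\<close>

lemma cls_smult:
  assumes "r \<in> carrier R" "x \<in> carrier M"
  shows "r \<odot>\<^bsub>quotient_module M N\<^esub> cls x = cls (r \<odot>\<^bsub>M\<^esub> x)"
proof -
  have "(\<Union>h\<in>N. \<Union>k\<in>N. {h \<oplus>\<^bsub>M\<^esub> r \<odot>\<^bsub>M\<^esub> (k \<oplus>\<^bsub>M\<^esub> x)}) = (\<Union>h\<in>N. {h \<oplus>\<^bsub>M\<^esub> r \<odot>\<^bsub>M\<^esub> x})" (is "?L = ?R")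
  proof
    show "?L \<subseteq> ?R"
    proof safe
      fix h k assume hk: "h \<in> N" "k \<in> N"
      then have "h \<oplus>\<^bsub>M\<^esub> r \<odot>\<^bsub>M\<^esub> (k \<oplus>\<^bsub>M\<^esub> x) = (h \<oplus>\<^bsub>M\<^esub> r \<odot>\<^bsub>M\<^esub> k) \<oplus>\<^bsub>M\<^esub> r \<odot>\<^bsub>M\<^esub> x"
        using assms N(1) by (simp add: smult_r_distr smult_closed M.add.m_assoc subset_iff)
      then show "h \<oplus>\<^bsub>M\<^esub> r \<odot>\<^bsub>M\<^esub> (k \<oplus>\<^bsub>M\<^esub> x) \<in> ?R"
        using hk N assms by auto
    qed
    show "?R \<subseteq> ?L"
    proof safe
      fix h assume h: "h \<in> N"
      have "h \<oplus>\<^bsub>M\<^esub> r \<odot>\<^bsub>M\<^esub> x = h \<oplus>\<^bsub>M\<^esub> r \<odot>\<^bsub>M\<^esub> (\<zero>\<^bsub>M\<^esub> \<oplus>\<^bsub>M\<^esub> x)"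
        using assms by simp
      then show "h \<oplus>\<^bsub>M\<^esub> r \<odot>\<^bsub>M\<^esub> x \<in> ?L"
        using h N(2) by blast
    qed
  qed
  then show ?thesis
    by (simp add: quotient_module_def a_r_coset_def' set_add_def')
qed

lemma cls_eq_iff: "x \<in> carrier M \<Longrightarrow> y \<in> carrier M \<Longrightarrow> cls x = cls y \<longleftrightarrow> x \<ominus>\<^bsub>M\<^esub> y \<in> N"
  using Q.a_rcos_module[of y x] M.a_repr_independence[of x N y] Q.a_rcos_self[of x] Q.a_subgroup
  unfolding a_minus_def by metis

lemma zero_quotient: "\<zero>\<^bsub>quotient_module M N\<^esub> = N"
  by (simp add: quotient_module_def)

lemma cls_eq_zero_iff: "x \<in> carrier M \<Longrightarrow> cls x = N \<longleftrightarrow> x \<in> N"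
  using Q.a_rcos_self[of x] Q.a_rcos_const[of x] by auto

lemma left_module_quotient: "left_module R (quotient_module M N)" (is "left_module R ?Q")
proof -
  have zero: "\<zero>\<^bsub>?Q\<^esub> = cls \<zero>\<^bsub>M\<^esub>"
    using N by (simp add: zero_quotient cls_eq_zero_iff)
  have "abelian_group ?Q"
  proof (rule abelian_groupI)
    fix x assume "x \<in> carrier ?Q"
    then obtain y where y: "y \<in> carrier M" "x = cls y" by (auto simp: carrier_quotient)
    then show "\<exists>z\<in>carrier ?Q. z \<oplus>\<^bsub>?Q\<^esub> x = \<zero>\<^bsub>?Q\<^esub>"
      by (intro bexI[of _ "cls (\<ominus>\<^bsub>M\<^esub> y)"]) (auto simp: zero carrier_quotient cls_add M.l_neg)
  qed (auto simp: zero carrier_quotient cls_add M.add.m_ac)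
  then show ?thesis
    by (intro left_moduleI R.ring_axioms)
      (auto simp: carrier_quotient cls_add cls_smult smult_closed smult_l_distr smult_r_distr
        smult_assoc smult_one)
qed

lemma cls_lhom: "(\<lambda>x\<in>carrier M. cls x) \<in> lhom R M (quotient_module M N)"
  by (rule lhom_restrictI) (auto simp: left_module_axioms carrier_quotient cls_add cls_smult)

end

section \<open>Free modules, the dual basis lemma, and lifting\<close>

section \<open>Projective modules\<close>

definition lin_comb :: "('r, 'k) ring_scheme \<Rightarrow> ('r, 'a, 'm) module_scheme \<Rightarrow> ('i \<Rightarrow> 'r) \<Rightarrow> ('i \<Rightarrow> 'a) \<Rightarrow> 'a" where
  "lin_comb R M c a = finsum M (\<lambda>x. c x \<odot>\<^bsub>M\<^esub> a x) {x. c x \<noteq> \<zero>\<^bsub>R\<^esub>}"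

text \<open>The coefficients are functions on the whole index type that vanish off \<open>G\<close>.
  For indices taken from a module \<open>P\<close> their type is the one from which
  \<open>projective_module\<close> draws its test modules.\<close>

definition free_mod :: "('r, 'k) ring_scheme \<Rightarrow> 'i set \<Rightarrow> ('r, 'i \<Rightarrow> 'r) module" where
  "free_mod R G = \<lparr>carrier = {c. (\<forall>x. c x \<in> carrier R) \<and> {x. c x \<noteq> \<zero>\<^bsub>R\<^esub>} \<subseteq> G \<and> finite {x. c x \<noteq> \<zero>\<^bsub>R\<^esub>}},
     monoid.mult = undefined, one = undefined, ring.zero = (\<lambda>_. \<zero>\<^bsub>R\<^esub>),
     add = (\<lambda>c c' x. c x \<oplus>\<^bsub>R\<^esub> c' x), smult = (\<lambda>r c x. r \<otimes>\<^bsub>R\<^esub> c x)\<rparr>"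

lemma mem_free_mod: "c \<in> carrier (free_mod R G) \<longleftrightarrow>
    (\<forall>x. c x \<in> carrier R) \<and> {x. c x \<noteq> \<zero>\<^bsub>R\<^esub>} \<subseteq> G \<and> finite {x. c x \<noteq> \<zero>\<^bsub>R\<^esub>}"
  and free_mod_add: "c \<oplus>\<^bsub>free_mod R G\<^esub> c' = (\<lambda>x. c x \<oplus>\<^bsub>R\<^esub> c' x)"
  and free_mod_smult: "r \<odot>\<^bsub>free_mod R G\<^esub> c = (\<lambda>x. r \<otimes>\<^bsub>R\<^esub> c x)"
  and free_mod_zero: "\<zero>\<^bsub>free_mod R G\<^esub> = (\<lambda>_. \<zero>\<^bsub>R\<^esub>)"
  by (auto simp: free_mod_def)

lemma left_module_free_mod:
  assumes "ring R"
  shows "left_module R (free_mod R G)"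
proof -
  interpret R: ring R by fact
  have add_cl: "c \<oplus>\<^bsub>free_mod R G\<^esub> c' \<in> carrier (free_mod R G)"
    if "c \<in> carrier (free_mod R G)" "c' \<in> carrier (free_mod R G)" for c c'
  proof -
    have "{x. c x \<oplus>\<^bsub>R\<^esub> c' x \<noteq> \<zero>\<^bsub>R\<^esub>} \<subseteq> {x. c x \<noteq> \<zero>\<^bsub>R\<^esub>} \<union> {x. c' x \<noteq> \<zero>\<^bsub>R\<^esub>}" by auto
    then show ?thesis
      using that unfolding mem_free_mod free_mod_add
      by (meson R.add.m_closed Un_subset_iff finite_Un finite_subset order_trans)
  qed
  have smult_cl: "r \<odot>\<^bsub>free_mod R G\<^esub> c \<in> carrier (free_mod R G)"
    if "r \<in> carrier R" "c \<in> carrier (free_mod R G)" for r c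
  proof -
    have "{x. r \<otimes>\<^bsub>R\<^esub> c x \<noteq> \<zero>\<^bsub>R\<^esub>} \<subseteq> {x. c x \<noteq> \<zero>\<^bsub>R\<^esub>}" using that by auto
    then show ?thesis
      using that unfolding mem_free_mod free_mod_smult
      by (meson R.m_closed finite_subset order_trans)
  qed
  show ?thesis
  proof (rule left_moduleI[OF assms abelian_groupI])
    fix c assume c: "c \<in> carrier (free_mod R G)"
    then have "{x. \<ominus>\<^bsub>R\<^esub> c x \<noteq> \<zero>\<^bsub>R\<^esub>} = {x. c x \<noteq> \<zero>\<^bsub>R\<^esub>}"
      by (auto simp: mem_free_mod R.minus_equality)
    with c show "\<exists>c'\<in>carrier (free_mod R G). c' \<oplus>\<^bsub>free_mod R G\<^esub> c = \<zero>\<^bsub>free_mod R G\<^esub>"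
      by (intro bexI[of _ "\<lambda>x. \<ominus>\<^bsub>R\<^esub> c x"])
        (auto simp: mem_free_mod free_mod_add free_mod_zero R.l_neg)
  qed (auto intro: add_cl smult_cl, auto simp: mem_free_mod free_mod_add free_mod_smult free_mod_zero
      R.add.m_ac R.l_distr R.r_distr R.m_assoc)
qed

context left_module
begin

text \<open>\<open>lin_comb\<close> sums over the support, which changes with the coefficients; this
  allows several combinations to be compared over one finite set.\<close>

lemma lin_comb_superset:
  assumes c: "c \<in> carrier (free_mod R G)" and a: "\<And>x. x \<in> G \<Longrightarrow> a x \<in> carrier M"
    and X: "finite X" "{x. c x \<noteq> \<zero>\<^bsub>R\<^esub>} \<subseteq> X" "X \<subseteq> G"
  shows "lin_comb R M c a = finsum M (\<lambda>x. c x \<odot>\<^bsub>M\<^esub> a x) X"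
  unfolding lin_comb_def
  by (rule M.add.finprod_mono_neutral_cong_left)
    (use assms in \<open>auto simp: mem_free_mod smult_l_null smult_closed\<close>)

lemma lin_comb_closed:
  assumes "c \<in> carrier (free_mod R G)" "\<And>x. x \<in> G \<Longrightarrow> a x \<in> carrier M"
  shows "lin_comb R M c a \<in> carrier M"
  unfolding lin_comb_def using assms
  by (intro M.finsum_closed) (auto simp: mem_free_mod subset_iff intro!: smult_closed)

lemma lin_comb_add:
  assumes c: "c \<in> carrier (free_mod R G)" "c' \<in> carrier (free_mod R G)"
    and a: "\<And>x. x \<in> G \<Longrightarrow> a x \<in> carrier M"
  shows "lin_comb R M (c \<oplus>\<^bsub>free_mod R G\<^esub> c') a = lin_comb R M c a \<oplus>\<^bsub>M\<^esub> lin_comb R M c' a"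
proof -
  interpret F: left_module R "free_mod R G"
    by (rule left_module_free_mod) unfold_locales
  define X where "X = {x. c x \<noteq> \<zero>\<^bsub>R\<^esub>} \<union> {x. c' x \<noteq> \<zero>\<^bsub>R\<^esub>}"
  have X: "finite X" "X \<subseteq> G" "{x. c x \<noteq> \<zero>\<^bsub>R\<^esub>} \<subseteq> X" "{x. c' x \<noteq> \<zero>\<^bsub>R\<^esub>} \<subseteq> X"
    using c by (auto simp: X_def mem_free_mod)
  have X': "{x. (c \<oplus>\<^bsub>free_mod R G\<^esub> c') x \<noteq> \<zero>\<^bsub>R\<^esub>} \<subseteq> X"
    using c by (auto simp: X_def free_mod_add mem_free_mod)
  have cl: "c x \<in> carrier R" "c' x \<in> carrier R" for x using c by (auto simp: mem_free_mod)
  have "lin_comb R M (c \<oplus>\<^bsub>free_mod R G\<^esub> c') a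
      = finsum M (\<lambda>x. (c \<oplus>\<^bsub>free_mod R G\<^esub> c') x \<odot>\<^bsub>M\<^esub> a x) X"
    by (rule lin_comb_superset[OF _ a X(1) X' X(2)]) (use c in auto)
  also have "\<dots> = finsum M (\<lambda>x. c x \<odot>\<^bsub>M\<^esub> a x \<oplus>\<^bsub>M\<^esub> c' x \<odot>\<^bsub>M\<^esub> a x) X"
    by (rule M.finsum_cong') (use a X in \<open>auto simp: free_mod_add smult_l_distr cl smult_closed subset_iff\<close>)
  also have "\<dots> = finsum M (\<lambda>x. c x \<odot>\<^bsub>M\<^esub> a x) X \<oplus>\<^bsub>M\<^esub> finsum M (\<lambda>x. c' x \<odot>\<^bsub>M\<^esub> a x) X"
    by (rule M.finsum_addf) (use a X in \<open>auto simp: cl smult_closed subset_iff\<close>)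
  finally show ?thesis
    using lin_comb_superset[OF c(1) a X(1,3,2)] lin_comb_superset[OF c(2) a X(1,4,2)] by simp
qed

lemma lin_comb_smult:
  assumes r: "r \<in> carrier R" and c: "c \<in> carrier (free_mod R G)"
    and a: "\<And>x. x \<in> G \<Longrightarrow> a x \<in> carrier M"
  shows "lin_comb R M (r \<odot>\<^bsub>free_mod R G\<^esub> c) a = r \<odot>\<^bsub>M\<^esub> lin_comb R M c a"
proof -
  interpret F: left_module R "free_mod R G"
    by (rule left_module_free_mod) unfold_locales
  define X where "X = {x. c x \<noteq> \<zero>\<^bsub>R\<^esub>}"
  have X: "finite X" "X \<subseteq> G"
    using c by (auto simp: X_def mem_free_mod)
  have X': "{x. (r \<odot>\<^bsub>free_mod R G\<^esub> c) x \<noteq> \<zero>\<^bsub>R\<^esub>} \<subseteq> X"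
    using r c by (auto simp: X_def free_mod_smult mem_free_mod)
  have cl: "c x \<in> carrier R" for x using c by (auto simp: mem_free_mod)
  have "lin_comb R M (r \<odot>\<^bsub>free_mod R G\<^esub> c) a
      = finsum M (\<lambda>x. (r \<odot>\<^bsub>free_mod R G\<^esub> c) x \<odot>\<^bsub>M\<^esub> a x) X"
    by (rule lin_comb_superset[OF _ a X(1) X' X(2)]) (use r c in \<open>auto simp: F.smult_closed\<close>)
  also have "\<dots> = finsum M (\<lambda>x. r \<odot>\<^bsub>M\<^esub> (c x \<odot>\<^bsub>M\<^esub> a x)) X"
    by (rule M.finsum_cong') (use r a X in \<open>auto simp: free_mod_smult smult_assoc cl smult_closed subset_iff\<close>)
  also have "\<dots> = r \<odot>\<^bsub>M\<^esub> finsum M (\<lambda>x. c x \<odot>\<^bsub>M\<^esub> a x) X"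
    by (rule smult_finsum[symmetric]) (use r a X in \<open>auto simp: cl smult_closed subset_iff\<close>)
  finally show ?thesis
    by (simp add: lin_comb_def X_def)
qed

lemma lin_comb_hom:
  assumes B: "left_module R B" "q \<in> lhom R M B" and c: "c \<in> carrier (free_mod R G)"
    and a: "\<And>x. x \<in> G \<Longrightarrow> a x \<in> carrier M"
  shows "q (lin_comb R M c a) = lin_comb R B c (\<lambda>x. q (a x))"
proof -
  interpret B: left_module R B by fact
  have cl: "c x \<in> carrier R" "c x \<noteq> \<zero>\<^bsub>R\<^esub> \<Longrightarrow> x \<in> G" for x using c by (auto simp: mem_free_mod)
  have "q (lin_comb R M c a) = finsum B (\<lambda>x. q (c x \<odot>\<^bsub>M\<^esub> a x)) {x. c x \<noteq> \<zero>\<^bsub>R\<^esub>}"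
    unfolding lin_comb_def
    by (rule lhom_finsum) (use c a cl left_module_axioms B in \<open>auto simp: mem_free_mod smult_closed\<close>)
  also have "\<dots> = lin_comb R B c (\<lambda>x. q (a x))"
    unfolding lin_comb_def
    by (rule B.M.finsum_cong')
      (use a cl in \<open>auto simp: lhom_smult[OF B(2)] lhom_closed[OF B(2)] B.smult_closed\<close>)
  finally show ?thesis .
qed

lemma lin_comb_delta:
  assumes "x \<in> G" "a x \<in> carrier M"
  shows "(\<lambda>y. if y = x then \<one>\<^bsub>R\<^esub> else \<zero>\<^bsub>R\<^esub>) \<in> carrier (free_mod R G)" (is "?\<delta> \<in> _")
    and "lin_comb R M (\<lambda>y. if y = x then \<one>\<^bsub>R\<^esub> else \<zero>\<^bsub>R\<^esub>) a = a x"
proof -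
  have sub: "{y. ?\<delta> y \<noteq> \<zero>\<^bsub>R\<^esub>} \<subseteq> {x}" by auto
  then have "finite {y. ?\<delta> y \<noteq> \<zero>\<^bsub>R\<^esub>}" using finite_subset by blast
  then show *: "?\<delta> \<in> carrier (free_mod R G)"
    using assms by (auto simp: mem_free_mod)
  have "?\<delta> \<in> carrier (free_mod R {x})"
    using \<open>finite {y. ?\<delta> y \<noteq> \<zero>\<^bsub>R\<^esub>}\<close> by (auto simp: mem_free_mod)
  then have "lin_comb R M ?\<delta> a = finsum M (\<lambda>y. ?\<delta> y \<odot>\<^bsub>M\<^esub> a y) {x}"
    by (rule lin_comb_superset) (use assms sub in auto)
  also have "\<dots> = a x"
    using assms by (simp add: smult_one)
  finally show "lin_comb R M ?\<delta> a = a x" .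
qed

end

text \<open>\<open>\<phi> p x\<close> is the x-th coordinate of \<open>p\<close>; that
  \<open>\<phi> p\<close> lies in \<open>free_mod\<close> makes almost all coordinates of each
  \<open>p\<close> vanish. Unlike \<open>projective_module\<close>, this form of projectivity
  involves no test modules and hence no restriction on types.\<close>

definition dual_basis :: "('r, 'k) ring_scheme \<Rightarrow> ('r, 'p) module \<Rightarrow> 'p set \<Rightarrow> ('p \<Rightarrow> 'p \<Rightarrow> 'r) \<Rightarrow> bool" where
  "dual_basis R P G \<phi> \<longleftrightarrow> left_module R P \<and> G \<subseteq> carrier P \<and> \<phi> \<in> lhom R P (free_mod R G) \<and>
     (\<forall>p\<in>carrier P. lin_comb R P (\<phi> p) (\<lambda>x. x) = p)"

text \<open>\<open>gen\<close> says that \<open>G\<close> generates \<open>P\<close>, so the free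
  module on \<open>G\<close> maps onto \<open>P\<close>; \<open>\<phi>\<close> splits this map by
  lifting the identity.\<close>

lemma projective_dual_basis:
  assumes P: "projective_module R P" and G: "G \<subseteq> carrier P"
    and gen: "\<And>N. submodule N R P \<Longrightarrow> G \<subseteq> N \<Longrightarrow> N = carrier P"
  obtains \<phi> where "dual_basis R P G \<phi>"
proof -
  interpret P: left_module R P using P by (simp add: projective_module_def)
  have F: "left_module R (free_mod R G)"
    by (rule left_module_free_mod) unfold_locales
  have id: "\<And>x. x \<in> G \<Longrightarrow> x \<in> carrier P" using G by auto
  define \<pi> where "\<pi> = (\<lambda>c\<in>carrier (free_mod R G). lin_comb R P c (\<lambda>x. x))"
  have \<pi>: "\<pi> \<in> lhom R (free_mod R G) P"
    unfolding \<pi>_def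
    by (rule lhom_restrictI[OF F]) (auto simp: id P.lin_comb_closed P.lin_comb_add P.lin_comb_smult)
  have "\<pi> ` carrier (free_mod R G) = carrier P"
  proof (rule gen)
    show "submodule (\<pi> ` carrier (free_mod R G)) R P"
      by (rule submodule_image[OF F P.left_module_axioms \<pi>])
    show "G \<subseteq> \<pi> ` carrier (free_mod R G)"
    proof
      fix x assume "x \<in> G"
      then show "x \<in> \<pi> ` carrier (free_mod R G)"
        using P.lin_comb_delta[of x G "\<lambda>x. x"] id unfolding \<pi>_def by force
    qed
  qed
  then obtain \<phi> where "\<phi> \<in> lhom R P (free_mod R G)" "\<forall>x\<in>carrier P. \<pi> (\<phi> x) = (\<lambda>x\<in>carrier P. x) x"
    using P F \<pi> lhom_id[OF P.left_module_axioms] unfolding projective_module_def by blast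
  then have "dual_basis R P G \<phi>"
    using G P.left_module_axioms lhom_closed[of \<phi> R P "free_mod R G"] by (auto simp: dual_basis_def \<pi>_def)
  then show ?thesis using that by blast
qed

lemma projective_dual_basis_carrier:
  assumes "projective_module R P"
  obtains \<phi> where "dual_basis R P (carrier P) \<phi>"
proof -
  interpret P: left_module R P using assms by (simp add: projective_module_def)
  show ?thesis
    by (rule projective_dual_basis[OF assms order_refl])
      (auto dest: P.submoduleD(1) intro: that)
qed

text \<open>\<open>A\<close> and \<open>B\<close> may have elements of any types. Preimages
  \<open>a x\<close> of the \<open>g x\<close> are chosen without regard to linearity; weighting
  them by the linear coordinates \<open>\<phi> p x\<close> restores it.\<close>

lemma projective_lift:
  assumes P: "projective_module R P" and A: "left_module R A" and B: "left_module R B"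
    and q: "q \<in> lhom R A B" and g: "g \<in> lhom R P B" and im: "\<And>x. x \<in> carrier P \<Longrightarrow> g x \<in> q ` carrier A"
  obtains k where "k \<in> lhom R P A" "\<And>x. x \<in> carrier P \<Longrightarrow> q (k x) = g x"
proof -
  interpret P: left_module R P using P by (simp add: projective_module_def)
  interpret A: left_module R A by fact
  interpret B: left_module R B by fact
  obtain \<phi> where \<phi>: "dual_basis R P (carrier P) \<phi>"
    using projective_dual_basis_carrier[OF P] .
  then have \<phi>h: "\<phi> \<in> lhom R P (free_mod R (carrier P))" and
    \<phi>p: "\<And>p. p \<in> carrier P \<Longrightarrow> lin_comb R P (\<phi> p) (\<lambda>x. x) = p"
    by (auto simp: dual_basis_def)
  have "\<forall>x\<in>carrier P. \<exists>y. y \<in> carrier A \<and> q y = g x"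
    using im by force
  then obtain a where a: "\<And>x. x \<in> carrier P \<Longrightarrow> a x \<in> carrier A \<and> q (a x) = g x"
    using bchoice[of "carrier P" "\<lambda>x y. y \<in> carrier A \<and> q y = g x"] by blast
  define k where "k = (\<lambda>p\<in>carrier P. lin_comb R A (\<phi> p) a)"
  have "k \<in> lhom R P A"
    unfolding k_def
    by (rule lhom_restrictI)
      (auto simp: P.left_module_axioms a lhom_add[OF \<phi>h] lhom_smult[OF \<phi>h] lhom_closed[OF \<phi>h]
        A.lin_comb_closed[of _ "carrier P"] A.lin_comb_add A.lin_comb_smult)
  moreover have "q (k p) = g p" if "p \<in> carrier P" for p
  proof -
    have "q (k p) = lin_comb R B (\<phi> p) (\<lambda>x. q (a x))"
      unfolding k_def using that
      by (simp add: A.lin_comb_hom[OF B q lhom_closed[OF \<phi>h that]] a)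
    also have "\<dots> = lin_comb R B (\<phi> p) g"
      unfolding lin_comb_def
      by (rule B.M.finsum_cong')
        (use lhom_closed[OF \<phi>h that] a lhom_closed[OF g] B.smult_closed in \<open>auto simp: mem_free_mod subset_iff\<close>)
    also have "\<dots> = g (lin_comb R P (\<phi> p) (\<lambda>x. x))"
      by (simp add: P.lin_comb_hom[OF B g lhom_closed[OF \<phi>h that]])
    also have "\<dots> = g p"
      by (simp add: \<phi>p that)
    finally show ?thesis .
  qed
  ultimately show ?thesis using that by blast
qed


section \<open>The comparison theorem: chain maps and homotopies over the identity\<close>

section \<open>Comparison of projective resolutions\<close>

locale proj_resolution =
  fixes R :: "('r, 'k) ring_scheme" and A :: "('r, 'a, 'm) module_scheme"
    and P :: "nat \<Rightarrow> ('r, 'p) module" and \<epsilon> d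
  assumes res: "projective_resolution R A P \<epsilon> d"
begin

lemma A: "left_module R A"
  and proj: "projective_module R (P i)"
  and P: "left_module R (P i)"
  and \<epsilon>: "\<epsilon> \<in> lhom R (P 0) A"
  and d: "d i \<in> lhom R (P (Suc i)) (P i)"
  and \<epsilon>_surj: "\<epsilon> ` carrier (P 0) = carrier A"
  using res by (auto simp: projective_resolution_def projective_module_def)

lemma image_d0: "d 0 ` carrier (P (Suc 0)) = a_kernel (P 0) A \<epsilon>"
  using res by (simp add: projective_resolution_def)

lemma image_d: "d (Suc i) ` carrier (P (Suc (Suc i))) = a_kernel (P (Suc i)) (P i) (d i)"
  using res by (simp add: projective_resolution_def)

lemma \<epsilon>d: "x \<in> carrier (P (Suc 0)) \<Longrightarrow> \<epsilon> (d 0 x) = \<zero>\<^bsub>A\<^esub>"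
  using image_d0 by (force simp: mem_a_kernel set_eq_iff)

lemma dd: "x \<in> carrier (P (Suc (Suc i))) \<Longrightarrow> d i (d (Suc i) x) = \<zero>\<^bsub>P i\<^esub>"
  using image_d[of i] by (force simp: mem_a_kernel set_eq_iff)

end

text \<open>The last conjunct of the invariant in the recursion is what allows the next lift.\<close>

lemma chain_map_exists:
  assumes "projective_resolution R A P \<epsilon> d" "projective_resolution R A Q \<epsilon>' d'"
  obtains \<phi> where "\<And>j. \<phi> j \<in> lhom R (P j) (Q j)"
    and "\<And>x. x \<in> carrier (P 0) \<Longrightarrow> \<epsilon>' (\<phi> 0 x) = \<epsilon> x"
    and "\<And>j x. x \<in> carrier (P (Suc j)) \<Longrightarrow> d' j (\<phi> (Suc j) x) = \<phi> j (d j x)"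
proof -
  interpret P: proj_resolution R A P \<epsilon> d by unfold_locales fact
  interpret Q: proj_resolution R A Q \<epsilon>' d' by unfold_locales fact
  define I where "I j f \<longleftrightarrow> f \<in> lhom R (P j) (Q j) \<and>
      (j = 0 \<longrightarrow> (\<forall>x\<in>carrier (P 0). \<epsilon>' (f x) = \<epsilon> x)) \<and>
      (\<forall>x\<in>carrier (P (Suc j)). f (d j x) \<in> d' j ` carrier (Q (Suc j)))" for j f
  define L where "L j f g \<longleftrightarrow> (\<forall>x\<in>carrier (P (Suc j)). d' j (g x) = f (d j x))" for j f g
  have "\<exists>\<phi>. \<forall>j. I j (\<phi> j) \<and> L j (\<phi> j) (\<phi> (Suc j))"
  proof (rule dependent_nat_choice)
    obtain f where f: "f \<in> lhom R (P 0) (Q 0)" "\<And>x. x \<in> carrier (P 0) \<Longrightarrow> \<epsilon>' (f x) = \<epsilon> x"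
      by (rule projective_lift[OF P.proj Q.P Q.A Q.\<epsilon> P.\<epsilon>]) (auto simp: Q.\<epsilon>_surj lhom_closed[OF P.\<epsilon>])
    have "f (d 0 x) \<in> d' 0 ` carrier (Q (Suc 0))" if x: "x \<in> carrier (P (Suc 0))" for x
      using lhom_closed[OF P.d x] lhom_closed[OF f(1)] f(2) P.\<epsilon>d[OF x]
      unfolding Q.image_d0 mem_a_kernel by simp
    then show "\<exists>f. I 0 f" using f by (intro exI[of _ f]) (simp add: I_def)
  next
    fix f j assume "I j f"
    then have f: "f \<in> lhom R (P j) (Q j)"
      and fd: "\<And>x. x \<in> carrier (P (Suc j)) \<Longrightarrow> f (d j x) \<in> d' j ` carrier (Q (Suc j))"
      by (auto simp: I_def)
    obtain g where g: "g \<in> lhom R (P (Suc j)) (Q (Suc j))"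
      "\<And>x. x \<in> carrier (P (Suc j)) \<Longrightarrow> d' j (g x) = compose (carrier (P (Suc j))) f (d j) x"
      by (rule projective_lift[OF P.proj Q.P Q.P Q.d lhom_compose[OF P.P P.d f]])
        (auto simp: fd compose_def)
    have "g (d (Suc j) x) \<in> d' (Suc j) ` carrier (Q (Suc (Suc j)))"
      if x: "x \<in> carrier (P (Suc (Suc j)))" for x
      using lhom_closed[OF P.d x] lhom_closed[OF g(1)] g(2) P.dd[OF x] lhom_zero[OF P.P Q.P f]
      unfolding Q.image_d mem_a_kernel by (simp add: compose_def)
    then show "\<exists>g. I (Suc j) g \<and> L j f g"
      using g unfolding I_def L_def by (auto simp: compose_def)
  qed
  then obtain \<phi> where "\<And>j. I j (\<phi> j)" "\<And>j. L j (\<phi> j) (\<phi> (Suc j))" by blast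
  then show ?thesis
    by (intro that[of \<phi>]) (simp_all add: I_def L_def)
qed

text \<open>The difference of the identity and \<theta> covers zero on \<open>A\<close>, so it can
  be lifted step by step to a homotopy. The conclusions express \<open>x\<close> as a sum because
  they are later pushed through tensor relations and homomorphisms by additivity.\<close>

lemma chain_homotopy_exists:
  assumes "projective_resolution R A P \<epsilon> d"
    and \<theta>: "\<And>j. \<theta> j \<in> lhom R (P j) (P j)"
    and \<epsilon>\<theta>: "\<And>x. x \<in> carrier (P 0) \<Longrightarrow> \<epsilon> (\<theta> 0 x) = \<epsilon> x"
    and d\<theta>: "\<And>j x. x \<in> carrier (P (Suc j)) \<Longrightarrow> d j (\<theta> (Suc j) x) = \<theta> j (d j x)"
  obtains h where "\<And>j. h j \<in> lhom R (P j) (P (Suc j))"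
    and "\<And>x. x \<in> carrier (P 0) \<Longrightarrow> x = \<theta> 0 x \<oplus>\<^bsub>P 0\<^esub> d 0 (h 0 x)"
    and "\<And>j x. x \<in> carrier (P (Suc j)) \<Longrightarrow>
      x = \<theta> (Suc j) x \<oplus>\<^bsub>P (Suc j)\<^esub> (d (Suc j) (h (Suc j) x) \<oplus>\<^bsub>P (Suc j)\<^esub> h j (d j x))"
proof -
  interpret P: proj_resolution R A P \<epsilon> d by unfold_locales fact
  interpret A: left_module R A by (rule P.A)
  interpret Pj: left_module R "P j" for j by (rule P.P)
  \<comment> \<open>\<open>g j f\<close> is the value that \<open>d (Suc j)\<close> must give on the
    next component when \<open>f\<close> is the component in degree \<open>j\<close>.\<close>
  define g where "g j f = (\<lambda>x\<in>carrier (P (Suc j)). (x \<ominus>\<^bsub>P (Suc j)\<^esub> \<theta> (Suc j) x) \<ominus>\<^bsub>P (Suc j)\<^esub> f (d j x))"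
    for j f
  have g: "g j f \<in> lhom R (P (Suc j)) (P (Suc j))" if f: "f \<in> lhom R (P j) (P (Suc j))" for j f
    unfolding g_def a_minus_def
    by (rule lhom_restrictI)
      (auto simp: P.P lhom_closed[OF \<theta>] lhom_closed[OF P.d] lhom_closed[OF f]
        lhom_add[OF \<theta>] lhom_add[OF P.d] lhom_add[OF f]
        lhom_smult[OF \<theta>] lhom_smult[OF P.d] lhom_smult[OF f]
        Pj.M.minus_add Pj.M.add.m_ac Pj.smult_r_distr Pj.smult_r_minus Pj.smult_closed)
  define I where "I j f \<longleftrightarrow> f \<in> lhom R (P j) (P (Suc j)) \<and>
      (j = 0 \<longrightarrow> (\<forall>x\<in>carrier (P 0). d 0 (f x) = x \<ominus>\<^bsub>P 0\<^esub> \<theta> 0 x)) \<and>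
      (\<forall>x\<in>carrier (P (Suc j)). g j f x \<in> d (Suc j) ` carrier (P (Suc (Suc j))))" for j f
  define L where "L j f f' \<longleftrightarrow> (\<forall>x\<in>carrier (P (Suc j)). d (Suc j) (f' x) = g j f x)" for j f f'
  have "\<exists>h. \<forall>j. I j (h j) \<and> L j (h j) (h (Suc j))"
  proof (rule dependent_nat_choice)
    have g0: "(\<lambda>x\<in>carrier (P 0). x \<ominus>\<^bsub>P 0\<^esub> \<theta> 0 x) \<in> lhom R (P 0) (P 0)"
      unfolding a_minus_def
      by (rule lhom_restrictI)
        (auto simp: P.P lhom_closed[OF \<theta>] lhom_add[OF \<theta>] lhom_smult[OF \<theta>]
          Pj.M.minus_add Pj.M.add.m_ac Pj.smult_r_distr Pj.smult_r_minus Pj.smult_closed)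
    have im: "x \<ominus>\<^bsub>P 0\<^esub> \<theta> 0 x \<in> d 0 ` carrier (P (Suc 0))" if "x \<in> carrier (P 0)" for x
      unfolding P.image_d0 mem_a_kernel
      using that A.M.r_neg[OF lhom_closed[OF P.\<epsilon> that]]
      by (simp add: lhom_closed[OF \<theta>] lhom_diff[OF P.P P.A P.\<epsilon>] \<epsilon>\<theta>) (simp add: a_minus_def)
    obtain f where f: "f \<in> lhom R (P 0) (P (Suc 0))"
        "\<And>x. x \<in> carrier (P 0) \<Longrightarrow> d 0 (f x) = (\<lambda>x\<in>carrier (P 0). x \<ominus>\<^bsub>P 0\<^esub> \<theta> 0 x) x"
      by (rule projective_lift[OF P.proj P.P P.P P.d g0]) (auto simp: im)
    have "g 0 f x \<in> d (Suc 0) ` carrier (P (Suc (Suc 0)))" if x: "x \<in> carrier (P (Suc 0))" for x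
    proof -
      have "d 0 (g 0 f x) = (d 0 x \<ominus>\<^bsub>P 0\<^esub> \<theta> 0 (d 0 x)) \<ominus>\<^bsub>P 0\<^esub> (d 0 x \<ominus>\<^bsub>P 0\<^esub> \<theta> 0 (d 0 x))"
        using x lhom_closed[OF P.d x] lhom_closed[OF \<theta> x]
        by (simp add: g_def lhom_diff[OF P.P P.P P.d] lhom_closed[OF f(1)] f(2) d\<theta>)
      also have "\<dots> = \<zero>\<^bsub>P 0\<^esub>"
        using lhom_closed[OF P.d x] lhom_closed[OF \<theta> lhom_closed[OF P.d x]]
        by (simp add: a_minus_def Pj.M.r_neg)
      finally show ?thesis
        unfolding P.image_d mem_a_kernel using lhom_closed[OF g[OF f(1)] x] by simp
    qed
    then show "\<exists>f. I 0 f" using f by (intro exI[of _ f]) (simp add: I_def)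
  next
    fix f j assume "I j f"
    then have f: "f \<in> lhom R (P j) (P (Suc j))"
      and gd: "\<And>x. x \<in> carrier (P (Suc j)) \<Longrightarrow> g j f x \<in> d (Suc j) ` carrier (P (Suc (Suc j)))"
      by (auto simp: I_def)
    obtain f' where f': "f' \<in> lhom R (P (Suc j)) (P (Suc (Suc j)))"
      "\<And>x. x \<in> carrier (P (Suc j)) \<Longrightarrow> d (Suc j) (f' x) = g j f x"
      by (rule projective_lift[OF P.proj P.P P.P P.d g[OF f]]) (auto simp: gd)
    \<comment> \<open>The next required value is a cycle: on \<open>?y\<close>, itself a boundary,
      the \<open>f\<close> term of \<open>g j f\<close> vanishes and the rest cancels. By exactness
      it is a boundary, so the recursion can go on.\<close>
    have "g (Suc j) f' x \<in> d (Suc (Suc j)) ` carrier (P (Suc (Suc (Suc j))))"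
      if x: "x \<in> carrier (P (Suc (Suc j)))" for x
    proof -
      let ?y = "d (Suc j) x"
      have y: "?y \<in> carrier (P (Suc j))" "\<theta> (Suc j) ?y \<in> carrier (P (Suc j))"
        using lhom_closed[OF P.d x] lhom_closed[OF \<theta>] by auto
      have z: "f \<zero>\<^bsub>P j\<^esub> = \<zero>\<^bsub>P (Suc j)\<^esub>"
        by (rule lhom_zero[OF P.P P.P f])
      have "d (Suc j) (g (Suc j) f' x) = (?y \<ominus>\<^bsub>P (Suc j)\<^esub> \<theta> (Suc j) ?y) \<ominus>\<^bsub>P (Suc j)\<^esub> g j f ?y"
        using x y lhom_closed[OF \<theta> x]
        by (simp add: g_def[of "Suc j"] lhom_diff[OF P.P P.P P.d] lhom_closed[OF f'(1)] f'(2) d\<theta>)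
      also have "g j f ?y = ?y \<ominus>\<^bsub>P (Suc j)\<^esub> \<theta> (Suc j) ?y"
        using y by (simp add: g_def P.dd[OF x] z a_minus_def)
      also have "(?y \<ominus>\<^bsub>P (Suc j)\<^esub> \<theta> (Suc j) ?y) \<ominus>\<^bsub>P (Suc j)\<^esub> (?y \<ominus>\<^bsub>P (Suc j)\<^esub> \<theta> (Suc j) ?y) = \<zero>\<^bsub>P (Suc j)\<^esub>"
        using y by (simp add: a_minus_def Pj.M.r_neg)
      finally show ?thesis
        unfolding P.image_d mem_a_kernel using lhom_closed[OF g[OF f'(1)] x] by simp
    qed
    then show "\<exists>f'. I (Suc j) f' \<and> L j f f'"
      using f' unfolding I_def L_def by blast
  qed
  then obtain h where I: "\<And>j. I j (h j)" and L: "\<And>j. L j (h j) (h (Suc j))" by blast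
  show ?thesis
  proof (rule that)
    show h: "h j \<in> lhom R (P j) (P (Suc j))" for j
      using I by (simp add: I_def)
    show "x = \<theta> 0 x \<oplus>\<^bsub>P 0\<^esub> d 0 (h 0 x)" if "x \<in> carrier (P 0)" for x
      using I[of 0] that lhom_closed[OF \<theta> that] unfolding I_def
      by (simp add: a_minus_def Pj.M.add.m_lcomm Pj.M.r_neg)
    show "x = \<theta> (Suc j) x \<oplus>\<^bsub>P (Suc j)\<^esub> (d (Suc j) (h (Suc j) x) \<oplus>\<^bsub>P (Suc j)\<^esub> h j (d j x))"
      if x: "x \<in> carrier (P (Suc j))" for j x
    proof -
      have "d (Suc j) (h (Suc j) x) = g j (h j) x"
        using L x by (simp add: L_def)
      moreover have "\<theta> (Suc j) x \<in> carrier (P (Suc j))" "h j (d j x) \<in> carrier (P (Suc j))"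
        using lhom_closed[OF \<theta> x] lhom_closed[OF h lhom_closed[OF P.d x]] by auto
      ultimately show ?thesis
        using x by (simp add: g_def a_minus_def Pj.M.add.m_assoc Pj.M.l_neg)
          (simp add: Pj.M.add.m_lcomm Pj.M.r_neg)
    qed
  qed
qed

text \<open>The homotopy lives on \<open>P\<close>, the resolution for which exactness is to be
  concluded; what is known concerns \<open>Q\<close>.\<close>

locale resolution_comparison =
  P: proj_resolution R A P \<epsilon> d + Q: proj_resolution R A Q \<epsilon>' d'
  for R :: "('r, 'k) ring_scheme" and A :: "('r, 'a, 'm) module_scheme"
    and P :: "nat \<Rightarrow> ('r, 'p) module" and \<epsilon> d and Q :: "nat \<Rightarrow> ('r, 'q) module" and \<epsilon>' d' +
  fixes \<phi> \<psi> h
  assumes \<phi>: "\<phi> j \<in> lhom R (P j) (Q j)" and \<psi>: "\<psi> j \<in> lhom R (Q j) (P j)"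
    and h: "h j \<in> lhom R (P j) (P (Suc j))"
    and \<epsilon>\<phi>: "x \<in> carrier (P 0) \<Longrightarrow> \<epsilon>' (\<phi> 0 x) = \<epsilon> x"
    and \<epsilon>\<psi>: "y \<in> carrier (Q 0) \<Longrightarrow> \<epsilon> (\<psi> 0 y) = \<epsilon>' y"
    and d\<phi>: "x \<in> carrier (P (Suc j)) \<Longrightarrow> d' j (\<phi> (Suc j) x) = \<phi> j (d j x)"
    and d\<psi>: "y \<in> carrier (Q (Suc j)) \<Longrightarrow> d j (\<psi> (Suc j) y) = \<psi> j (d' j y)"
    and h0: "x \<in> carrier (P 0) \<Longrightarrow> x = \<psi> 0 (\<phi> 0 x) \<oplus>\<^bsub>P 0\<^esub> d 0 (h 0 x)"
    and hS: "x \<in> carrier (P (Suc j)) \<Longrightarrow>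
      x = \<psi> (Suc j) (\<phi> (Suc j) x) \<oplus>\<^bsub>P (Suc j)\<^esub> (d (Suc j) (h (Suc j) x) \<oplus>\<^bsub>P (Suc j)\<^esub> h j (d j x))"

lemma resolution_comparison_exists:
  assumes "projective_resolution R A P \<epsilon> d" "projective_resolution R A Q \<epsilon>' d'"
  obtains \<phi> \<psi> h where "resolution_comparison R A P \<epsilon> d Q \<epsilon>' d' \<phi> \<psi> h"
proof -
  interpret P: proj_resolution R A P \<epsilon> d by unfold_locales fact
  interpret Q: proj_resolution R A Q \<epsilon>' d' by unfold_locales fact
  obtain \<phi> where \<phi>: "\<And>j. \<phi> j \<in> lhom R (P j) (Q j)"
    and \<phi>\<epsilon>: "\<And>x. x \<in> carrier (P 0) \<Longrightarrow> \<epsilon>' (\<phi> 0 x) = \<epsilon> x"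
    and \<phi>d: "\<And>j x. x \<in> carrier (P (Suc j)) \<Longrightarrow> d' j (\<phi> (Suc j) x) = \<phi> j (d j x)"
    using chain_map_exists[OF assms] by metis
  obtain \<psi> where \<psi>: "\<And>j. \<psi> j \<in> lhom R (Q j) (P j)"
    and \<psi>\<epsilon>: "\<And>x. x \<in> carrier (Q 0) \<Longrightarrow> \<epsilon> (\<psi> 0 x) = \<epsilon>' x"
    and \<psi>d: "\<And>j x. x \<in> carrier (Q (Suc j)) \<Longrightarrow> d j (\<psi> (Suc j) x) = \<psi> j (d' j x)"
    using chain_map_exists[OF assms(2,1)] by metis
  have *: "compose (carrier (P j)) (\<psi> j) (\<phi> j) \<in> lhom R (P j) (P j)" for j
    by (rule lhom_compose[OF P.P \<phi> \<psi>])
  obtain h where h: "\<And>j. h j \<in> lhom R (P j) (P (Suc j))"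
    and h0: "\<And>x. x \<in> carrier (P 0) \<Longrightarrow>
      x = compose (carrier (P 0)) (\<psi> 0) (\<phi> 0) x \<oplus>\<^bsub>P 0\<^esub> d 0 (h 0 x)"
    and hS: "\<And>j x. x \<in> carrier (P (Suc j)) \<Longrightarrow>
      x = compose (carrier (P (Suc j))) (\<psi> (Suc j)) (\<phi> (Suc j)) x
        \<oplus>\<^bsub>P (Suc j)\<^esub> (d (Suc j) (h (Suc j) x) \<oplus>\<^bsub>P (Suc j)\<^esub> h j (d j x))"
    by (rule chain_homotopy_exists[OF assms(1) *])
      (auto simp: compose_def \<psi>\<epsilon> \<phi>\<epsilon> \<psi>d \<phi>d lhom_closed[OF \<phi>] lhom_closed[OF P.d])
  have "resolution_comparison R A P \<epsilon> d Q \<epsilon>' d' \<phi> \<psi> h"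
  proof (intro resolution_comparison.intro resolution_comparison_axioms.intro
      P.proj_resolution_axioms Q.proj_resolution_axioms)
    show "x = \<psi> 0 (\<phi> 0 x) \<oplus>\<^bsub>P 0\<^esub> d 0 (h 0 x)" if "x \<in> carrier (P 0)" for x
      using h0[OF that] that by (simp add: compose_def)
    show "x = \<psi> (Suc j) (\<phi> (Suc j) x) \<oplus>\<^bsub>P (Suc j)\<^esub> (d (Suc j) (h (Suc j) x) \<oplus>\<^bsub>P (Suc j)\<^esub> h j (d j x))"
      if "x \<in> carrier (P (Suc j))" for j x
      using hS[OF that] that by (simp only: compose_def restrict_apply' if_True)
  qed (fact \<phi> \<psi> h \<phi>\<epsilon> \<psi>\<epsilon> \<phi>d \<psi>d)+
  then show ?thesis by (rule that)
qed

section \<open>Tensor products on representatives: universal property, right exactness, coordinates,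
  flatness\<close>

section \<open>Tensor products as subquotients of free abelian groups\<close>

lemma opposite_ring_simps [simp]:
  "carrier (opposite_ring S) = carrier S" "\<zero>\<^bsub>opposite_ring S\<^esub> = \<zero>\<^bsub>S\<^esub>" "\<one>\<^bsub>opposite_ring S\<^esub> = \<one>\<^bsub>S\<^esub>"
  "x \<oplus>\<^bsub>opposite_ring S\<^esub> y = x \<oplus>\<^bsub>S\<^esub> y" "x \<otimes>\<^bsub>opposite_ring S\<^esub> y = y \<otimes>\<^bsub>S\<^esub> x"
  by (simp_all add: opposite_ring_def)

definition frags :: "'x set \<Rightarrow> ('x \<Rightarrow>\<^sub>0 int) set" where
  "frags X = {u. Poly_Mapping.keys u \<subseteq> X}"

lemma diff_closed_frags: "diff_closed (frags X)"
  using keys_diff by (fastforce simp: diff_closed_def frags_def)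

lemma frag_of_mem_frags: "frag_of x \<in> frags X \<longleftrightarrow> x \<in> X"
  by (simp add: frags_def)

lemma frags_induct [consumes 1, case_names zero of diff]:
  assumes u: "u \<in> frags X" and P: "P 0" "\<And>x. x \<in> X \<Longrightarrow> P (frag_of x)"
    "\<And>u v. u \<in> frags X \<Longrightarrow> v \<in> frags X \<Longrightarrow> P u \<Longrightarrow> P v \<Longrightarrow> P (u - v)"
  shows "P u"
proof -
  have "Poly_Mapping.keys u \<subseteq> X" using u by (simp add: frags_def)
  then have "u \<in> frags X \<and> P u"
    by (induction rule: frag_induction)
      (auto simp: P diff_closed_zero[OF diff_closed_frags] diff_closed_diff[OF diff_closed_frags] frag_of_mem_frags)
  then show ?thesis ..
qed

lemma frag_extend_mem:
  assumes "diff_closed W" "\<And>x. x \<in> X \<Longrightarrow> f x \<in> W" "u \<in> frags X"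
  shows "frag_extend f u \<in> W"
  using assms(3)
  by (induction rule: frags_induct) (auto simp: assms diff_closed_zero diff_closed_diff frag_extend_diff)

abbreviation tmap where
  "tmap g i \<equiv> frag_extend (\<lambda>(a, b). frag_of (g a, i b))"

lemma tmap_mem:
  assumes "\<And>a. a \<in> A \<Longrightarrow> g a \<in> A'" "\<And>b. b \<in> B \<Longrightarrow> i b \<in> B'" "u \<in> frags (A \<times> B)"
  shows "tmap g i u \<in> frags (A' \<times> B')"
  by (rule frag_extend_mem[OF diff_closed_frags _ assms(3)]) (auto simp: assms frag_of_mem_frags)

lemma tmap_tmap:
  assumes "\<And>a b. a \<in> A \<Longrightarrow> b \<in> B \<Longrightarrow> g (g' a) = h a \<and> i (i' b) = j b" "u \<in> frags (A \<times> B)"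
  shows "tmap g i (tmap g' i' u) = tmap h j u"
  using assms(2)
  by (induction rule: frags_induct) (auto simp: assms frag_extend_diff)

abbreviation right_module :: "('s, 'k) ring_scheme \<Rightarrow> ('s, 'a) module \<Rightarrow> bool" where
  "right_module S A \<equiv> left_module (opposite_ring S) A"

lemma tensor_relations_add_left:
  "a \<in> carrier A \<Longrightarrow> a' \<in> carrier A \<Longrightarrow> b \<in> carrier B \<Longrightarrow>
    frag_of (a \<oplus>\<^bsub>A\<^esub> a', b) - frag_of (a, b) - frag_of (a', b) \<in> tensor_relations S A B"
  and tensor_relations_add_right:
  "a \<in> carrier A \<Longrightarrow> b \<in> carrier B \<Longrightarrow> b' \<in> carrier B \<Longrightarrow>
    frag_of (a, b \<oplus>\<^bsub>B\<^esub> b') - frag_of (a, b) - frag_of (a, b') \<in> tensor_relations S A B"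
  and tensor_relations_balanced:
  "s \<in> carrier S \<Longrightarrow> a \<in> carrier A \<Longrightarrow> b \<in> carrier B \<Longrightarrow>
    frag_of (s \<odot>\<^bsub>A\<^esub> a, b) - frag_of (a, s \<odot>\<^bsub>B\<^esub> b) \<in> tensor_relations S A B"
  unfolding tensor_relations_def by (rule generate.incl; blast)+

text \<open>The usual way to show that a map or property respects the tensor product: the relations
  lie in a subgroup \<open>W\<close> once the three kinds of generators do. \<open>W\<close> is
  typically the preimage of other relations.\<close>

lemma tensor_relations_induct:
  assumes A: "right_module S A" and B: "left_module S B" and W: "diff_closed W"
    and 1: "\<And>a a' b. a \<in> carrier A \<Longrightarrow> a' \<in> carrier A \<Longrightarrow> b \<in> carrier B \<Longrightarrow>
      frag_of (a \<oplus>\<^bsub>A\<^esub> a', b) - frag_of (a, b) - frag_of (a', b) \<in> W"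
    and 2: "\<And>a b b'. a \<in> carrier A \<Longrightarrow> b \<in> carrier B \<Longrightarrow> b' \<in> carrier B \<Longrightarrow>
      frag_of (a, b \<oplus>\<^bsub>B\<^esub> b') - frag_of (a, b) - frag_of (a, b') \<in> W"
    and 3: "\<And>s a b. s \<in> carrier S \<Longrightarrow> a \<in> carrier A \<Longrightarrow> b \<in> carrier B \<Longrightarrow>
      frag_of (s \<odot>\<^bsub>A\<^esub> a, b) - frag_of (a, s \<odot>\<^bsub>B\<^esub> b) \<in> W"
  shows "tensor_relations S A B \<subseteq> W"
proof
  interpret A: left_module "opposite_ring S" A by fact
  interpret B: left_module S B by fact
  let ?F = "frags (carrier A \<times> carrier B)"
  note F = diff_closed_diff[OF diff_closed_frags]
  have F1: "frag_of (a \<oplus>\<^bsub>A\<^esub> a', b) - frag_of (a, b) - frag_of (a', b) \<in> ?F"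
    if "a \<in> carrier A" "a' \<in> carrier A" "b \<in> carrier B" for a a' b
    by (intro F) (use that in \<open>auto simp: frag_of_mem_frags\<close>)
  have F2: "frag_of (a, b \<oplus>\<^bsub>B\<^esub> b') - frag_of (a, b) - frag_of (a, b') \<in> ?F"
    if "a \<in> carrier A" "b \<in> carrier B" "b' \<in> carrier B" for a b b'
    by (intro F) (use that in \<open>auto simp: frag_of_mem_frags\<close>)
  have F3: "frag_of (s \<odot>\<^bsub>A\<^esub> a, b) - frag_of (a, s \<odot>\<^bsub>B\<^esub> b) \<in> ?F"
    if "s \<in> carrier S" "a \<in> carrier A" "b \<in> carrier B" for s a b
    by (intro F) (use that A.smult_closed B.smult_closed in \<open>auto simp: frag_of_mem_frags\<close>)
  \<comment> \<open>Membership in \<open>?F\<close> is carried along because inversion in the free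
    abelian group is known to be negation on its carrier.\<close>
  have H: "u \<in> W \<and> u \<in> ?F"
    if "u \<in> {frag_of (a \<oplus>\<^bsub>A\<^esub> a', b) - frag_of (a, b) - frag_of (a', b) | a a' b.
         a \<in> carrier A \<and> a' \<in> carrier A \<and> b \<in> carrier B} \<union>
      {frag_of (a, b \<oplus>\<^bsub>B\<^esub> b') - frag_of (a, b) - frag_of (a, b') | a b b'.
         a \<in> carrier A \<and> b \<in> carrier B \<and> b' \<in> carrier B} \<union>
      {frag_of (s \<odot>\<^bsub>A\<^esub> a, b) - frag_of (a, s \<odot>\<^bsub>B\<^esub> b) | s a b.
         s \<in> carrier S \<and> a \<in> carrier A \<and> b \<in> carrier B}" for u
    using that by (elim UnE CollectE exE conjE) (simp_all add: 1 2 3 F1 F2 F3)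
  fix u assume "u \<in> tensor_relations S A B"
  then show "u \<in> W"
    unfolding tensor_relations_def
  proof (induction rule: generate.induct)
    case one
    then show ?case by (simp add: W diff_closed_zero)
  next
    case (incl u)
    from H[OF this] show ?case ..
  next
    case (inv u)
    from H[OF this] show ?case using W by (simp add: diff_closed_uminus frags_def)
  next
    case (eng u v)
    then show ?case using W by (simp add: diff_closed_add)
  qed
qed

lemma diff_closed_tensor_relations:
  assumes A: "right_module S A" and B: "left_module S B"
  shows "diff_closed (tensor_relations S A B)" "tensor_relations S A B \<subseteq> frags (carrier A \<times> carrier B)"
proof -
  interpret A: left_module "opposite_ring S" A by fact
  interpret B: left_module S B by fact
  note F = diff_closed_diff[OF diff_closed_frags]
  show *: "tensor_relations S A B \<subseteq> frags (carrier A \<times> carrier B)"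
    by (rule tensor_relations_induct[OF A B diff_closed_frags]; intro F)
      (auto simp: frag_of_mem_frags A.smult_closed[simplified] B.smult_closed)
  let ?F = "free_Abelian_group (carrier A \<times> carrier B)" and ?V = "tensor_relations S A B"
  interpret F: Group.group ?F by simp
  have gen: "?V = generate ?F
     ({frag_of (a \<oplus>\<^bsub>A\<^esub> a', b) - frag_of (a, b) - frag_of (a', b) | a a' b.
         a \<in> carrier A \<and> a' \<in> carrier A \<and> b \<in> carrier B} \<union>
      {frag_of (a, b \<oplus>\<^bsub>B\<^esub> b') - frag_of (a, b) - frag_of (a, b') | a b b'.
         a \<in> carrier A \<and> b \<in> carrier B \<and> b' \<in> carrier B} \<union>
      {frag_of (s \<odot>\<^bsub>A\<^esub> a, b) - frag_of (a, s \<odot>\<^bsub>B\<^esub> b) | s a b.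
         s \<in> carrier S \<and> a \<in> carrier A \<and> b \<in> carrier B})" (is "_ = generate _ ?H")
    by (simp add: tensor_relations_def)
  have H: "?H \<subseteq> ?V"
    unfolding gen by (rule subsetI) (rule generate.incl)
  moreover have "?V \<subseteq> carrier ?F"
    using * by (simp add: frags_def subset_iff)
  ultimately have "?H \<subseteq> carrier ?F"
    by (rule order_trans)
  then have sub: "subgroup ?V ?F"
    unfolding gen by (rule F.generate_is_subgroup)
  show "diff_closed ?V"
    unfolding diff_closed_def
  proof safe
    show "0 \<in> ?V" using subgroup.one_closed[OF sub] by simp
    show "x - y \<in> ?V" if "x \<in> ?V" "y \<in> ?V" for x y
      using subgroup.m_closed[OF sub that(1) subgroup.m_inv_closed[OF sub that(2)]] that(2) *
      by (auto simp: frags_def)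
  qed
qed

lemma tmap_tensor_relations:
  assumes A: "right_module S A" "right_module S A'" and B: "left_module S B" "left_module S B'"
    and g: "g \<in> lhom (opposite_ring S) A A'" and i: "i \<in> lhom S B B'"
    and u: "u \<in> tensor_relations S A B"
  shows "tmap g i u \<in> tensor_relations S A' B'"
proof -
  note V = diff_closed_tensor_relations(1)[OF A(2) B(2)]
  have "tensor_relations S A B \<subseteq> {u. tmap g i u \<in> tensor_relations S A' B'}"
  proof (rule tensor_relations_induct[OF A(1) B(1)])
    show "diff_closed {u. tmap g i u \<in> tensor_relations S A' B'}"
      using V by (auto simp: diff_closed_def frag_extend_diff)
  qed (auto simp: frag_extend_diff lhom_add[OF g] lhom_add[OF i] lhom_smult[OF i] lhom_closed[OF g]
      lhom_closed[OF i] lhom_smult[OF g, simplified]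
      intro!: tensor_relations_add_left tensor_relations_add_right tensor_relations_balanced)
  with u show ?thesis by blast
qed

lemma frag_of_zero_relations:
  assumes A: "right_module S A" and B: "left_module S B"
  shows "b \<in> carrier B \<Longrightarrow> frag_of (\<zero>\<^bsub>A\<^esub>, b) \<in> tensor_relations S A B"
    and "a \<in> carrier A \<Longrightarrow> frag_of (a, \<zero>\<^bsub>B\<^esub>) \<in> tensor_relations S A B"
proof -
  interpret A: left_module "opposite_ring S" A by fact
  interpret B: left_module S B by fact
  note V = diff_closed_tensor_relations(1)[OF A B]
  show "frag_of (\<zero>\<^bsub>A\<^esub>, b) \<in> tensor_relations S A B" if "b \<in> carrier B"
    using diff_closed_uminus[OF V tensor_relations_add_left[of "\<zero>\<^bsub>A\<^esub>" A "\<zero>\<^bsub>A\<^esub>" b B S]] that by simp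
  show "frag_of (a, \<zero>\<^bsub>B\<^esub>) \<in> tensor_relations S A B" if "a \<in> carrier A"
    using diff_closed_uminus[OF V tensor_relations_add_right[of a A "\<zero>\<^bsub>B\<^esub>" B "\<zero>\<^bsub>B\<^esub>" S]] that by simp
qed

lemma frag_of_finsum_relations:
  assumes A: "right_module S A" and B: "left_module S B"
    and X: "finite X" "\<And>x. x \<in> X \<Longrightarrow> f x \<in> carrier A" and b: "b \<in> carrier B"
  shows "frag_of (finsum A f X, b) - (\<Sum>x\<in>X. frag_of (f x, b)) \<in> tensor_relations S A B"
  using X
proof (induction X rule: finite_induct)
  interpret A: left_module "opposite_ring S" A by fact
  case empty
  then show ?case using frag_of_zero_relations(1)[OF A B b] by simp
next
  interpret A: left_module "opposite_ring S" A by fact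
  note V = diff_closed_tensor_relations(1)[OF A B]
  case (insert x X)
  let ?s = "finsum A f X"
  have s: "?s \<in> carrier A" "f x \<in> carrier A"
    using insert by (auto intro: A.M.finsum_closed)
  have "frag_of (f x \<oplus>\<^bsub>A\<^esub> ?s, b) - (frag_of (f x, b) + (\<Sum>x\<in>X. frag_of (f x, b)))
      = (frag_of (f x \<oplus>\<^bsub>A\<^esub> ?s, b) - frag_of (f x, b) - frag_of (?s, b)) + (frag_of (?s, b) - (\<Sum>x\<in>X. frag_of (f x, b)))"
    by simp
  also have "\<dots> \<in> tensor_relations S A B"
    using insert s b by (intro diff_closed_add[OF V] tensor_relations_add_left) auto
  finally show ?case
    using insert by simp
qed

lemma additive_extension:
  assumes K: "abelian_group K" and \<beta>: "\<And>x. x \<in> X \<Longrightarrow> \<beta> x \<in> carrier K"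
  shows "\<exists>h. (\<forall>x\<in>X. h (frag_of x) = \<beta> x) \<and> (\<forall>u\<in>frags X. h u \<in> carrier K) \<and> h 0 = \<zero>\<^bsub>K\<^esub> \<and>
    (\<forall>u\<in>frags X. \<forall>v\<in>frags X. h (u - v) = h u \<ominus>\<^bsub>K\<^esub> h v)"
proof -
  interpret K: abelian_group K by fact
  have "\<beta> ` X \<subseteq> carrier (add_monoid K)" using \<beta> by auto
  then obtain h where h: "h \<in> hom (free_Abelian_group X) (add_monoid K)" "\<And>x. x \<in> X \<Longrightarrow> h (frag_of x) = \<beta> x"
    by (rule comm_group.free_Abelian_group_universal[OF K.a_comm_group]) auto
  interpret h: group_hom "free_Abelian_group X" "add_monoid K" h
    using h(1) K.a_group by (simp add: group_hom_def group_hom_axioms_def)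
  have "h (u - v) = h u \<ominus>\<^bsub>K\<^esub> h v" if "u \<in> frags X" "v \<in> frags X" for u v
    using h.hom_mult[of u "- v"] h.hom_inv[of v] that
    by (simp add: frags_def a_minus_def a_inv_def)
  then show ?thesis
    using h h.hom_one h.hom_closed by (intro exI[of _ h]) (auto simp: frags_def)
qed

text \<open>The universal property of the tensor product on representatives. Additivity of
  \<open>h\<close> is stated on \<open>frags\<close>, since \<open>K\<close> is a group on its
  carrier and not on its type.\<close>

lemma bilinear_extension:
  assumes A: "right_module S A" and B: "left_module S B" and K: "abelian_group K"
    and \<beta>: "\<And>a b. a \<in> carrier A \<Longrightarrow> b \<in> carrier B \<Longrightarrow> \<beta> a b \<in> carrier K"
      "\<And>a a' b. a \<in> carrier A \<Longrightarrow> a' \<in> carrier A \<Longrightarrow> b \<in> carrier B \<Longrightarrow> \<beta> (a \<oplus>\<^bsub>A\<^esub> a') b = \<beta> a b \<oplus>\<^bsub>K\<^esub> \<beta> a' b"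
      "\<And>a b b'. a \<in> carrier A \<Longrightarrow> b \<in> carrier B \<Longrightarrow> b' \<in> carrier B \<Longrightarrow> \<beta> a (b \<oplus>\<^bsub>B\<^esub> b') = \<beta> a b \<oplus>\<^bsub>K\<^esub> \<beta> a b'"
      "\<And>s a b. s \<in> carrier S \<Longrightarrow> a \<in> carrier A \<Longrightarrow> b \<in> carrier B \<Longrightarrow> \<beta> (s \<odot>\<^bsub>A\<^esub> a) b = \<beta> a (s \<odot>\<^bsub>B\<^esub> b)"
  shows "\<exists>h. (\<forall>a\<in>carrier A. \<forall>b\<in>carrier B. h (frag_of (a, b)) = \<beta> a b) \<and>
    (\<forall>u\<in>frags (carrier A \<times> carrier B). h u \<in> carrier K) \<and> h 0 = \<zero>\<^bsub>K\<^esub> \<and>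
    (\<forall>u\<in>frags (carrier A \<times> carrier B). \<forall>v\<in>frags (carrier A \<times> carrier B). h (u - v) = h u \<ominus>\<^bsub>K\<^esub> h v) \<and>
    (\<forall>u\<in>tensor_relations S A B. h u = \<zero>\<^bsub>K\<^esub>)"
proof -
  interpret A: left_module "opposite_ring S" A by fact
  interpret B: left_module S B by fact
  interpret K: abelian_group K by fact
  let ?F = "frags (carrier A \<times> carrier B)"
  have "\<exists>h. (\<forall>x\<in>carrier A \<times> carrier B. h (frag_of x) = (\<lambda>(a, b). \<beta> a b) x) \<and>
      (\<forall>u\<in>?F. h u \<in> carrier K) \<and> h 0 = \<zero>\<^bsub>K\<^esub> \<and> (\<forall>u\<in>?F. \<forall>v\<in>?F. h (u - v) = h u \<ominus>\<^bsub>K\<^esub> h v)"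
    by (rule additive_extension[OF K]) (auto simp: \<beta>(1))
  then obtain h where "\<forall>x\<in>carrier A \<times> carrier B. h (frag_of x) = (\<lambda>(a, b). \<beta> a b) x"
    and "\<forall>u\<in>?F. h u \<in> carrier K" "h 0 = \<zero>\<^bsub>K\<^esub>" "\<forall>u\<in>?F. \<forall>v\<in>?F. h (u - v) = h u \<ominus>\<^bsub>K\<^esub> h v"
    by blast
  then have h: "\<And>a b. a \<in> carrier A \<Longrightarrow> b \<in> carrier B \<Longrightarrow> h (frag_of (a, b)) = \<beta> a b"
    "\<And>u. u \<in> ?F \<Longrightarrow> h u \<in> carrier K" "h 0 = \<zero>\<^bsub>K\<^esub>"
    "\<And>u v. u \<in> ?F \<Longrightarrow> v \<in> ?F \<Longrightarrow> h (u - v) = h u \<ominus>\<^bsub>K\<^esub> h v"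
    by auto
  note F = diff_closed_diff[OF diff_closed_frags]
  have zero: "x \<oplus>\<^bsub>K\<^esub> y \<ominus>\<^bsub>K\<^esub> x \<ominus>\<^bsub>K\<^esub> y = \<zero>\<^bsub>K\<^esub>" if "x \<in> carrier K" "y \<in> carrier K" for x y
  proof -
    have "x \<oplus>\<^bsub>K\<^esub> y \<ominus>\<^bsub>K\<^esub> x = y"
      using that by (simp add: a_minus_def K.add.m_comm[of x y] K.add.m_assoc K.r_neg)
    then show ?thesis using that by (simp add: a_minus_def K.r_neg)
  qed
  have "tensor_relations S A B \<subseteq> {u \<in> ?F. h u = \<zero>\<^bsub>K\<^esub>}"
  proof (rule tensor_relations_induct[OF A B])
    show "diff_closed {u \<in> ?F. h u = \<zero>\<^bsub>K\<^esub>}"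
      using h(3) by (auto simp: diff_closed_def diff_closed_zero[OF diff_closed_frags] F h(4) a_minus_def)
  qed (auto simp: frag_of_mem_frags A.smult_closed[simplified] B.smult_closed h(1,4) F \<beta> zero
      K.r_neg a_minus_def[of K "\<beta> a (s \<odot>\<^bsub>B\<^esub> b)" "\<beta> a (s \<odot>\<^bsub>B\<^esub> b)" for a b s])
  then show ?thesis
    using h by (intro exI[of _ h]) auto
qed

text \<open>The map to \<open>N''\<close> is inverted modulo the image of \<open>N'\<close> by any set-theoretic section.\<close>

lemma tensor_right_exact:
  assumes P: "right_module S P" and N': "left_module S N'" and N: "left_module S N"
    and N'': "left_module S N''"
    and i: "i \<in> lhom S N' N" and q: "q \<in> lhom S N N''" and surj: "q ` carrier N = carrier N''"
    and ker: "\<And>n. n \<in> carrier N \<Longrightarrow> q n = \<zero>\<^bsub>N''\<^esub> \<Longrightarrow> n \<in> i ` carrier N'"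
    and y: "y \<in> frags (carrier P \<times> carrier N)" and qy: "tmap (\<lambda>p. p) q y \<in> tensor_relations S P N''"
  shows "\<exists>x\<in>frags (carrier P \<times> carrier N'). y - tmap (\<lambda>p. p) i x \<in> tensor_relations S P N"
proof -
  interpret P: left_module "opposite_ring S" P by fact
  interpret N': left_module S N' by fact
  interpret N: left_module S N by fact
  interpret N'': left_module S N'' by fact
  let ?V = "tensor_relations S P N"
  note V = diff_closed_tensor_relations(1)[OF P N]
  \<comment> \<open>\<open>W\<close> is the image of P \<otimes> N' together with the relations; the
    goal is that \<open>y\<close> lies in it.\<close>
  define W where "W = {w. \<exists>x\<in>frags (carrier P \<times> carrier N'). w - tmap (\<lambda>p. p) i x \<in> ?V}"
  have W: "diff_closed W"
    unfolding diff_closed_def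
  proof safe
    show "0 \<in> W"
      using diff_closed_zero[OF diff_closed_frags] diff_closed_zero[OF V] by (force simp: W_def)
    fix u v assume "u \<in> W" "v \<in> W"
    then obtain x y where x: "x \<in> frags (carrier P \<times> carrier N')" "u - tmap (\<lambda>p. p) i x \<in> ?V"
      and y: "y \<in> frags (carrier P \<times> carrier N')" "v - tmap (\<lambda>p. p) i y \<in> ?V"
      by (auto simp: W_def)
    have "(u - v) - tmap (\<lambda>p. p) i (x - y) = (u - tmap (\<lambda>p. p) i x) - (v - tmap (\<lambda>p. p) i y)"
      by (simp add: frag_extend_diff)
    also have "\<dots> \<in> ?V" by (rule diff_closed_diff[OF V x(2) y(2)])
    finally show "u - v \<in> W"
      using diff_closed_diff[OF diff_closed_frags x(1) y(1)] by (auto simp: W_def)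
  qed
  have VW: "?V \<subseteq> W"
    using diff_closed_zero[OF diff_closed_frags] by (force simp: W_def)
  have iW: "frag_of (p, i n) \<in> W" if "p \<in> carrier P" "n \<in> carrier N'" for p n
    using that diff_closed_zero[OF V]
    by (auto simp: W_def frag_of_mem_frags intro!: bexI[of _ "frag_of (p, n)"])
  \<comment> \<open>Two elements of \<open>N\<close> with the same image under \<open>q\<close>
    differ by an element of the image of \<open>i\<close>, so they give the same class modulo
    \<open>W\<close>.\<close>
  have fib: "frag_of (p, n) - frag_of (p, n') \<in> W"
    if *: "p \<in> carrier P" "n \<in> carrier N" "n' \<in> carrier N" "q n = q n'" for p n n'
  proof -
    have "q (n \<ominus>\<^bsub>N\<^esub> n') = q n' \<ominus>\<^bsub>N''\<^esub> q n'"
      using * by (simp add: lhom_diff[OF N N'' q])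
    then have "q (n \<ominus>\<^bsub>N\<^esub> n') = \<zero>\<^bsub>N''\<^esub>"
      using * lhom_closed[OF q] by (simp add: a_minus_def N''.M.r_neg)
    then obtain m where m: "m \<in> carrier N'" "n \<ominus>\<^bsub>N\<^esub> n' = i m"
      using ker[of "n \<ominus>\<^bsub>N\<^esub> n'"] * by auto
    have "n' \<oplus>\<^bsub>N\<^esub> (n \<ominus>\<^bsub>N\<^esub> n') = n"
      using * N.M.add.m_lcomm[of n' n "\<ominus>\<^bsub>N\<^esub> n'"] by (simp add: a_minus_def N.M.r_neg)
    then have "n = n' \<oplus>\<^bsub>N\<^esub> i m"
      by (simp only: m(2))
    then have "frag_of (p, n) - frag_of (p, n')
        = (frag_of (p, n' \<oplus>\<^bsub>N\<^esub> i m) - frag_of (p, n') - frag_of (p, i m)) + frag_of (p, i m)"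
      by simp
    also have "\<dots> \<in> W"
      using * m VW by (intro diff_closed_add[OF W] iW subsetD[OF VW] tensor_relations_add_right)
        (auto simp: lhom_closed[OF i])
    finally show ?thesis .
  qed
  have "\<forall>x\<in>carrier N''. \<exists>n. n \<in> carrier N \<and> q n = x"
    unfolding surj[symmetric] by blast
  then obtain \<sigma> where \<sigma>: "\<And>x. x \<in> carrier N'' \<Longrightarrow> \<sigma> x \<in> carrier N" "\<And>x. x \<in> carrier N'' \<Longrightarrow> q (\<sigma> x) = x"
    using bchoice[of "carrier N''" "\<lambda>x n. n \<in> carrier N \<and> q n = x"] by blast
  \<comment> \<open>By \<open>fib\<close> the section \<sigma> is additive and linear modulo
    \<open>W\<close>. It therefore induces a map from P \<otimes> N'' to the quotient by
    \<open>W\<close> that undoes the map induced by \<open>q\<close>.\<close>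
  let ?\<gamma> = "tmap (\<lambda>p. p) \<sigma>"
  have "tensor_relations S P N'' \<subseteq> {u. ?\<gamma> u \<in> W}"
  proof (rule tensor_relations_induct[OF P N''])
    show "diff_closed {u. ?\<gamma> u \<in> W}"
      using W by (auto simp: diff_closed_def frag_extend_diff)
    fix p p' n assume "p \<in> carrier P" "p' \<in> carrier P" "n \<in> carrier N''"
    then show "frag_of (p \<oplus>\<^bsub>P\<^esub> p', n) - frag_of (p, n) - frag_of (p', n) \<in> {u. ?\<gamma> u \<in> W}"
      using tensor_relations_add_left[of p P p' "\<sigma> n" N S] \<sigma> VW by (auto simp: frag_extend_diff)
  next
    fix p n n' assume *: "p \<in> carrier P" "n \<in> carrier N''" "n' \<in> carrier N''"
    have "frag_of (p, \<sigma> (n \<oplus>\<^bsub>N''\<^esub> n')) - frag_of (p, \<sigma> n) - frag_of (p, \<sigma> n')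
        = (frag_of (p, \<sigma> (n \<oplus>\<^bsub>N''\<^esub> n')) - frag_of (p, \<sigma> n \<oplus>\<^bsub>N\<^esub> \<sigma> n'))
          + (frag_of (p, \<sigma> n \<oplus>\<^bsub>N\<^esub> \<sigma> n') - frag_of (p, \<sigma> n) - frag_of (p, \<sigma> n'))"
      by simp
    also have "\<dots> \<in> W"
      using * \<sigma> by (intro diff_closed_add[OF W] fib subsetD[OF VW] tensor_relations_add_right)
        (auto simp: lhom_add[OF q])
    finally show "frag_of (p, n \<oplus>\<^bsub>N''\<^esub> n') - frag_of (p, n) - frag_of (p, n') \<in> {u. ?\<gamma> u \<in> W}"
      by (simp add: frag_extend_diff)
  next
    fix s p n assume *: "s \<in> carrier S" "p \<in> carrier P" "n \<in> carrier N''"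
    have "frag_of (s \<odot>\<^bsub>P\<^esub> p, \<sigma> n) - frag_of (p, \<sigma> (s \<odot>\<^bsub>N''\<^esub> n))
        = (frag_of (s \<odot>\<^bsub>P\<^esub> p, \<sigma> n) - frag_of (p, s \<odot>\<^bsub>N\<^esub> \<sigma> n))
          + (frag_of (p, s \<odot>\<^bsub>N\<^esub> \<sigma> n) - frag_of (p, \<sigma> (s \<odot>\<^bsub>N''\<^esub> n)))"
      by simp
    also have "\<dots> \<in> W"
      using * \<sigma> by (intro diff_closed_add[OF W] fib subsetD[OF VW] tensor_relations_balanced)
        (auto simp: lhom_smult[OF q] N.smult_closed N''.smult_closed)
    finally show "frag_of (s \<odot>\<^bsub>P\<^esub> p, n) - frag_of (p, s \<odot>\<^bsub>N''\<^esub> n) \<in> {u. ?\<gamma> u \<in> W}"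
      by (simp add: frag_extend_diff)
  qed
  then have "?\<gamma> (tmap (\<lambda>p. p) q y) \<in> W" using qy by blast
  moreover have "y - ?\<gamma> (tmap (\<lambda>p. p) q y) \<in> W"
    using y
  proof (induction rule: frags_induct)
    case (of x)
    then obtain p n where x: "x = (p, n)" "p \<in> carrier P" "n \<in> carrier N" by auto
    then show ?case
      using fib[of p n "\<sigma> (q n)"] \<sigma> lhom_closed[OF q] by simp
  next
    case (diff u v)
    have eq: "(u - v) - ?\<gamma> (tmap (\<lambda>p. p) q (u - v))
        = (u - ?\<gamma> (tmap (\<lambda>p. p) q u)) - (v - ?\<gamma> (tmap (\<lambda>p. p) q v))"
      by (simp add: frag_extend_diff)
    show ?case unfolding eq by (rule diff_closed_diff[OF W diff.IH])
  qed (simp add: diff_closed_zero[OF W])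
  ultimately have "y \<in> W"
    using diff_closed_add[OF W, of "y - ?\<gamma> (tmap (\<lambda>p. p) q y)" "?\<gamma> (tmap (\<lambda>p. p) q y)"] by simp
  then show ?thesis by (simp add: W_def)
qed

text \<open>\<open>c\<close> represents the map P \<otimes> N \<rightarrow> N induced by the x-th
  coordinate functional of the dual basis, that is, the x-th coordinate of a tensor.\<close>

definition tensor_coord where
  "tensor_coord S P N \<phi> x c \<longleftrightarrow> (\<forall>p\<in>carrier P. \<forall>n\<in>carrier N. c (frag_of (p, n)) = \<phi> p x \<odot>\<^bsub>N\<^esub> n) \<and>
    (\<forall>u\<in>frags (carrier P \<times> carrier N). c u \<in> carrier N) \<and> c 0 = \<zero>\<^bsub>N\<^esub> \<and>
    (\<forall>u\<in>frags (carrier P \<times> carrier N). \<forall>v\<in>frags (carrier P \<times> carrier N). c (u - v) = c u \<ominus>\<^bsub>N\<^esub> c v) \<and>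
    (\<forall>u\<in>tensor_relations S P N. c u = \<zero>\<^bsub>N\<^esub>)"

lemma tensor_coord_exists:
  assumes \<phi>: "dual_basis (opposite_ring S) P G \<phi>" and N: "left_module S N"
  obtains c where "\<And>x. tensor_coord S P N \<phi> x (c x)"
proof -
  have P: "right_module S P" and \<phi>h: "\<phi> \<in> lhom (opposite_ring S) P (free_mod (opposite_ring S) G)"
    using \<phi> by (auto simp: dual_basis_def)
  interpret P: left_module "opposite_ring S" P by fact
  interpret N: left_module S N by fact
  have cl: "\<phi> p x \<in> carrier S" if "p \<in> carrier P" for p x
    using lhom_closed[OF \<phi>h that] by (simp add: mem_free_mod)
  have "\<exists>c. tensor_coord S P N \<phi> x c" for x
    unfolding tensor_coord_def
    by (rule bilinear_extension[OF P N N.M.abelian_group_axioms, of "\<lambda>p n. \<phi> p x \<odot>\<^bsub>N\<^esub> n"])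
      (auto simp: cl N.smult_closed lhom_add[OF \<phi>h] lhom_smult[OF \<phi>h, simplified] free_mod_add
        free_mod_smult N.smult_l_distr N.smult_r_distr N.smult_assoc)
  then show ?thesis using that by metis
qed

text \<open>A tensor is the sum of the x \<otimes> c_x(u), because p = \<Sum> \<phi>(p, x) x and
  scalars may be moved across. The claim is made for every large enough finite \<open>Y\<close>, so
  that the expansions of \<open>u\<close> and \<open>v\<close> can be subtracted over a common index
  set.\<close>

lemma tensor_coord_expansion:
  assumes \<phi>: "dual_basis (opposite_ring S) P G \<phi>" and N: "left_module S N"
    and c: "\<And>x. tensor_coord S P N \<phi> x (c x)" and u: "u \<in> frags (carrier P \<times> carrier N)"
  shows "\<exists>X. finite X \<and> X \<subseteq> G \<and> (\<forall>Y. finite Y \<longrightarrow> X \<subseteq> Y \<longrightarrow> Y \<subseteq> G \<longrightarrow>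
    u - (\<Sum>x\<in>Y. frag_of (x, c x u)) \<in> tensor_relations S P N)"
proof -
  have P: "right_module S P" and \<phi>h: "\<phi> \<in> lhom (opposite_ring S) P (free_mod (opposite_ring S) G)"
    and G: "G \<subseteq> carrier P" and \<phi>p: "\<And>p. p \<in> carrier P \<Longrightarrow> lin_comb (opposite_ring S) P (\<phi> p) (\<lambda>x. x) = p"
    using \<phi> by (auto simp: dual_basis_def)
  interpret P: left_module "opposite_ring S" P by fact
  interpret N: left_module S N by fact
  note V = diff_closed_tensor_relations(1)[OF P N]
  let ?V = "tensor_relations S P N" and ?F = "frags (carrier P \<times> carrier N)"
  show ?thesis
    using u
  proof (induction rule: frags_induct)
    case zero
    have "- (\<Sum>x\<in>Y. frag_of (x, c x 0)) \<in> ?V" if "Y \<subseteq> G" for Y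
      using c that G frag_of_zero_relations(2)[OF P N]
      by (intro diff_closed_uminus[OF V] diff_closed_sum[OF V]) (auto simp: tensor_coord_def)
    then show ?case by (intro exI[of _ "{}"]) auto
  next
    case (of pn)
    then obtain p n where pn: "pn = (p, n)" "p \<in> carrier P" "n \<in> carrier N" by auto
    have cl: "\<phi> p x \<in> carrier S" for x
      using lhom_closed[OF \<phi>h pn(2)] by (simp add: mem_free_mod)
    have "frag_of pn - (\<Sum>x\<in>Y. frag_of (x, c x (frag_of pn))) \<in> ?V"
      if Y: "finite Y" "{x. \<phi> p x \<noteq> \<zero>\<^bsub>S\<^esub>} \<subseteq> Y" "Y \<subseteq> G" for Y
    proof -
      have "p = finsum P (\<lambda>x. \<phi> p x \<odot>\<^bsub>P\<^esub> x) Y"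
        using P.lin_comb_superset[OF lhom_closed[OF \<phi>h pn(2)], of "\<lambda>x. x" Y] \<phi>p[OF pn(2)] Y G by auto
      then have 1: "frag_of (p, n) - (\<Sum>x\<in>Y. frag_of (\<phi> p x \<odot>\<^bsub>P\<^esub> x, n)) \<in> ?V"
        using frag_of_finsum_relations[OF P N Y(1) _ pn(3), of "\<lambda>x. \<phi> p x \<odot>\<^bsub>P\<^esub> x"] Y G cl
          P.smult_closed by (auto simp: subset_iff)
      have 2: "(\<Sum>x\<in>Y. frag_of (\<phi> p x \<odot>\<^bsub>P\<^esub> x, n) - frag_of (x, \<phi> p x \<odot>\<^bsub>N\<^esub> n)) \<in> ?V"
        using Y G cl pn by (intro diff_closed_sum[OF V] tensor_relations_balanced) auto
      have "c x (frag_of (p, n)) = \<phi> p x \<odot>\<^bsub>N\<^esub> n" for x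
        using c pn by (auto simp: tensor_coord_def)
      then show ?thesis
        using diff_closed_add[OF V 1 2] by (simp add: sum_subtractf pn)
    qed
    then show ?case
      using lhom_closed[OF \<phi>h pn(2)]
      by (intro exI[of _ "{x. \<phi> p x \<noteq> \<zero>\<^bsub>S\<^esub>}"]) (auto simp: mem_free_mod)
  next
    case (diff u v)
    obtain X where X: "finite X" "X \<subseteq> G" "\<And>Y. finite Y \<Longrightarrow> X \<subseteq> Y \<Longrightarrow> Y \<subseteq> G \<Longrightarrow>
        u - (\<Sum>x\<in>Y. frag_of (x, c x u)) \<in> ?V"
      using diff.IH(1) by blast
    obtain X' where X': "finite X'" "X' \<subseteq> G" "\<And>Y. finite Y \<Longrightarrow> X' \<subseteq> Y \<Longrightarrow> Y \<subseteq> G \<Longrightarrow>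
        v - (\<Sum>x\<in>Y. frag_of (x, c x v)) \<in> ?V"
      using diff.IH(2) by blast
    have "(u - v) - (\<Sum>x\<in>Y. frag_of (x, c x (u - v))) \<in> ?V"
      if Y: "finite Y" "X \<union> X' \<subseteq> Y" "Y \<subseteq> G" for Y
    proof -
      have "frag_of (x, c x u \<ominus>\<^bsub>N\<^esub> c x v) - (frag_of (x, c x u) - frag_of (x, c x v)) \<in> ?V" if "x \<in> Y" for x
      proof -
        have *: "c x u \<in> carrier N" "c x v \<in> carrier N" "x \<in> carrier P"
          using c diff.hyps that Y(3) G by (auto simp: tensor_coord_def)
        have "(c x u \<ominus>\<^bsub>N\<^esub> c x v) \<oplus>\<^bsub>N\<^esub> c x v = c x u"
          using * by (simp add: a_minus_def N.M.add.m_assoc N.M.l_neg)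
        then show ?thesis
          using diff_closed_uminus[OF V tensor_relations_add_right[of x P "c x u \<ominus>\<^bsub>N\<^esub> c x v" N "c x v" S]] *
          by (simp add: algebra_simps)
      qed
      then have 1: "(\<Sum>x\<in>Y. frag_of (x, c x (u - v)) - (frag_of (x, c x u) - frag_of (x, c x v))) \<in> ?V"
        using c diff.hyps by (intro diff_closed_sum[OF V]) (auto simp: tensor_coord_def)
      have "u - (\<Sum>x\<in>Y. frag_of (x, c x u)) \<in> ?V" "v - (\<Sum>x\<in>Y. frag_of (x, c x v)) \<in> ?V"
        using X(3) X'(3) Y by auto
      from diff_closed_diff[OF V diff_closed_diff[OF V this] 1] show ?thesis
        by (simp add: sum_subtractf sum.distrib algebra_simps)
    qed
    then show ?case
      using X X' by (intro exI[of _ "X \<union> X'"]) auto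
  qed
qed


lemma tensor_coord_injective:
  assumes \<phi>: "dual_basis (opposite_ring S) P G \<phi>" and N: "left_module S N"
    and c: "\<And>x. tensor_coord S P N \<phi> x (c x)" and u: "u \<in> frags (carrier P \<times> carrier N)"
    and zero: "\<And>x. c x u = \<zero>\<^bsub>N\<^esub>"
  shows "u \<in> tensor_relations S P N"
proof -
  have P: "right_module S P" and G: "G \<subseteq> carrier P" using \<phi> by (auto simp: dual_basis_def)
  note V = diff_closed_tensor_relations(1)[OF P N]
  obtain X where X: "finite X" "X \<subseteq> G" "u - (\<Sum>x\<in>X. frag_of (x, c x u)) \<in> tensor_relations S P N"
    using tensor_coord_expansion[OF \<phi> N c u] by blast
  have "(\<Sum>x\<in>X. frag_of (x, c x u)) \<in> tensor_relations S P N"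
    unfolding zero using X G by (intro diff_closed_sum[OF V] frag_of_zero_relations(2)[OF P N]) auto
  from diff_closed_add[OF V X(3) this] show ?thesis by simp
qed

text \<open>Taking coordinates commutes with \<open>i\<close>. If the image of \<open>u\<close> is
  zero, then \<open>i\<close> kills every coordinate of \<open>u\<close>; as \<open>i\<close> is
  injective these vanish, and coordinates determine a tensor.\<close>

lemma projective_flat:
  assumes P: "projective_module (opposite_ring S) P" and N': "left_module S N'" and N: "left_module S N"
    and i: "i \<in> lhom S N' N" and inj: "\<And>n. n \<in> carrier N' \<Longrightarrow> i n = \<zero>\<^bsub>N\<^esub> \<Longrightarrow> n = \<zero>\<^bsub>N'\<^esub>"
    and u: "u \<in> frags (carrier P \<times> carrier N')" and iu: "tmap (\<lambda>p. p) i u \<in> tensor_relations S P N"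
  shows "u \<in> tensor_relations S P N'"
proof -
  obtain \<phi> where \<phi>: "dual_basis (opposite_ring S) P (carrier P) \<phi>"
    using projective_dual_basis_carrier[OF P] .
  then have \<phi>h: "\<phi> \<in> lhom (opposite_ring S) P (free_mod (opposite_ring S) (carrier P))"
    by (simp add: dual_basis_def)
  obtain c where c: "\<And>x. tensor_coord S P N \<phi> x (c x)"
    using tensor_coord_exists[OF \<phi> N] by metis
  obtain c' where c': "\<And>x. tensor_coord S P N' \<phi> x (c' x)"
    using tensor_coord_exists[OF \<phi> N'] by metis
  have "tmap (\<lambda>p. p) i v \<in> frags (carrier P \<times> carrier N) \<and> i (c' x v) = c x (tmap (\<lambda>p. p) i v)"
    if "v \<in> frags (carrier P \<times> carrier N')" for v x
    using that
  proof (induction rule: frags_induct)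
    case zero
    then show ?case
      using c[of x] c'[of x] lhom_zero[OF N' N i] diff_closed_zero[OF diff_closed_frags]
      by (simp add: tensor_coord_def)
  next
    case (of pn)
    then obtain p n where pn: "pn = (p, n)" "p \<in> carrier P" "n \<in> carrier N'" by auto
    have "\<phi> p x \<in> carrier S"
      using lhom_closed[OF \<phi>h pn(2)] by (simp add: mem_free_mod)
    then show ?case
      using pn c[of x] c'[of x] lhom_closed[OF i] lhom_smult[OF i]
      by (simp add: tensor_coord_def frag_of_mem_frags)
  next
    case (diff v w)
    have "i (c' x (v - w)) = i (c' x v) \<ominus>\<^bsub>N\<^esub> i (c' x w)"
      using diff.hyps c'[of x] by (simp add: tensor_coord_def lhom_diff[OF N' N i])
    then show ?case
      using diff.IH c[of x] by (simp add: tensor_coord_def frag_extend_diff diff_closed_diff[OF diff_closed_frags])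
  qed
  then have "i (c' x u) = \<zero>\<^bsub>N\<^esub>" for x
    using u iu c[of x] by (simp add: tensor_coord_def)
  then have "c' x u = \<zero>\<^bsub>N'\<^esub>" for x
    using inj c'[of x] u by (simp add: tensor_coord_def)
  then show ?thesis
    using tensor_coord_injective[OF \<phi> N' c' u] by blast
qed

section \<open>The complexes \<open>X(K)\<close> for general pairings, and their behaviour in short
  exact sequences\<close>

section \<open>Augmented tensor complexes\<close>

text \<open>The summation map from formal sums of elements of \<open>K\<close> to \<open>K\<close>.
  Modulo its kernel \<open>sum_relations K\<close>, the formal sums recover \<open>K\<close>, which
  makes \<open>K\<close> a term of a \<open>subquotient_complex\<close>.\<close>

definition msum :: "('r, 'k) module \<Rightarrow> ('k \<Rightarrow>\<^sub>0 int) \<Rightarrow> 'k" where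
  "msum K = (SOME h. (\<forall>x\<in>carrier K. h (frag_of x) = x) \<and> (\<forall>u\<in>frags (carrier K). h u \<in> carrier K) \<and>
    h 0 = \<zero>\<^bsub>K\<^esub> \<and> (\<forall>u\<in>frags (carrier K). \<forall>v\<in>frags (carrier K). h (u - v) = h u \<ominus>\<^bsub>K\<^esub> h v))"

definition sum_relations :: "('r, 'k) module \<Rightarrow> ('k \<Rightarrow>\<^sub>0 int) set" where
  "sum_relations K = {u \<in> frags (carrier K). msum K u = \<zero>\<^bsub>K\<^esub>}"

abbreviation kmap where
  "kmap \<iota> \<equiv> frag_extend (\<lambda>x. frag_of (\<iota> x))"

context
  fixes R :: "('r, 'l) ring_scheme" and K :: "('r, 'k) module"
  assumes K: "left_module R K"
begin

interpretation K: left_module R K by (rule K)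

lemma msum:
  "x \<in> carrier K \<Longrightarrow> msum K (frag_of x) = x"
  "u \<in> frags (carrier K) \<Longrightarrow> msum K u \<in> carrier K"
  "msum K 0 = \<zero>\<^bsub>K\<^esub>"
  "u \<in> frags (carrier K) \<Longrightarrow> v \<in> frags (carrier K) \<Longrightarrow> msum K (u - v) = msum K u \<ominus>\<^bsub>K\<^esub> msum K v"
  using someI_ex[OF additive_extension[OF K.M.abelian_group_axioms, of "carrier K" "\<lambda>x. x"], folded msum_def]
  by auto

lemma diff_closed_sum_relations: "diff_closed (sum_relations K)"
  unfolding diff_closed_def sum_relations_def
  by (auto simp: diff_closed_zero[OF diff_closed_frags] diff_closed_diff[OF diff_closed_frags] msum(3,4)
      a_minus_def)

lemma frag_of_sum_relations: "x \<in> carrier K \<Longrightarrow> frag_of x \<in> sum_relations K \<longleftrightarrow> x = \<zero>\<^bsub>K\<^esub>"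
  by (simp add: sum_relations_def frag_of_mem_frags msum)

lemma frag_of_add_sum_relations:
  assumes "x \<in> carrier K" "y \<in> carrier K"
  shows "frag_of (x \<oplus>\<^bsub>K\<^esub> y) - frag_of x - frag_of y \<in> sum_relations K"
proof -
  have "x \<oplus>\<^bsub>K\<^esub> y \<ominus>\<^bsub>K\<^esub> x = y"
    using assms by (simp add: a_minus_def K.M.add.m_comm[of x y] K.M.add.m_assoc K.M.r_neg)
  then show ?thesis
    using assms by (simp add: sum_relations_def frag_of_mem_frags diff_closed_diff[OF diff_closed_frags]
        msum a_minus_def[of K y y] K.M.r_neg)
qed

lemma msum_relation:
  assumes "u \<in> frags (carrier K)"
  shows "u - frag_of (msum K u) \<in> sum_relations K"
  using assms by (simp add: sum_relations_def frag_of_mem_frags diff_closed_diff[OF diff_closed_frags]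
      msum a_minus_def K.M.r_neg)

end

lemma kmap_mem:
  assumes "\<And>x. x \<in> carrier K \<Longrightarrow> \<iota> x \<in> carrier K'" "u \<in> frags (carrier K)"
  shows "kmap \<iota> u \<in> frags (carrier K')"
  by (rule frag_extend_mem[OF diff_closed_frags _ assms(2)]) (auto simp: assms frag_of_mem_frags)

lemma msum_kmap:
  assumes K: "left_module R K" "left_module R K'" and \<iota>: "\<iota> \<in> lhom R K K'"
    and u: "u \<in> frags (carrier K)"
  shows "msum K' (kmap \<iota> u) = \<iota> (msum K u)"
  using u
proof (induction rule: frags_induct)
  case zero
  then show ?case using msum(3)[OF K(1)] msum(3)[OF K(2)] lhom_zero[OF K \<iota>] by simp
next
  case (of x)
  then show ?case using msum(1)[OF K(1)] msum(1)[OF K(2)] lhom_closed[OF \<iota>] by simp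
next
  case (diff u v)
  have "kmap \<iota> w \<in> frags (carrier K')" if "w \<in> frags (carrier K)" for w
    by (rule kmap_mem[OF _ that]) (rule lhom_closed[OF \<iota>])
  then show ?case
    using diff by (simp add: frag_extend_diff msum(4)[OF K(1)] msum(4)[OF K(2)] lhom_diff[OF K \<iota>] msum(2)[OF K(1)])
qed

text \<open>
  The complex \<open>\<dots> \<rightarrow> P 1 \<otimes> N \<rightarrow> P 0 \<otimes> N \<rightarrow> K \<rightarrow> 0\<close> has \<open>0\<close> at index \<open>0\<close>, \<open>K\<close> at index \<open>1\<close> and \<open>P j \<otimes> N\<close>
  at index \<open>j + 2\<close>. Pairs are used only to place all these groups in one type.
\<close>

fun aug_U :: "(nat \<Rightarrow> ('s, 'p) module) \<Rightarrow> ('s, 'n) module \<Rightarrow> ('r, 'k) module \<Rightarrow> nat \<Rightarrow>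
    (('p \<times> 'n \<Rightarrow>\<^sub>0 int) \<times> ('k \<Rightarrow>\<^sub>0 int)) set" where
  "aug_U P N K 0 = {(0, 0)}"
| "aug_U P N K (Suc 0) = {0} \<times> frags (carrier K)"
| "aug_U P N K (Suc (Suc j)) = frags (carrier (P j) \<times> carrier N) \<times> {0}"

fun aug_V :: "('s, 'l) ring_scheme \<Rightarrow> (nat \<Rightarrow> ('s, 'p) module) \<Rightarrow> ('s, 'n) module \<Rightarrow> ('r, 'k) module \<Rightarrow> nat \<Rightarrow>
    (('p \<times> 'n \<Rightarrow>\<^sub>0 int) \<times> ('k \<Rightarrow>\<^sub>0 int)) set" where
  "aug_V S P N K 0 = {(0, 0)}"
| "aug_V S P N K (Suc 0) = {0} \<times> sum_relations K"
| "aug_V S P N K (Suc (Suc j)) = tensor_relations S (P j) N \<times> {0}"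

abbreviation tensor_eval where
  "tensor_eval e \<epsilon> \<equiv> frag_extend (\<lambda>(p, n). frag_of (e (\<epsilon> p) n))"

fun aug_d :: "('c \<Rightarrow> 'n \<Rightarrow> 'k) \<Rightarrow> ('p \<Rightarrow> 'c) \<Rightarrow> (nat \<Rightarrow> 'p \<Rightarrow> 'p) \<Rightarrow> nat \<Rightarrow>
    ('p \<times> 'n \<Rightarrow>\<^sub>0 int) \<times> ('k \<Rightarrow>\<^sub>0 int) \<Rightarrow> ('p \<times> 'n \<Rightarrow>\<^sub>0 int) \<times> ('k \<Rightarrow>\<^sub>0 int)" where
  "aug_d e \<epsilon> d 0 x = (0, 0)"
| "aug_d e \<epsilon> d (Suc 0) x = (0, tensor_eval e \<epsilon> (fst x))"
| "aug_d e \<epsilon> d (Suc (Suc j)) x = (tmap (d j) (\<lambda>n. n) (fst x), 0)"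

lemma pair_zero: "(0, 0) = (0 :: 'a::zero \<times> 'b::zero)"
  by (simp add: zero_prod_def)

lemma nat_cases3: obtains "k = 0" | "k = Suc 0" | j where "k = Suc (Suc j)"
  by (metis not0_implies_Suc)

text \<open>The datum of a homomorphism A \<otimes> N \<rightarrow> K. It abstracts from the
  evaluation C \<otimes> Hom(C, K) \<rightarrow> K because restrictions of the evaluation to
  submodules and the pairings induced on quotients are needed as well.\<close>

locale balanced_pairing =
  A: left_module "opposite_ring S" A + N: left_module S N + K: left_module R K
  for R :: "'r ring" and S :: "'s ring" and A :: "('s, 'c) module" and N :: "('s, 'n) module"
    and K :: "('r, 'k) module" +
  fixes e :: "'c \<Rightarrow> 'n \<Rightarrow> 'k"
  assumes e_closed: "c \<in> carrier A \<Longrightarrow> n \<in> carrier N \<Longrightarrow> e c n \<in> carrier K"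
    and e_add_left: "c \<in> carrier A \<Longrightarrow> c' \<in> carrier A \<Longrightarrow> n \<in> carrier N \<Longrightarrow>
      e (c \<oplus>\<^bsub>A\<^esub> c') n = e c n \<oplus>\<^bsub>K\<^esub> e c' n"
    and e_add_right: "c \<in> carrier A \<Longrightarrow> n \<in> carrier N \<Longrightarrow> n' \<in> carrier N \<Longrightarrow>
      e c (n \<oplus>\<^bsub>N\<^esub> n') = e c n \<oplus>\<^bsub>K\<^esub> e c n'"
    and e_balanced: "s \<in> carrier S \<Longrightarrow> c \<in> carrier A \<Longrightarrow> n \<in> carrier N \<Longrightarrow>
      e (s \<odot>\<^bsub>A\<^esub> c) n = e c (s \<odot>\<^bsub>N\<^esub> n)"
begin

lemma e_zero_left: "n \<in> carrier N \<Longrightarrow> e \<zero>\<^bsub>A\<^esub> n = \<zero>\<^bsub>K\<^esub>"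
  using e_add_left[of "\<zero>\<^bsub>A\<^esub>" "\<zero>\<^bsub>A\<^esub>" n] e_closed[of "\<zero>\<^bsub>A\<^esub>" n] by (simp add: K.M.add.r_cancel_one')

lemma tensor_eval_mem:
  assumes g: "g \<in> lhom (opposite_ring S) Q A" and u: "u \<in> frags (carrier Q \<times> carrier N)"
  shows "tensor_eval e g u \<in> frags (carrier K)"
  by (rule frag_extend_mem[OF diff_closed_frags _ u]) (auto simp: frag_of_mem_frags e_closed lhom_closed[OF g])

lemma tensor_eval_relations:
  assumes Q: "right_module S Q" and g: "g \<in> lhom (opposite_ring S) Q A" and u: "u \<in> tensor_relations S Q N"
  shows "tensor_eval e g u \<in> sum_relations K"
proof -
  note V = diff_closed_sum_relations[OF K.left_module_axioms]
  have "tensor_relations S Q N \<subseteq> {u. tensor_eval e g u \<in> sum_relations K}"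
    by (rule tensor_relations_induct[OF Q N.left_module_axioms])
      (auto simp: diff_closed_def frag_extend_diff diff_closed_zero[OF V] diff_closed_diff[OF V]
        lhom_add[OF g] lhom_smult[OF g, simplified] lhom_closed[OF g] e_add_left e_add_right e_balanced
        e_closed frag_of_add_sum_relations[OF K.left_module_axioms])
  with u show ?thesis by blast
qed

end

locale augmented_complex = balanced_pairing R S A N K e + proj_resolution "opposite_ring S" A P \<epsilon> d
  for R :: "'r ring" and S :: "'s ring" and A :: "('s, 'c) module" and N :: "('s, 'n) module"
    and K :: "('r, 'k) module" and e :: "'c \<Rightarrow> 'n \<Rightarrow> 'k"
    and P :: "nat \<Rightarrow> ('s, 'p) module" and \<epsilon> d
begin

lemma tmap_d_mem:
  "u \<in> frags (carrier (P (Suc j)) \<times> carrier N) \<Longrightarrow> tmap (d j) (\<lambda>n. n) u \<in> frags (carrier (P j) \<times> carrier N)"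
  by (rule tmap_mem) (auto simp: lhom_closed[OF d])

lemma tensor_eval_d:
  assumes "u \<in> frags (carrier (P (Suc 0)) \<times> carrier N)"
  shows "tensor_eval e \<epsilon> (tmap (d 0) (\<lambda>n. n) u) \<in> sum_relations K"
  using assms
proof (induction rule: frags_induct)
  case (of x)
  then show ?case
    by (auto simp: \<epsilon>d e_zero_left frag_of_sum_relations[OF K.left_module_axioms])
qed (auto simp: diff_closed_zero[OF diff_closed_sum_relations[OF K.left_module_axioms]] frag_extend_diff
    intro: diff_closed_diff[OF diff_closed_sum_relations[OF K.left_module_axioms]])

lemma tmap_dd:
  assumes "u \<in> frags (carrier (P (Suc (Suc j))) \<times> carrier N)"
  shows "tmap (d j) (\<lambda>n. n) (tmap (d (Suc j)) (\<lambda>n. n) u) \<in> tensor_relations S (P j) N"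
  using assms
proof (induction rule: frags_induct)
  case (of x)
  then show ?case
    by (auto simp: dd frag_of_zero_relations[OF P N.left_module_axioms])
qed (auto simp: diff_closed_zero[OF diff_closed_tensor_relations(1)[OF P N.left_module_axioms]] frag_extend_diff
    intro: diff_closed_diff[OF diff_closed_tensor_relations(1)[OF P N.left_module_axioms]])

text \<open>The identity belongs to \<open>lhom\<close> only in its restricted form; on
  \<open>frags\<close> the two forms act alike.\<close>

lemma id_lhom_apply: "tmap g (\<lambda>n. n) u = tmap g (\<lambda>n\<in>carrier N. n) u"
  if "u \<in> frags (X \<times> carrier N)"
  using that by (induction rule: frags_induct) (auto simp: frag_extend_diff)

lemma tmap_left_relations:
  assumes "right_module S B" "right_module S B'" "g \<in> lhom (opposite_ring S) B B'"
    and u: "u \<in> tensor_relations S B N"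
  shows "tmap g (\<lambda>n. n) u \<in> tensor_relations S B' N"
  using tmap_tensor_relations[OF assms(1,2) N.left_module_axioms N.left_module_axioms assms(3)
      lhom_id[OF N.left_module_axioms] u]
    id_lhom_apply subsetD[OF diff_closed_tensor_relations(2)[OF assms(1) N.left_module_axioms] u]
  by metis

sublocale cx: subquotient_complex "aug_U P N K" "aug_V S P N K" "aug_d e \<epsilon> d"
proof
  note N = N.left_module_axioms and K = K.left_module_axioms
  fix k
  show "diff_closed (aug_U P N K k)"
    by (cases k rule: nat_cases3)
      (use diff_closed_zero[OF diff_closed_frags] diff_closed_diff[OF diff_closed_frags] in
        \<open>auto simp: diff_closed_def prod_eq_iff mem_Times_iff\<close>)
  show "diff_closed (aug_V S P N K k)"
    by (cases k rule: nat_cases3)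
      (use diff_closed_sum_relations[OF K] diff_closed_tensor_relations(1)[OF P N] in
        \<open>auto simp: diff_closed_def prod_eq_iff mem_Times_iff\<close>)
  fix x y
  show "aug_d e \<epsilon> d k (x - y) = aug_d e \<epsilon> d k x - aug_d e \<epsilon> d k y"
    by (cases k rule: nat_cases3) (auto simp: frag_extend_diff pair_zero)
  show "aug_d e \<epsilon> d k x \<in> aug_U P N K k" if "x \<in> aug_U P N K (Suc k)"
    using that
    by (cases k rule: nat_cases3) (auto simp: tensor_eval_mem[OF \<epsilon>] tmap_d_mem)
  show "aug_d e \<epsilon> d k x \<in> aug_V S P N K k" if "x \<in> aug_V S P N K (Suc k)"
    using that
    by (cases k rule: nat_cases3) (auto simp: tensor_eval_relations[OF P \<epsilon>] tmap_left_relations[OF P P d])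
  show "aug_d e \<epsilon> d k (aug_d e \<epsilon> d (Suc k) x) \<in> aug_V S P N K k" if "x \<in> aug_U P N K (Suc (Suc k))"
    using that
    by (cases k rule: nat_cases3) (auto simp: tensor_eval_d tmap_dd)
qed

text \<open>In terms of A \<otimes> N \<rightarrow> K, index 0 means surjectivity, index 1 means
  injectivity, and index j + 2 means that Tor_{j+1}(A, N) vanishes, as the next two lemmas and this
  one spell out.\<close>

lemma exact_at_0_iff:
  "cx.exact_at 0 \<longleftrightarrow> (\<forall>v\<in>frags (carrier K). \<exists>u\<in>frags (carrier (P 0) \<times> carrier N).
    v - tensor_eval e \<epsilon> u \<in> sum_relations K)"
  unfolding cx.exact_at_def by (auto simp: numeral_eq_Suc)

lemma exact_at_1_iff:
  "cx.exact_at (Suc 0) \<longleftrightarrow> (\<forall>u\<in>frags (carrier (P 0) \<times> carrier N). tensor_eval e \<epsilon> u \<in> sum_relations K \<longrightarrow>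
    (\<exists>w\<in>frags (carrier (P (Suc 0)) \<times> carrier N). u - tmap (d 0) (\<lambda>n. n) w \<in> tensor_relations S (P 0) N))"
  unfolding cx.exact_at_def by auto

lemma exact_at_Suc_iff:
  "cx.exact_at (Suc (Suc j)) \<longleftrightarrow> (\<forall>u\<in>frags (carrier (P (Suc j)) \<times> carrier N).
    tmap (d j) (\<lambda>n. n) u \<in> tensor_relations S (P j) N \<longrightarrow>
    (\<exists>w\<in>frags (carrier (P (Suc (Suc j))) \<times> carrier N).
      u - tmap (d (Suc j)) (\<lambda>n. n) w \<in> tensor_relations S (P (Suc j)) N))"
  unfolding cx.exact_at_def by auto

end

text \<open>Makes exactness at one index a predicate of the data alone, so that different pairings
  and resolutions can be compared outside the locale.\<close>

definition aug_exact where
  "aug_exact S P \<epsilon> d N K e k \<longleftrightarrow> subquotient_complex.exact_at (aug_U P N K) (aug_V S P N K) (aug_d e \<epsilon> d) k"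

locale pairing_ses = X: balanced_pairing R S A N' K' e' + Y: balanced_pairing R S A N K e +
    Z: balanced_pairing R S A N'' K'' e''
  for R :: "'r ring" and S :: "'s ring" and A :: "('s, 'c) module"
    and N' :: "('s, 'n1) module" and K' :: "('r, 'k1) module" and e'
    and N :: "('s, 'n2) module" and K :: "('r, 'k2) module" and e
    and N'' :: "('s, 'n3) module" and K'' :: "('r, 'k3) module" and e'' +
  fixes i :: "'n1 \<Rightarrow> 'n2" and \<iota> :: "'k1 \<Rightarrow> 'k2" and q :: "'n2 \<Rightarrow> 'n3" and \<kappa> :: "'k2 \<Rightarrow> 'k3"
  assumes i: "i \<in> lhom S N' N" and q: "q \<in> lhom S N N''"
    and \<iota>: "\<iota> \<in> lhom R K' K" and \<kappa>: "\<kappa> \<in> lhom R K K''"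
    and i_inj: "n' \<in> carrier N' \<Longrightarrow> i n' = \<zero>\<^bsub>N\<^esub> \<Longrightarrow> n' = \<zero>\<^bsub>N'\<^esub>"
    and \<iota>_inj: "k' \<in> carrier K' \<Longrightarrow> \<iota> k' = \<zero>\<^bsub>K\<^esub> \<Longrightarrow> k' = \<zero>\<^bsub>K'\<^esub>"
    and q_ker: "n \<in> carrier N \<Longrightarrow> q n = \<zero>\<^bsub>N''\<^esub> \<Longrightarrow> n \<in> i ` carrier N'"
    and \<kappa>_ker: "k \<in> carrier K \<Longrightarrow> \<kappa> k = \<zero>\<^bsub>K''\<^esub> \<Longrightarrow> k \<in> \<iota> ` carrier K'"
    and qi: "n' \<in> carrier N' \<Longrightarrow> q (i n') = \<zero>\<^bsub>N''\<^esub>"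
    and \<kappa>\<iota>: "k' \<in> carrier K' \<Longrightarrow> \<kappa> (\<iota> k') = \<zero>\<^bsub>K''\<^esub>"
    and q_surj: "q ` carrier N = carrier N''"
    and \<kappa>_surj: "\<kappa> ` carrier K = carrier K''"
    and e_i: "c \<in> carrier A \<Longrightarrow> n' \<in> carrier N' \<Longrightarrow> \<iota> (e' c n') = e c (i n')"
    and e_q: "c \<in> carrier A \<Longrightarrow> n \<in> carrier N \<Longrightarrow> \<kappa> (e c n) = e'' c (q n)"
begin

text \<open>At the terms P j \<otimes> N, exactness on the left is flatness of \<open>P j\<close>,
  and exactness in the middle is right exactness of the tensor product. At the term \<open>K\<close>
  both are the exactness of the given sequence.\<close>

lemma aug_complex_ses:
  assumes res: "projective_resolution (opposite_ring S) A P \<epsilon> d"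
  shows "complex_ses (aug_U P N' K') (aug_V S P N' K') (aug_d e' \<epsilon> d)
    (aug_U P N K) (aug_V S P N K) (aug_d e \<epsilon> d) (aug_U P N'' K'') (aug_V S P N'' K'') (aug_d e'' \<epsilon> d)
    (\<lambda>x. (tmap (\<lambda>p. p) i (fst x), kmap \<iota> (snd x))) (\<lambda>x. (tmap (\<lambda>p. p) q (fst x), kmap \<kappa> (snd x)))"
    (is "complex_ses _ _ _ _ _ _ _ _ _ ?\<alpha> ?\<beta>")
proof -
  interpret AX: augmented_complex R S A N' K' e' P \<epsilon> d
    by (intro augmented_complex.intro X.balanced_pairing_axioms proj_resolution.intro res)
  interpret AY: augmented_complex R S A N K e P \<epsilon> d
    by (intro augmented_complex.intro Y.balanced_pairing_axioms proj_resolution.intro res)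
  interpret AZ: augmented_complex R S A N'' K'' e'' P \<epsilon> d
    by (intro augmented_complex.intro Z.balanced_pairing_axioms proj_resolution.intro res)
  note N = X.N.left_module_axioms Y.N.left_module_axioms Z.N.left_module_axioms
  note K = X.K.left_module_axioms Y.K.left_module_axioms Z.K.left_module_axioms
  note ev0 = diff_closed_zero[OF diff_closed_frags] diff_closed_zero[OF diff_closed_sum_relations[OF K(1)]]
    diff_closed_zero[OF diff_closed_sum_relations[OF K(2)]] diff_closed_zero[OF diff_closed_sum_relations[OF K(3)]]
    diff_closed_zero[OF diff_closed_tensor_relations(1)[OF AX.P N(1)]]
    diff_closed_zero[OF diff_closed_tensor_relations(1)[OF AX.P N(2)]]
    diff_closed_zero[OF diff_closed_tensor_relations(1)[OF AX.P N(3)]]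
  have i_eq: "tmap (\<lambda>p. p) f u = tmap (\<lambda>p\<in>carrier (P j). p) f u" if "u \<in> frags (carrier (P j) \<times> X)" for f u j X
    using that by (induction rule: frags_induct) (auto simp: frag_extend_diff)
  have iV: "tmap (\<lambda>p. p) i u \<in> tensor_relations S (P j) N" if "u \<in> tensor_relations S (P j) N'" for u j
    unfolding i_eq[OF subsetD[OF diff_closed_tensor_relations(2)[OF AX.P N(1)] that]]
    by (rule tmap_tensor_relations[OF AX.P AX.P N(1,2) lhom_id[OF AX.P] i that])
  have qV: "tmap (\<lambda>p. p) q u \<in> tensor_relations S (P j) N''" if "u \<in> tensor_relations S (P j) N" for u j
    unfolding i_eq[OF subsetD[OF diff_closed_tensor_relations(2)[OF AX.P N(2)] that]]
    by (rule tmap_tensor_relations[OF AX.P AX.P N(2,3) lhom_id[OF AX.P] q that])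
  have iU: "tmap (\<lambda>p. p) i u \<in> frags (carrier (P j) \<times> carrier N)" if "u \<in> frags (carrier (P j) \<times> carrier N')" for u j
    by (rule tmap_mem[OF _ _ that]) (auto simp: lhom_closed[OF i])
  have qU: "tmap (\<lambda>p. p) q u \<in> frags (carrier (P j) \<times> carrier N'')" if "u \<in> frags (carrier (P j) \<times> carrier N)" for u j
    by (rule tmap_mem[OF _ _ that]) (auto simp: lhom_closed[OF q])
  have \<iota>U: "kmap \<iota> v \<in> frags (carrier K)" if "v \<in> frags (carrier K')" for v
    by (rule kmap_mem[OF _ that]) (auto simp: lhom_closed[OF \<iota>])
  have \<kappa>U: "kmap \<kappa> v \<in> frags (carrier K'')" if "v \<in> frags (carrier K)" for v
    by (rule kmap_mem[OF _ that]) (auto simp: lhom_closed[OF \<kappa>])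
  have \<iota>V: "kmap \<iota> v \<in> sum_relations K \<longleftrightarrow> v \<in> sum_relations K'" if "v \<in> frags (carrier K')" for v
    using \<iota>_inj[of "msum K' v"] lhom_zero[OF K(1,2) \<iota>] that
    by (auto simp: sum_relations_def \<iota>U msum_kmap[OF K(1,2) \<iota>] msum(2)[OF K(1)])
  have \<kappa>V: "kmap \<kappa> v \<in> sum_relations K'' \<longleftrightarrow> \<kappa> (msum K v) = \<zero>\<^bsub>K''\<^esub>" if "v \<in> frags (carrier K)" for v
    using that by (auto simp: sum_relations_def \<kappa>U msum_kmap[OF K(2,3) \<kappa>])
  have frags_sumrel: "sum_relations L \<subseteq> frags (carrier L)" for L :: "('r, 'k) module"
    by (auto simp: sum_relations_def)
  have comm1: "kmap \<iota> (tensor_eval e' \<epsilon> u) = tensor_eval e \<epsilon> (tmap (\<lambda>p. p) i u)"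
    if "u \<in> frags (carrier (P 0) \<times> carrier N')" for u
    using that by (induction rule: frags_induct) (auto simp: frag_extend_diff e_i lhom_closed[OF AX.\<epsilon>])
  have comm2: "kmap \<kappa> (tensor_eval e \<epsilon> u) = tensor_eval e'' \<epsilon> (tmap (\<lambda>p. p) q u)"
    if "u \<in> frags (carrier (P 0) \<times> carrier N)" for u
    using that by (induction rule: frags_induct) (auto simp: frag_extend_diff e_q lhom_closed[OF AX.\<epsilon>])
  have comm3: "tmap (\<lambda>p. p) f (tmap (d j) (\<lambda>n. n) u) = tmap (d j) (\<lambda>n. n) (tmap (\<lambda>p. p) f u)"
    if "u \<in> frags (X \<times> Y)" for f u j X Y
    using that by (induction rule: frags_induct) (auto simp: frag_extend_diff)
  show ?thesis
  proof (intro complex_ses.intro complex_ses_axioms.intro AX.cx.subquotient_complex_axioms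
      AY.cx.subquotient_complex_axioms AZ.cx.subquotient_complex_axioms)
    fix k
    {
      fix x x' show "?\<alpha> (x - x') = ?\<alpha> x - ?\<alpha> x'" by (simp add: frag_extend_diff)
    next
      fix x x' show "?\<beta> (x - x') = ?\<beta> x - ?\<beta> x'" by (simp add: frag_extend_diff)
    next
      fix x assume "x \<in> aug_U P N' K' k"
      then show "?\<alpha> x \<in> aug_U P N K k"
        by (cases k rule: nat_cases3) (auto simp: iU \<iota>U)
    next
      fix x assume "x \<in> aug_V S P N' K' k"
      then show "?\<alpha> x \<in> aug_V S P N K k"
        by (cases k rule: nat_cases3) (auto simp: iV \<iota>V subsetD[OF frags_sumrel])
    next
      fix x assume "x \<in> aug_U P N K k"
      then show "?\<beta> x \<in> aug_U P N'' K'' k"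
        by (cases k rule: nat_cases3) (auto simp: qU \<kappa>U)
    next
      fix x assume "x \<in> aug_V S P N K k"
      then show "?\<beta> x \<in> aug_V S P N'' K'' k"
        using lhom_zero[OF K(2,3) \<kappa>]
        by (cases k rule: nat_cases3) (auto simp: qV \<kappa>V sum_relations_def msum_kmap[OF K(2,3) \<kappa>] \<kappa>U)
    next
      fix x assume "x \<in> aug_U P N' K' (Suc k)"
      then show "?\<alpha> (aug_d e' \<epsilon> d k x) - aug_d e \<epsilon> d k (?\<alpha> x) \<in> aug_V S P N K k"
        by (cases k rule: nat_cases3) (auto simp: comm1 comm3 ev0 pair_zero)
    next
      fix x assume "x \<in> aug_U P N K (Suc k)"
      then show "?\<beta> (aug_d e \<epsilon> d k x) - aug_d e'' \<epsilon> d k (?\<beta> x) \<in> aug_V S P N'' K'' k"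
        by (cases k rule: nat_cases3) (auto simp: comm2 comm3 ev0 pair_zero)
    next
      fix x assume "x \<in> aug_U P N' K' k" "?\<alpha> x \<in> aug_V S P N K k"
      then show "x \<in> aug_V S P N' K' k"
        by (cases k rule: nat_cases3)
          (auto simp: \<iota>V intro: projective_flat[OF AX.proj N(1,2) i i_inj])
    next
      fix y assume *: "y \<in> aug_U P N K k" "?\<beta> y \<in> aug_V S P N'' K'' k"
      show "\<exists>x\<in>aug_U P N' K' k. y - ?\<alpha> x \<in> aug_V S P N K k"
      proof (cases k rule: nat_cases3)
        case 1
        then show ?thesis using * by (auto simp: pair_zero)
      next
        case 2
        then obtain v where v: "y = (0, v)" "v \<in> frags (carrier K)" "kmap \<kappa> v \<in> sum_relations K''"
          using * by auto
        then obtain x where x: "x \<in> carrier K'" "msum K v = \<iota> x"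
          using \<kappa>V \<kappa>_ker[of "msum K v"] msum(2)[OF K(2)] by auto
        \<comment> \<open>\<open>v\<close> is equivalent to the single generator
          \<open>frag_of (msum K v)\<close>, so one preimage under \<iota> suffices.\<close>
        have "v - kmap \<iota> (frag_of x) \<in> sum_relations K"
          using msum_relation[OF K(2) v(2)] x by simp
        then show ?thesis
          using 2 v(1) x(1) by (intro bexI[of _ "(0, frag_of x)"]) (auto simp: frag_of_mem_frags)
      next
        case (3 j)
        then obtain u where u: "y = (u, 0)" "u \<in> frags (carrier (P j) \<times> carrier N)"
          "tmap (\<lambda>p. p) q u \<in> tensor_relations S (P j) N''"
          using * by auto
        obtain x where "x \<in> frags (carrier (P j) \<times> carrier N')" "u - tmap (\<lambda>p. p) i x \<in> tensor_relations S (P j) N"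
          using tensor_right_exact[OF AX.P N i q q_surj q_ker u(2,3)] by blast
        then show ?thesis
          using 3 u(1) by (intro bexI[of _ "(x, 0)"]) auto
      qed
    next
      fix x assume *: "x \<in> aug_U P N' K' k"
      have "tmap (\<lambda>p. p) q (tmap (\<lambda>p. p) i u) \<in> tensor_relations S (P j) N''"
        if "u \<in> frags (carrier (P j) \<times> carrier N')" for u j
        using that
        by (induction rule: frags_induct)
          (auto simp: frag_extend_diff ev0 qi frag_of_zero_relations[OF AX.P N(3)]
            intro: diff_closed_diff[OF diff_closed_tensor_relations(1)[OF AX.P N(3)]])
      then show "?\<beta> (?\<alpha> x) \<in> aug_V S P N'' K'' k"
        using * by (cases k rule: nat_cases3)
          (auto simp: \<kappa>V \<iota>U msum_kmap[OF K(1,2) \<iota>] \<kappa>\<iota> msum(2)[OF K(1)])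
    next
      fix z assume *: "z \<in> aug_U P N'' K'' k"
      have surj_T: "\<exists>y\<in>frags (carrier (P j) \<times> carrier N). tmap (\<lambda>p. p) q y = u"
        if "u \<in> frags (carrier (P j) \<times> carrier N'')" for u j
        using that
      proof (induction rule: frags_induct)
        case zero
        then show ?case using ev0(1) by force
      next
        case (of x)
        then obtain p n where "x = (p, q n)" "p \<in> carrier (P j)" "n \<in> carrier N"
          unfolding q_surj[symmetric] by auto
        then show ?case by (intro bexI[of _ "frag_of (p, n)"]) (auto simp: frag_of_mem_frags)
      next
        case (diff u v)
        then show ?case
          by (metis frag_extend_diff diff_closed_diff[OF diff_closed_frags])
      qed
      have surj_K: "\<exists>y\<in>frags (carrier K). kmap \<kappa> y = u" if "u \<in> frags (carrier K'')" for u
        using that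
      proof (induction rule: frags_induct)
        case zero
        then show ?case using ev0(1) by force
      next
        case (of x)
        then obtain y where "x = \<kappa> y" "y \<in> carrier K"
          unfolding \<kappa>_surj[symmetric] by auto
        then show ?case by (intro bexI[of _ "frag_of y"]) (auto simp: frag_of_mem_frags)
      next
        case (diff u v)
        then show ?case
          by (metis frag_extend_diff diff_closed_diff[OF diff_closed_frags])
      qed
      show "\<exists>y\<in>aug_U P N K k. z - ?\<beta> y \<in> aug_V S P N'' K'' k"
      proof (cases k rule: nat_cases3)
        case 1
        then show ?thesis using * by (auto simp: pair_zero)
      next
        case 2
        then obtain v where v: "z = (0, v)" "v \<in> frags (carrier K'')" using * by auto
        then obtain y where "y \<in> frags (carrier K)" "kmap \<kappa> y = v" using surj_K by blast
        then show ?thesis using 2 v by (intro bexI[of _ "(0, y)"]) (auto simp: ev0 mem_Times_iff)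
      next
        case (3 j)
        then obtain u where u: "z = (u, 0)" "u \<in> frags (carrier (P j) \<times> carrier N'')" using * by auto
        then obtain y where "y \<in> frags (carrier (P j) \<times> carrier N)" "tmap (\<lambda>p. p) q y = u"
          using surj_T by blast
        then show ?thesis using 3 u by (intro bexI[of _ "(y, 0)"]) (auto simp: ev0 mem_Times_iff)
      qed
    }
  qed
qed

text \<open>The last two claims shift degrees: where the middle complex is exact, the third complex
  is exact at k + 1 if and only if the first is exact at \<open>k\<close>.\<close>

lemma aug_exact_ses:
  assumes res: "projective_resolution (opposite_ring S) A P \<epsilon> d"
  shows "aug_exact S P \<epsilon> d N' K' e' k \<Longrightarrow> aug_exact S P \<epsilon> d N'' K'' e'' k \<Longrightarrow>
      aug_exact S P \<epsilon> d N K e k"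
    and "aug_exact S P \<epsilon> d N K e 0 \<Longrightarrow> aug_exact S P \<epsilon> d N'' K'' e'' 0"
    and "aug_exact S P \<epsilon> d N K e (Suc k) \<Longrightarrow> aug_exact S P \<epsilon> d N' K' e' k \<Longrightarrow>
      aug_exact S P \<epsilon> d N'' K'' e'' (Suc k)"
    and "aug_exact S P \<epsilon> d N'' K'' e'' (Suc k) \<Longrightarrow> aug_exact S P \<epsilon> d N K e k \<Longrightarrow>
      aug_exact S P \<epsilon> d N' K' e' k"
proof -
  interpret s: complex_ses "aug_U P N' K'" "aug_V S P N' K'" "aug_d e' \<epsilon> d"
    "aug_U P N K" "aug_V S P N K" "aug_d e \<epsilon> d" "aug_U P N'' K''" "aug_V S P N'' K''" "aug_d e'' \<epsilon> d"
    "\<lambda>x. (tmap (\<lambda>p. p) i (fst x), kmap \<iota> (snd x))" "\<lambda>x. (tmap (\<lambda>p. p) q (fst x), kmap \<kappa> (snd x))"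
    by (rule aug_complex_ses[OF res])
  show "aug_exact S P \<epsilon> d N' K' e' k \<Longrightarrow> aug_exact S P \<epsilon> d N'' K'' e'' k \<Longrightarrow> aug_exact S P \<epsilon> d N K e k"
    unfolding aug_exact_def by (rule s.exact_mid)
  show "aug_exact S P \<epsilon> d N K e 0 \<Longrightarrow> aug_exact S P \<epsilon> d N'' K'' e'' 0"
    unfolding aug_exact_def by (rule s.exact_right_0) auto
  show "aug_exact S P \<epsilon> d N K e (Suc k) \<Longrightarrow> aug_exact S P \<epsilon> d N' K' e' k \<Longrightarrow>
      aug_exact S P \<epsilon> d N'' K'' e'' (Suc k)"
    unfolding aug_exact_def by (rule s.exact_right)
  show "aug_exact S P \<epsilon> d N'' K'' e'' (Suc k) \<Longrightarrow> aug_exact S P \<epsilon> d N K e k \<Longrightarrow>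
      aug_exact S P \<epsilon> d N' K' e' k"
    unfolding aug_exact_def by (rule s.exact_left)
qed

end

section \<open>Pairings on images, submodules and quotients\<close>

section \<open>Short exact sequences of pairings\<close>

lemma (in balanced_pairing) balanced_pairing_sub:
  assumes "submodule N' S N" "submodule K' R K"
    and "\<And>c n. c \<in> carrier A \<Longrightarrow> n \<in> N' \<Longrightarrow> e c n \<in> K'"
  shows "balanced_pairing R S A (N\<lparr>carrier := N'\<rparr>) (K\<lparr>carrier := K'\<rparr>) e"
  using assms N.submoduleD(1)[OF assms(1)]
  by (intro balanced_pairing.intro balanced_pairing_axioms.intro A.left_module_axioms
      N.submodule_left_module K.submodule_left_module)
    (auto simp: e_add_left e_add_right e_balanced subset_iff)

lemma inclusion_lhom:
  assumes "left_module R M" "submodule H R M"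
  shows "(\<lambda>x\<in>H. x) \<in> lhom R (M\<lparr>carrier := H\<rparr>) M"
  using lhom_restrictI[OF left_module.submodule_left_module[OF assms], of "\<lambda>x. x" M]
    left_module.submoduleD(1)[OF assms] by auto

text \<open>Two compatible left exact sequences become short exact when their last modules are cut
  down to the images of \<phi> and \<psi>.\<close>

lemma kernel_image_ses:
  assumes X: "balanced_pairing R S A N' K' e'" and Y: "balanced_pairing R S A N K e"
    and Z: "balanced_pairing R S A L J e''"
    and i: "i \<in> lhom S N' N" "inj_on i (carrier N')" "i ` carrier N' = a_kernel N L \<phi>"
    and \<iota>: "\<iota> \<in> lhom R K' K" "inj_on \<iota> (carrier K')" "\<iota> ` carrier K' = a_kernel K J \<psi>"
    and \<phi>: "\<phi> \<in> lhom S N L" and \<psi>: "\<psi> \<in> lhom R K J"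
    and comm': "\<And>c n. c \<in> carrier A \<Longrightarrow> n \<in> carrier N' \<Longrightarrow> \<iota> (e' c n) = e c (i n)"
    and comm: "\<And>c n. c \<in> carrier A \<Longrightarrow> n \<in> carrier N \<Longrightarrow> \<psi> (e c n) = e'' c (\<phi> n)"
  shows "pairing_ses R S A N' K' e' N K e
    (L\<lparr>carrier := \<phi> ` carrier N\<rparr>) (J\<lparr>carrier := \<psi> ` carrier K\<rparr>) e'' i \<iota> \<phi> \<psi>"
proof -
  interpret X: balanced_pairing R S A N' K' e' by fact
  interpret Y: balanced_pairing R S A N K e by fact
  interpret Z: balanced_pairing R S A L J e'' by fact
  note mods = Y.N.left_module_axioms Z.N.left_module_axioms Y.K.left_module_axioms Z.K.left_module_axioms
  show ?thesis
  proof (intro pairing_ses.intro pairing_ses_axioms.intro X Y)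
    show "balanced_pairing R S A (L\<lparr>carrier := \<phi> ` carrier N\<rparr>) (J\<lparr>carrier := \<psi> ` carrier K\<rparr>) e''"
      by (rule Z.balanced_pairing_sub[OF submodule_image[OF mods(1,2) \<phi>] submodule_image[OF mods(3,4) \<psi>]])
        (auto simp: comm[symmetric] Y.e_closed)
    show "\<phi> \<in> lhom S N (L\<lparr>carrier := \<phi> ` carrier N\<rparr>)"
      using \<phi> by (auto simp: lhom_restrict_codomain lhom_extensional lhom_add lhom_smult)
    show "\<psi> \<in> lhom R K (J\<lparr>carrier := \<psi> ` carrier K\<rparr>)"
      using \<psi> by (auto simp: lhom_restrict_codomain lhom_extensional lhom_add lhom_smult)
    show "n = \<zero>\<^bsub>N'\<^esub>" if "n \<in> carrier N'" "i n = \<zero>\<^bsub>N\<^esub>" for n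
      using inj_onD[OF i(2), of n "\<zero>\<^bsub>N'\<^esub>"] that lhom_zero[OF X.N.left_module_axioms mods(1) i(1)] by simp
    show "k = \<zero>\<^bsub>K'\<^esub>" if "k \<in> carrier K'" "\<iota> k = \<zero>\<^bsub>K\<^esub>" for k
      using inj_onD[OF \<iota>(2), of k "\<zero>\<^bsub>K'\<^esub>"] that lhom_zero[OF X.K.left_module_axioms mods(3) \<iota>(1)] by simp
    show "\<phi> (i n) = \<zero>\<^bsub>L\<lparr>carrier := \<phi> ` carrier N\<rparr>\<^esub>" if "n \<in> carrier N'" for n
      using imageI[OF that, of i] unfolding i(3) mem_a_kernel by simp
    show "\<psi> (\<iota> k) = \<zero>\<^bsub>J\<lparr>carrier := \<psi> ` carrier K\<rparr>\<^esub>" if "k \<in> carrier K'" for k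
      using imageI[OF that, of \<iota>] unfolding \<iota>(3) mem_a_kernel by simp
  qed (simp_all add: i \<iota> mem_a_kernel comm comm')
qed

text \<open>The representative chosen by \<open>SOME\<close> is immaterial once \<open>e c\<close>
  maps the submodule of \<open>N\<close> into \<open>K'\<close>; this is the fact \<open>cl\<close>
  in \<open>sub_quotient_ses\<close>.\<close>

definition quotient_pairing :: "('r, 'k) module \<Rightarrow> 'k set \<Rightarrow> ('c \<Rightarrow> 'n \<Rightarrow> 'k) \<Rightarrow> 'c \<Rightarrow> 'n set \<Rightarrow> 'k set" where
  "quotient_pairing K K' e c X = K' +>\<^bsub>K\<^esub> e c (SOME n. n \<in> X)"

lemma sub_quotient_ses:
  assumes Y: "balanced_pairing R S A N K e" and N': "submodule N' S N" and K': "submodule K' R K"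
    and e: "\<And>c n. c \<in> carrier A \<Longrightarrow> n \<in> N' \<Longrightarrow> e c n \<in> K'"
  shows "pairing_ses R S A (N\<lparr>carrier := N'\<rparr>) (K\<lparr>carrier := K'\<rparr>) e N K e
    (quotient_module N N') (quotient_module K K') (quotient_pairing K K' e)
    (\<lambda>n\<in>N'. n) (\<lambda>k\<in>K'. k) (\<lambda>n\<in>carrier N. N' +>\<^bsub>N\<^esub> n) (\<lambda>k\<in>carrier K. K' +>\<^bsub>K\<^esub> k)"
proof -
  interpret Y: balanced_pairing R S A N K e by fact
  interpret QN: left_submodule S N N'
    by (intro left_submodule.intro left_submodule_axioms.intro Y.N.left_module_axioms N')
  interpret QK: left_submodule R K K'
    by (intro left_submodule.intro left_submodule_axioms.intro Y.K.left_module_axioms K')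
  have cl: "quotient_pairing K K' e c (N' +>\<^bsub>N\<^esub> n) = K' +>\<^bsub>K\<^esub> e c n"
    if c: "c \<in> carrier A" and n: "n \<in> carrier N" for c n
  proof -
    define m where "m = (SOME m. m \<in> N' +>\<^bsub>N\<^esub> n)"
    have m: "m \<in> N' +>\<^bsub>N\<^esub> n"
      unfolding m_def by (rule someI[of _ n]) (rule QN.Q.a_rcos_self[OF n])
    then obtain h where h: "h \<in> N'" "m = h \<oplus>\<^bsub>N\<^esub> n"
      by (auto simp: a_r_coset_def')
    have *: "e c h \<in> K'" "e c h \<in> carrier K" "e c n \<in> carrier K"
      using e c n h QN.N(1) Y.e_closed by auto
    have "e c m = e c h \<oplus>\<^bsub>K\<^esub> e c n"
      using c n h QN.N(1) by (auto simp: Y.e_add_right)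
    then have "e c m \<ominus>\<^bsub>K\<^esub> e c n = e c h"
      using * by (simp add: a_minus_def Y.K.M.add.m_assoc Y.K.M.r_neg)
    then have "K' +>\<^bsub>K\<^esub> e c m = K' +>\<^bsub>K\<^esub> e c n"
      using * QK.cls_eq_iff[of "e c m" "e c n"] \<open>e c m = _\<close> by simp
    then show ?thesis by (simp add: quotient_pairing_def m_def)
  qed
  note mods = Y.N.left_module_axioms Y.K.left_module_axioms
  show ?thesis
  proof (intro pairing_ses.intro pairing_ses_axioms.intro Y)
    show "balanced_pairing R S A (N\<lparr>carrier := N'\<rparr>) (K\<lparr>carrier := K'\<rparr>) e"
      by (rule Y.balanced_pairing_sub[OF N' K' e])
    show "balanced_pairing R S A (quotient_module N N') (quotient_module K K') (quotient_pairing K K' e)"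
      by (intro balanced_pairing.intro balanced_pairing_axioms.intro Y.A.left_module_axioms
          QN.left_module_quotient QK.left_module_quotient)
        (auto simp: QN.carrier_quotient QK.carrier_quotient cl Y.e_closed Y.e_add_left Y.e_add_right Y.e_balanced
          QN.cls_add QK.cls_add QN.cls_smult Y.N.smult_closed Y.A.smult_closed[simplified])
  next
    fix n assume "n \<in> carrier N" "(\<lambda>n\<in>carrier N. N' +>\<^bsub>N\<^esub> n) n = \<zero>\<^bsub>quotient_module N N'\<^esub>"
    then show "n \<in> (\<lambda>n\<in>N'. n) ` carrier (N\<lparr>carrier := N'\<rparr>)"
      by (auto simp: QN.zero_quotient QN.cls_eq_zero_iff)
  next
    fix n assume "n \<in> carrier K" "(\<lambda>n\<in>carrier K. K' +>\<^bsub>K\<^esub> n) n = \<zero>\<^bsub>quotient_module K K'\<^esub>"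
    then show "n \<in> (\<lambda>n\<in>K'. n) ` carrier (K\<lparr>carrier := K'\<rparr>)"
      by (auto simp: QK.zero_quotient QK.cls_eq_zero_iff)
  next
    fix n assume "n \<in> carrier (N\<lparr>carrier := N'\<rparr>)"
    then show "(\<lambda>n\<in>carrier N. N' +>\<^bsub>N\<^esub> n) ((\<lambda>n\<in>N'. n) n) = \<zero>\<^bsub>quotient_module N N'\<^esub>"
      using QN.N(1) by (auto simp: QN.zero_quotient QN.cls_eq_zero_iff)
  next
    fix n assume "n \<in> carrier (K\<lparr>carrier := K'\<rparr>)"
    then show "(\<lambda>n\<in>carrier K. K' +>\<^bsub>K\<^esub> n) ((\<lambda>n\<in>K'. n) n) = \<zero>\<^bsub>quotient_module K K'\<^esub>"
      using QK.N(1) by (auto simp: QK.zero_quotient QK.cls_eq_zero_iff)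
  qed (auto simp: QN.carrier_quotient QK.carrier_quotient cl Y.e_closed e inclusion_lhom[OF mods(1) N']
      inclusion_lhom[OF mods(2) K'] QN.cls_lhom QK.cls_lhom)
qed

section \<open>Exactness of augmented complexes transported between projective resolutions\<close>

section \<open>Independence of the resolution\<close>

lemma tmap_sum_relation:
  assumes A: "right_module S A" and N: "left_module S N"
    and fg: "\<And>x. x \<in> carrier A \<Longrightarrow> f x \<in> carrier A" "\<And>x. x \<in> carrier A \<Longrightarrow> g x \<in> carrier A"
      "\<And>x. x \<in> carrier A \<Longrightarrow> x = f x \<oplus>\<^bsub>A\<^esub> g x"
    and u: "u \<in> frags (carrier A \<times> carrier N)"
  shows "u - tmap f (\<lambda>n. n) u - tmap g (\<lambda>n. n) u \<in> tensor_relations S A N"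
  using u
proof (induction rule: frags_induct)
  note V = diff_closed_tensor_relations(1)[OF A N]
  {
    case zero
    then show ?case using diff_closed_zero[OF V] by simp
  next
    case (of x)
    then obtain a n where x: "x = (a, n)" "a \<in> carrier A" "n \<in> carrier N" by auto
    then show ?case
      using tensor_relations_add_left[OF fg(1)[OF x(2)] fg(2)[OF x(2)] x(3), of S] x(1)
      unfolding fg(3)[OF x(2), symmetric] by simp
  next
    case (diff u v)
    show ?case
      using diff_closed_diff[OF V diff.IH] by (simp add: frag_extend_diff algebra_simps)
  }
qed

lemma tmap_left_mem:
  assumes "g \<in> lhom R A B" "u \<in> frags (carrier A \<times> Y)"
  shows "tmap g (\<lambda>n. n) u \<in> frags (carrier B \<times> Y)"
  by (rule tmap_mem[OF _ _ assms(2)]) (auto simp: lhom_closed[OF assms(1)])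

lemma tmap_left_comp:
  assumes "u \<in> frags (X \<times> Y)" "\<And>x. x \<in> X \<Longrightarrow> f (g x) = f' (g' x)"
  shows "tmap f (\<lambda>n. n) (tmap g (\<lambda>n. n) u) = tmap f' (\<lambda>n. n) (tmap g' (\<lambda>n. n) u)"
  using assms(1) by (induction rule: frags_induct) (auto simp: frag_extend_diff assms(2))

text \<open>A cycle \<open>u\<close> over \<open>P\<close> is sent by \<phi> to a cycle over
  \<open>Q\<close>, hence to a boundary. Applying \<psi> and correcting by the homotopy exhibits
  \<open>u\<close> as a boundary.\<close>

lemma aug_exact_transfer:
  fixes S :: "'s ring"
  assumes pair: "balanced_pairing R S A N K e"
    and resP: "projective_resolution (opposite_ring S) A P \<epsilon> d"
    and resQ: "projective_resolution (opposite_ring S) A Q \<epsilon>' d'"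
    and exQ: "aug_exact S Q \<epsilon>' d' N K e k"
  shows "aug_exact S P \<epsilon> d N K e k"
proof -
  interpret P: augmented_complex R S A N K e P \<epsilon> d
    by (intro augmented_complex.intro pair proj_resolution.intro resP)
  interpret Q: augmented_complex R S A N K e Q \<epsilon>' d'
    by (intro augmented_complex.intro pair proj_resolution.intro resQ)
  note N = P.N.left_module_axioms
  note VP = diff_closed_tensor_relations(1)[OF P.P N]
  obtain \<phi> \<psi> h where "resolution_comparison (opposite_ring S) A P \<epsilon> d Q \<epsilon>' d' \<phi> \<psi> h"
    using resolution_comparison_exists[OF resP resQ] .
  then interpret cmp: resolution_comparison "opposite_ring S" A P \<epsilon> d Q \<epsilon>' d' \<phi> \<psi> h .
  note \<phi> = cmp.\<phi> and \<psi> = cmp.\<psi> and h = cmp.h and \<epsilon>\<phi> = cmp.\<epsilon>\<phi> and \<epsilon>\<psi> = cmp.\<epsilon>\<psi>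
    and d\<phi> = cmp.d\<phi> and d\<psi> = cmp.d\<psi> and h0 = cmp.h0 and hS = cmp.hS
  let ?t = "\<lambda>g. tmap g (\<lambda>n. n)"
  note cl = lhom_closed[OF \<phi>] lhom_closed[OF \<psi>] lhom_closed[OF h] lhom_closed[OF P.d] lhom_closed[OF Q.d]
  have comp1: "?t f (?t g u) = ?t (\<lambda>x. f (g x)) u" for f g u
    by (rule tmap_tmap[where A=UNIV and B=UNIV]) (auto simp: frags_def)
  have hom0: "u - ?t (\<psi> 0) (?t (\<phi> 0) u) - ?t (d 0) (?t (h 0) u) \<in> tensor_relations S (P 0) N"
    if "u \<in> frags (carrier (P 0) \<times> carrier N)" for u
    unfolding comp1 by (rule tmap_sum_relation[OF P.P N _ _ _ that]) (auto simp: cl h0[symmetric])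
  have homS: "u - ?t (\<psi> (Suc j)) (?t (\<phi> (Suc j)) u) - ?t (d (Suc j)) (?t (h (Suc j)) u)
      - ?t (h j) (?t (d j) u) \<in> tensor_relations S (P (Suc j)) N"
    if u: "u \<in> frags (carrier (P (Suc j)) \<times> carrier N)" for u j
  proof -
    interpret Pj: left_module "opposite_ring S" "P (Suc j)" by (rule P.P)
    let ?g = "\<lambda>x. d (Suc j) (h (Suc j) x) \<oplus>\<^bsub>P (Suc j)\<^esub> h j (d j x)"
    have 1: "u - ?t (\<lambda>x. \<psi> (Suc j) (\<phi> (Suc j) x)) u - ?t ?g u \<in> tensor_relations S (P (Suc j)) N"
      by (rule tmap_sum_relation[OF P.P N _ _ _ u]) (auto simp: cl hS[symmetric])
    have 2: "?t ?g u - ?t (\<lambda>x. d (Suc j) (h (Suc j) x)) u - ?t (\<lambda>x. h j (d j x)) u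
        \<in> tensor_relations S (P (Suc j)) N"
      using u
    proof (induction rule: frags_induct)
      case zero
      then show ?case using diff_closed_zero[OF VP] by simp
    next
      case (of x)
      then show ?case by (auto intro!: tensor_relations_add_left simp: cl)
    next
      case (diff u v)
      show ?case
        using diff_closed_diff[OF VP diff.IH] by (simp add: frag_extend_diff algebra_simps)
    qed
    from diff_closed_add[OF VP 1 2] show ?thesis unfolding comp1 by (simp add: algebra_simps)
  qed
  have eval\<phi>: "tensor_eval e \<epsilon>' (?t (\<phi> 0) u) = tensor_eval e \<epsilon> u"
    if "u \<in> frags (carrier (P 0) \<times> carrier N)" for u
    using that by (induction rule: frags_induct) (auto simp: frag_extend_diff \<epsilon>\<phi>)
  have eval\<psi>: "tensor_eval e \<epsilon> (?t (\<psi> 0) u) = tensor_eval e \<epsilon>' u"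
    if "u \<in> frags (carrier (Q 0) \<times> carrier N)" for u
    using that by (induction rule: frags_induct) (auto simp: frag_extend_diff \<epsilon>\<psi>)
  show ?thesis
  proof (cases k rule: nat_cases3)
    case 1
    show ?thesis
      unfolding aug_exact_def 1 P.exact_at_0_iff
    proof
      fix v assume "v \<in> frags (carrier K)"
      then obtain w where w: "w \<in> frags (carrier (Q 0) \<times> carrier N)" "v - tensor_eval e \<epsilon>' w \<in> sum_relations K"
        using exQ unfolding aug_exact_def 1 Q.exact_at_0_iff by blast
      then show "\<exists>u\<in>frags (carrier (P 0) \<times> carrier N). v - tensor_eval e \<epsilon> u \<in> sum_relations K"
        using tmap_left_mem[OF \<psi> w(1)] eval\<psi>[OF w(1)] by (intro bexI[of _ "?t (\<psi> 0) w"]) simp_all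
    qed
  next
    case 2
    show ?thesis
      unfolding aug_exact_def 2 P.exact_at_1_iff
    proof (intro ballI impI)
      fix u assume u: "u \<in> frags (carrier (P 0) \<times> carrier N)" "tensor_eval e \<epsilon> u \<in> sum_relations K"
      then obtain w where w: "w \<in> frags (carrier (Q (Suc 0)) \<times> carrier N)"
        "?t (\<phi> 0) u - ?t (d' 0) w \<in> tensor_relations S (Q 0) N"
        using exQ tmap_left_mem[OF \<phi> u(1)] eval\<phi>[OF u(1)] unfolding aug_exact_def 2 Q.exact_at_1_iff by auto
      have 1: "?t (\<psi> 0) (?t (\<phi> 0) u) - ?t (\<psi> 0) (?t (d' 0) w) \<in> tensor_relations S (P 0) N"
        using P.tmap_left_relations[OF Q.P P.P \<psi> w(2)] by (simp add: frag_extend_diff)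
      have 2: "?t (\<psi> 0) (?t (d' 0) w) = ?t (d 0) (?t (\<psi> (Suc 0)) w)"
        by (rule tmap_left_comp[OF w(1)]) (simp add: d\<psi>)
      have "u - ?t (d 0) (?t (\<psi> (Suc 0)) w + ?t (h 0) u) \<in> tensor_relations S (P 0) N"
        using diff_closed_add[OF VP hom0[OF u(1)] 1] unfolding 2 by (simp add: frag_extend_add algebra_simps)
      then show "\<exists>w\<in>frags (carrier (P (Suc 0)) \<times> carrier N). u - ?t (d 0) w \<in> tensor_relations S (P 0) N"
        using diff_closed_add[OF diff_closed_frags tmap_left_mem[OF \<psi> w(1)] tmap_left_mem[OF h u(1)]] by blast
    qed
  next
    case (3 j)
    show ?thesis
      unfolding aug_exact_def 3 P.exact_at_Suc_iff
    proof (intro ballI impI)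
      fix u assume u: "u \<in> frags (carrier (P (Suc j)) \<times> carrier N)"
        and du: "?t (d j) u \<in> tensor_relations S (P j) N"
      have "?t (d' j) (?t (\<phi> (Suc j)) u) = ?t (\<phi> j) (?t (d j) u)"
        by (rule tmap_left_comp[OF u]) (simp add: d\<phi>)
      then have "?t (d' j) (?t (\<phi> (Suc j)) u) \<in> tensor_relations S (Q j) N"
        using P.tmap_left_relations[OF P.P Q.P \<phi> du] by simp
      then obtain w where w: "w \<in> frags (carrier (Q (Suc (Suc j))) \<times> carrier N)"
        "?t (\<phi> (Suc j)) u - ?t (d' (Suc j)) w \<in> tensor_relations S (Q (Suc j)) N"
        using exQ tmap_left_mem[OF \<phi> u] unfolding aug_exact_def 3 Q.exact_at_Suc_iff by auto
      have 1: "?t (\<psi> (Suc j)) (?t (\<phi> (Suc j)) u) - ?t (\<psi> (Suc j)) (?t (d' (Suc j)) w)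
          \<in> tensor_relations S (P (Suc j)) N"
        using P.tmap_left_relations[OF Q.P P.P \<psi> w(2)] by (simp add: frag_extend_diff)
      have 2: "?t (\<psi> (Suc j)) (?t (d' (Suc j)) w) = ?t (d (Suc j)) (?t (\<psi> (Suc (Suc j))) w)"
        by (rule tmap_left_comp[OF w(1)]) (simp add: d\<psi>)
      \<comment> \<open>The summand h d of the homotopy formula drops out on cycles.\<close>
      have 3: "?t (h j) (?t (d j) u) \<in> tensor_relations S (P (Suc j)) N"
        by (rule P.tmap_left_relations[OF P.P P.P h du])
      have "u - ?t (d (Suc j)) (?t (\<psi> (Suc (Suc j))) w + ?t (h (Suc j)) u) \<in> tensor_relations S (P (Suc j)) N"
        using diff_closed_add[OF VP diff_closed_add[OF VP homS[OF u] 1] 3]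
        unfolding 2 by (simp add: frag_extend_add algebra_simps)
      then show "\<exists>w\<in>frags (carrier (P (Suc (Suc j))) \<times> carrier N).
          u - ?t (d (Suc j)) w \<in> tensor_relations S (P (Suc j)) N"
        using diff_closed_add[OF diff_closed_frags tmap_left_mem[OF \<psi> w(1)] tmap_left_mem[OF h u]] by blast
    qed
  qed
qed

section \<open>Vanishing of Tor and Ext expressed by cycles and boundaries\<close>

section \<open>Tor and Ext groups\<close>

text \<open>Stated through the neutral element so that it applies to \<open>Hom_group\<close>
  directly, without first establishing its group structure.\<close>

lemma homology_trivialD:
  assumes "trivial_group (homology_at G Z B)" "\<one>\<^bsub>G\<^esub> \<in> B" "\<And>z. z \<in> Z \<Longrightarrow> \<one>\<^bsub>G\<^esub> \<otimes>\<^bsub>G\<^esub> z = z"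
  shows "Z \<subseteq> B"
proof
  fix z assume z: "z \<in> Z"
  have "B #>\<^bsub>G\<lparr>carrier := Z\<rparr>\<^esub> z \<in> carrier (homology_at G Z B)"
    using z by (simp add: homology_at_def carrier_FactGroup)
  then have "B #>\<^bsub>G\<lparr>carrier := Z\<rparr>\<^esub> z = B"
    using assms(1) by (simp add: trivial_group_def homology_at_def)
  moreover have "\<one>\<^bsub>G\<^esub> \<otimes>\<^bsub>G\<^esub> z \<in> B #>\<^bsub>G\<lparr>carrier := Z\<rparr>\<^esub> z"
    using assms(2) by (auto simp: r_coset_def)
  ultimately show "z \<in> B" using assms(3)[OF z] by simp
qed

lemma homology_trivial_iff:
  assumes G: "comm_group G" and Z: "subgroup Z G" and B: "subgroup B G" and BZ: "B \<subseteq> Z"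
  shows "trivial_group (homology_at G Z B) \<longleftrightarrow> Z \<subseteq> B"
proof
  interpret G: comm_group G by fact
  assume "trivial_group (homology_at G Z B)"
  then show "Z \<subseteq> B"
    by (rule homology_trivialD) (use subgroup.one_closed[OF B] subgroup.subset[OF Z] in auto)
next
  interpret G: comm_group G by fact
  assume "Z \<subseteq> B"
  with BZ have eq: "B = Z" by blast
  interpret H: Group.group "G\<lparr>carrier := Z\<rparr>" by (rule G.subgroup_imp_group[OF Z])
  have H: "comm_group (G\<lparr>carrier := Z\<rparr>)"
    by (rule H.group_comm_groupI) (use subgroup.subset[OF Z] G.m_comm in auto)
  have sub: "subgroup Z (G\<lparr>carrier := Z\<rparr>)"
    using H.subgroup_self by simp
  have "group (homology_at G Z B)"
    unfolding homology_at_def eq using comm_group.abelian_FactGroup[OF H sub] by (simp add: comm_group_def)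
  moreover have "carrier (homology_at G Z B) = {B}"
    using H.coset_join2[OF _ sub] H.one_closed unfolding homology_at_def eq carrier_FactGroup by auto
  ultimately show "trivial_group (homology_at G Z B)"
    by (simp add: trivial_group_def homology_at_def)
qed

definition tensor_class where
  "tensor_class S A B u = tensor_relations S A B #>\<^bsub>free_Abelian_group (carrier A \<times> carrier B)\<^esub> u"

lemma tensor_class_eq: "tensor_class S A B u = (\<lambda>v. v + u) ` tensor_relations S A B"
  by (auto simp: tensor_class_def r_coset_def)

context
  fixes S :: "'s ring" and A :: "('s, 'a) module" and B :: "('s, 'b) module"
  assumes A: "right_module S A" and B: "left_module S B"
begin

lemma tensor_class_eq_iff: "tensor_class S A B u = tensor_class S A B v \<longleftrightarrow> u - v \<in> tensor_relations S A B"
proof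
  note V = diff_closed_tensor_relations(1)[OF A B]
  assume "tensor_class S A B u = tensor_class S A B v"
  moreover have "u \<in> tensor_class S A B u"
    unfolding tensor_class_eq using diff_closed_zero[OF V] by force
  ultimately obtain w where "w \<in> tensor_relations S A B" "u = w + v"
    unfolding tensor_class_eq by auto
  then show "u - v \<in> tensor_relations S A B" by simp
next
  note V = diff_closed_tensor_relations(1)[OF A B]
  assume uv: "u - v \<in> tensor_relations S A B"
  show "tensor_class S A B u = tensor_class S A B v"
    unfolding tensor_class_eq
  proof safe
    fix w assume "w \<in> tensor_relations S A B"
    then show "w + u \<in> (\<lambda>w. w + v) ` tensor_relations S A B"
      using diff_closed_add[OF V _ uv] by (intro image_eqI[of _ _ "w + (u - v)"]) auto
  next
    fix w assume "w \<in> tensor_relations S A B"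
    then show "w + v \<in> (\<lambda>w. w + u) ` tensor_relations S A B"
      using diff_closed_diff[OF V _ uv] by (intro image_eqI[of _ _ "w - (u - v)"]) auto
  qed
qed

lemma subgroup_tensor_relations:
  "subgroup (tensor_relations S A B) (free_Abelian_group (carrier A \<times> carrier B))"
proof -
  note V = diff_closed_tensor_relations[OF A B]
  show ?thesis
    using V(2) diff_closed_zero[OF V(1)] diff_closed_add[OF V(1)] diff_closed_uminus[OF V(1)]
    by (intro subgroup.intro) (auto simp: frags_def subset_iff)
qed

lemma comm_group_tensor_group: "comm_group (tensor_group S A B)"
  unfolding tensor_group_def
  by (rule comm_group.abelian_FactGroup[OF abelian_free_Abelian_group subgroup_tensor_relations])

lemma carrier_tensor_group: "carrier (tensor_group S A B) = tensor_class S A B ` frags (carrier A \<times> carrier B)"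
  by (auto simp: tensor_group_def carrier_FactGroup tensor_class_def frags_def)

lemma one_tensor_group: "\<one>\<^bsub>tensor_group S A B\<^esub> = tensor_class S A B 0"
  by (simp add: tensor_group_def tensor_class_eq)

lemma mult_tensor_class:
  assumes "u \<in> frags (carrier A \<times> carrier B)" "v \<in> frags (carrier A \<times> carrier B)"
  shows "tensor_class S A B u \<otimes>\<^bsub>tensor_group S A B\<^esub> tensor_class S A B v = tensor_class S A B (u + v)"
  using normal.rcos_sum[OF comm_group.subgroup_imp_normal[OF abelian_free_Abelian_group
      subgroup_tensor_relations], of u v] assms
  by (simp add: tensor_group_def tensor_class_def frags_def)

end

text \<open>The elementwise image of a coset may be only part of a coset; the relations added in
  \<open>tensor_map\<close> complete it.\<close>

lemma tensor_map_class:
  fixes S :: "'s ring" and B :: "('s, 'b) module"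
  assumes A: "right_module S A" "right_module S A'" and B: "left_module S B"
    and h: "h \<in> lhom (opposite_ring S) A A'"
  shows "tensor_map S A' B h (tensor_class S A B u) = tensor_class S A' B (tmap h (\<lambda>b. b) u)"
proof -
  let ?V = "tensor_relations S A B" and ?V' = "tensor_relations S A' B"
  note V = diff_closed_tensor_relations(1)[OF A(1) B] and V' = diff_closed_tensor_relations(1)[OF A(2) B]
  have hV: "tmap h (\<lambda>b. b) v \<in> ?V'" if "v \<in> ?V" for v
  proof -
    have "tmap h (\<lambda>b. b) v = tmap h (\<lambda>b\<in>carrier B. b) v"
      using subsetD[OF diff_closed_tensor_relations(2)[OF A(1) B] that]
      by (induction rule: frags_induct) (auto simp: frag_extend_diff)
    then show ?thesis
      using tmap_tensor_relations[OF A B B h lhom_id[OF B] that] by simp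
  qed
  have "tensor_map S A' B h (tensor_class S A B u)
      = (\<Union>v'\<in>?V'. \<Union>v\<in>?V. {v' + tmap h (\<lambda>b. b) (v + u)})"
    by (auto simp: tensor_map_def tensor_class_eq set_mult_def)
  also have "\<dots> = (\<lambda>v. v + tmap h (\<lambda>b. b) u) ` ?V'"
  proof safe
    fix v v' assume "v \<in> ?V" "v' \<in> ?V'"
    then show "v' + tmap h (\<lambda>b. b) (v + u) \<in> (\<lambda>v. v + tmap h (\<lambda>b. b) u) ` ?V'"
      using diff_closed_add[OF V' _ hV]
      by (intro image_eqI[of _ _ "v' + tmap h (\<lambda>b. b) v"]) (auto simp: frag_extend_add)
  next
    fix v' assume "v' \<in> ?V'"
    then show "v' + tmap h (\<lambda>b. b) u \<in> (\<Union>v'\<in>?V'. \<Union>v\<in>?V. {v' + tmap h (\<lambda>b. b) (v + u)})"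
      using diff_closed_zero[OF V] by (intro UN_I[of v'] UN_I[of 0]) auto
  qed
  finally show ?thesis by (simp add: tensor_class_eq)
qed

lemma tensor_map_hom:
  fixes S :: "'s ring" and B :: "('s, 'b) module"
  assumes A: "right_module S A" "right_module S A'" and B: "left_module S B"
    and h: "h \<in> lhom (opposite_ring S) A A'"
  shows "group_hom (tensor_group S A B) (tensor_group S A' B) (tensor_map S A' B h)"
proof -
  have "tensor_map S A' B h \<in> hom (tensor_group S A B) (tensor_group S A' B)"
    by (rule homI)
      (auto simp: carrier_tensor_group[OF A(1) B] carrier_tensor_group[OF A(2) B] tensor_map_class[OF A B h]
        mult_tensor_class[OF A(1) B] mult_tensor_class[OF A(2) B] tmap_left_mem[OF h] frag_extend_add)
  then show ?thesis
    using comm_group_tensor_group[OF A(1) B] comm_group_tensor_group[OF A(2) B]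
    by (simp add: group_hom_def group_hom_axioms_def comm_group_def)
qed

text \<open>In positive degrees the homology does not see \<open>K\<close>. In degree 0 all of P 0
  \<otimes> N counts as cycles in \<open>Tor\<close>, which matches the augmented complex when
  \<open>K\<close> is zero, since then the evaluation imposes no condition.\<close>

lemma Tor_trivial_iff:
  assumes "augmented_complex R S A N K e P \<epsilon> d" and pd: "proj_res (opposite_ring S) A = (P, d)"
  shows "trivial_group (Tor S A N (Suc j)) \<longleftrightarrow> aug_exact S P \<epsilon> d N K e (Suc (Suc j))"
    and "carrier K = {\<zero>\<^bsub>K\<^esub>} \<Longrightarrow> trivial_group (Tor S A N 0) \<longleftrightarrow> aug_exact S P \<epsilon> d N K e (Suc 0)"
proof -
  interpret augmented_complex R S A N K e P \<epsilon> d by fact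
  note N = N.left_module_axioms
  let ?T = "\<lambda>j. tensor_group S (P j) N" and ?D = "\<lambda>j. tensor_map S (P j) N (d j)"
  let ?t = "\<lambda>j. tmap (d j) (\<lambda>n. n)"
  interpret D: group_hom "?T (Suc k)" "?T k" "?D k" for k
    by (rule tensor_map_hom[OF P P N d])
  note cls = carrier_tensor_group[OF P N] tensor_map_class[OF P P N d] tensor_class_eq_iff[OF P N]
    one_tensor_group[OF P N]
  have im: "subgroup (?D j ` carrier (?T (Suc j))) (?T j)" for j
    by (rule D.img_is_subgroup)
  have mem: "tensor_class S (P j) N u \<in> ?D j ` carrier (?T (Suc j)) \<longleftrightarrow>
      (\<exists>w\<in>frags (carrier (P (Suc j)) \<times> carrier N). u - ?t j w \<in> tensor_relations S (P j) N)" for u j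
    by (auto simp: cls image_iff)
  show "trivial_group (Tor S A N (Suc j)) \<longleftrightarrow> aug_exact S P \<epsilon> d N K e (Suc (Suc j))"
  proof -
    have "?D (Suc j) ` carrier (?T (Suc (Suc j))) \<subseteq> kernel (?T (Suc j)) (?T j) (?D j)"
    proof (rule image_subsetI)
      fix X assume "X \<in> carrier (?T (Suc (Suc j)))"
      then obtain u where "u \<in> frags (carrier (P (Suc (Suc j))) \<times> carrier N)"
        "X = tensor_class S (P (Suc (Suc j))) N u"
        by (auto simp: cls(1))
      then show "?D (Suc j) X \<in> kernel (?T (Suc j)) (?T j) (?D j)"
        using imageI[OF tmap_d_mem, of u "Suc j" "tensor_class S (P (Suc j)) N"]
        by (simp add: kernel_def cls tmap_dd)
    qed
    then have "trivial_group (Tor S A N (Suc j)) \<longleftrightarrow>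
        kernel (?T (Suc j)) (?T j) (?D j) \<subseteq> ?D (Suc j) ` carrier (?T (Suc (Suc j)))"
      unfolding Tor_def pd Let_def prod.case nat.case
      by (rule homology_trivial_iff[OF comm_group_tensor_group[OF P N] D.subgroup_kernel im])
    also have "\<dots> \<longleftrightarrow> (\<forall>u\<in>frags (carrier (P (Suc j)) \<times> carrier N). ?t j u \<in> tensor_relations S (P j) N \<longrightarrow>
        tensor_class S (P (Suc j)) N u \<in> ?D (Suc j) ` carrier (?T (Suc (Suc j))))"
    proof -
      have "tensor_class S (P (Suc j)) N u \<in> kernel (?T (Suc j)) (?T j) (?D j) \<longleftrightarrow>
          ?t j u \<in> tensor_relations S (P j) N" if "u \<in> frags (carrier (P (Suc j)) \<times> carrier N)" for u
        using that imageI[OF that, of "tensor_class S (P (Suc j)) N"] by (simp add: kernel_def cls)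
      moreover have "\<exists>u\<in>frags (carrier (P (Suc j)) \<times> carrier N). X = tensor_class S (P (Suc j)) N u"
        if "X \<in> kernel (?T (Suc j)) (?T j) (?D j)" for X
        using that by (auto simp: kernel_def cls(1))
      ultimately show ?thesis by blast
    qed
    finally show ?thesis
      unfolding mem aug_exact_def exact_at_Suc_iff .
  qed
  assume K0: "carrier K = {\<zero>\<^bsub>K\<^esub>}"
  have "trivial_group (Tor S A N 0) \<longleftrightarrow> carrier (?T 0) \<subseteq> ?D 0 ` carrier (?T (Suc 0))"
    unfolding Tor_def pd Let_def prod.case nat.case
    by (rule homology_trivial_iff[OF comm_group_tensor_group[OF P N] group.subgroup_self im subgroup.subset[OF im]])
      (use comm_group_tensor_group[OF P N] in \<open>simp add: comm_group_def\<close>)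
  also have "\<dots> \<longleftrightarrow> (\<forall>u\<in>frags (carrier (P 0) \<times> carrier N).
      tensor_class S (P 0) N u \<in> ?D 0 ` carrier (?T (Suc 0)))"
    by (auto simp: cls(1))
  also have "\<dots> \<longleftrightarrow> aug_exact S P \<epsilon> d N K e (Suc 0)"
  proof -
    have "tensor_eval e \<epsilon> u \<in> sum_relations K" if "u \<in> frags (carrier (P 0) \<times> carrier N)" for u
      using tensor_eval_mem[OF \<epsilon> that] msum(2)[OF K.left_module_axioms tensor_eval_mem[OF \<epsilon> that]] K0
      by (simp add: sum_relations_def)
    then show ?thesis
      unfolding mem aug_exact_def exact_at_1_iff by blast
  qed
  finally show "trivial_group (Tor S A N 0) \<longleftrightarrow> aug_exact S P \<epsilon> d N K e (Suc 0)" .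
qed

lemma Ext_trivialD:
  assumes "proj_resolution R A P \<epsilon> d" and pd: "proj_res R A = (P, d)" and B: "left_module R B"
    and tr: "trivial_group (Ext_group R A B (Suc j))"
    and g: "g \<in> lhom R (P (Suc j)) B" and gd: "\<And>x. x \<in> carrier (P (Suc (Suc j))) \<Longrightarrow> g (d (Suc j) x) = \<zero>\<^bsub>B\<^esub>"
  shows "\<exists>w\<in>lhom R (P j) B. \<forall>x\<in>carrier (P (Suc j)). g x = w (d j x)"
proof -
  interpret proj_resolution R A P \<epsilon> d by fact
  interpret B: left_module R B by fact
  let ?H = "\<lambda>j. Hom_group R (P j) B" and ?\<delta> = "\<lambda>j h. compose (carrier (P (Suc j))) h (d j)"
  have "kernel (?H (Suc j)) (?H (Suc (Suc j))) (?\<delta> (Suc j)) \<subseteq> ?\<delta> j ` carrier (?H j)"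
  proof (rule homology_trivialD)
    show "trivial_group (homology_at (?H (Suc j)) (kernel (?H (Suc j)) (?H (Suc (Suc j))) (?\<delta> (Suc j)))
        (?\<delta> j ` carrier (?H j)))"
      using tr unfolding Ext_group_def pd Let_def prod.case nat.case .
    have "(\<lambda>x\<in>carrier (P j). \<zero>\<^bsub>B\<^esub>) \<in> lhom R (P j) B"
      by (rule lhom_restrictI[OF P]) (auto simp: B.smult_r_null)
    then show "\<one>\<^bsub>?H (Suc j)\<^esub> \<in> ?\<delta> j ` carrier (?H j)"
      by (intro image_eqI[of _ _ "\<lambda>x\<in>carrier (P j). \<zero>\<^bsub>B\<^esub>"])
        (auto simp: Hom_group_def compose_def lhom_closed[OF d])
    fix z assume "z \<in> kernel (?H (Suc j)) (?H (Suc (Suc j))) (?\<delta> (Suc j))"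
    then have z: "z \<in> lhom R (P (Suc j)) B" by (simp add: kernel_def Hom_group_def)
    show "\<one>\<^bsub>?H (Suc j)\<^esub> \<otimes>\<^bsub>?H (Suc j)\<^esub> z = z"
      using lhom_closed[OF z] by (intro extensionalityI[OF _ lhom_extensional[OF z]]) (auto simp: Hom_group_def)
  qed
  moreover have "g \<in> kernel (?H (Suc j)) (?H (Suc (Suc j))) (?\<delta> (Suc j))"
    using g gd by (auto simp: kernel_def Hom_group_def compose_def)
  ultimately obtain w where "w \<in> lhom R (P j) B" "g = ?\<delta> j w"
    by (auto simp: Hom_group_def)
  then show ?thesis by (intro bexI[of _ w]) (auto simp: compose_def)
qed

text \<open>Ext vanishes by assumption for the resolution that \<open>proj_res\<close> picks; this
  carries the conclusion over to a resolution by finitely generated modules.\<close>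

lemma cocycle_transfer:
  assumes resP: "projective_resolution R A P \<epsilon> d" and resQ: "projective_resolution R A Q \<epsilon>' d'"
    and B: "left_module R B"
    and ex: "\<And>g. g \<in> lhom R (P (Suc j)) B \<Longrightarrow> (\<And>x. x \<in> carrier (P (Suc (Suc j))) \<Longrightarrow> g (d (Suc j) x) = \<zero>\<^bsub>B\<^esub>) \<Longrightarrow>
      \<exists>w\<in>lhom R (P j) B. \<forall>x\<in>carrier (P (Suc j)). g x = w (d j x)"
    and u: "u \<in> lhom R (Q (Suc j)) B" and ud: "\<And>x. x \<in> carrier (Q (Suc (Suc j))) \<Longrightarrow> u (d' (Suc j) x) = \<zero>\<^bsub>B\<^esub>"
  shows "\<exists>w\<in>lhom R (Q j) B. \<forall>x\<in>carrier (Q (Suc j)). u x = w (d' j x)"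
proof -
  interpret B: left_module R B by fact
  obtain \<phi> \<psi> h where "resolution_comparison R A Q \<epsilon>' d' P \<epsilon> d \<phi> \<psi> h"
    using resolution_comparison_exists[OF resQ resP] .
  then interpret c: resolution_comparison R A Q \<epsilon>' d' P \<epsilon> d \<phi> \<psi> h .
  note cl = lhom_closed[OF c.\<phi>] lhom_closed[OF c.\<psi>] lhom_closed[OF c.h] lhom_closed[OF c.P.d] lhom_closed[OF c.Q.d]
  obtain w where w: "w \<in> lhom R (P j) B"
    "\<And>x. x \<in> carrier (P (Suc j)) \<Longrightarrow> compose (carrier (P (Suc j))) u (\<psi> (Suc j)) x = w (d j x)"
    using ex[OF lhom_compose[OF c.Q.P c.\<psi> u]]
    by (auto simp: compose_def cl c.d\<psi>[symmetric] ud)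
  \<comment> \<open>Apply the cocycle \<open>u\<close> to the homotopy formula: the summand with d'
    h vanishes, \<open>u\<close> \<circ> \<psi> is the coboundary of \<open>w\<close>, and the
    remaining summand contributes \<open>u\<close> \<circ> \<open>h\<close>.\<close>
  let ?w = "\<lambda>x\<in>carrier (Q j). w (\<phi> j x) \<oplus>\<^bsub>B\<^esub> u (h j x)"
  have "?w \<in> lhom R (Q j) B"
    by (rule lhom_restrictI[OF c.P.P])
      (auto simp: cl lhom_closed[OF w(1)] lhom_closed[OF u] lhom_add[OF c.\<phi>] lhom_add[OF c.h] lhom_add[OF w(1)]
        lhom_add[OF u] lhom_smult[OF c.\<phi>] lhom_smult[OF c.h] lhom_smult[OF w(1)] lhom_smult[OF u]
        B.smult_r_distr B.smult_closed B.M.add.m_ac)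
  moreover have "u x = ?w (d' j x)" if x: "x \<in> carrier (Q (Suc j))" for x
  proof -
    interpret Qj: left_module R "Q (Suc j)" by (rule c.P.P)
    have "u x = u (\<psi> (Suc j) (\<phi> (Suc j) x) \<oplus>\<^bsub>Q (Suc j)\<^esub> (d' (Suc j) (h (Suc j) x) \<oplus>\<^bsub>Q (Suc j)\<^esub> h j (d' j x)))"
      using c.hS[OF x] by (rule arg_cong)
    also have "\<dots> = u (\<psi> (Suc j) (\<phi> (Suc j) x)) \<oplus>\<^bsub>B\<^esub> u (h j (d' j x))"
      using x by (simp add: lhom_add[OF u] cl ud lhom_closed[OF u])
    also have "u (\<psi> (Suc j) (\<phi> (Suc j) x)) = w (\<phi> j (d' j x))"
      using w(2)[OF lhom_closed[OF c.\<phi> x]] x by (simp add: compose_def cl c.d\<phi>)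
    finally show ?thesis using x by (simp add: cl)
  qed
  ultimately show ?thesis by blast
qed

section \<open>Baer's criterion and Zorn's lemma for partial homomorphisms\<close>

section \<open>Extension of homomorphisms into injective modules\<close>

text \<open>Extend \<open>h\<close> from the left ideal \<open>J\<close> to all of \<open>R\<close>;
  the value at one is the required \<open>e\<close>.\<close>

lemma injective_baer:
  fixes R :: "('r, 'k) ring_scheme" and E :: "('r, 'e) module"
  assumes inj: "injective_module R E"
    and J: "J \<subseteq> carrier R" "\<zero>\<^bsub>R\<^esub> \<in> J" "\<And>x y. x \<in> J \<Longrightarrow> y \<in> J \<Longrightarrow> x \<oplus>\<^bsub>R\<^esub> y \<in> J"
      "\<And>r x. r \<in> carrier R \<Longrightarrow> x \<in> J \<Longrightarrow> r \<otimes>\<^bsub>R\<^esub> x \<in> J"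
    and h: "\<And>x. x \<in> J \<Longrightarrow> h x \<in> carrier E" "\<And>x y. x \<in> J \<Longrightarrow> y \<in> J \<Longrightarrow> h (x \<oplus>\<^bsub>R\<^esub> y) = h x \<oplus>\<^bsub>E\<^esub> h y"
      "\<And>r x. r \<in> carrier R \<Longrightarrow> x \<in> J \<Longrightarrow> h (r \<otimes>\<^bsub>R\<^esub> x) = r \<odot>\<^bsub>E\<^esub> h x"
  shows "\<exists>e\<in>carrier E. \<forall>x\<in>J. h x = x \<odot>\<^bsub>E\<^esub> e"
proof -
  interpret E: left_module R E using inj by (simp add: injective_module_def)
  \<comment> \<open>A copy of \<open>R\<close> as a left module over itself, placed by
    \<open>Inl\<close> in the type of the test modules of \<open>injective_module\<close>.\<close>
  define B :: "('r, 'r + 'e) module" where "B = \<lparr>carrier = Inl ` carrier R, monoid.mult = undefined,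
    one = undefined, ring.zero = Inl \<zero>\<^bsub>R\<^esub>, add = (\<lambda>x y. Inl (projl x \<oplus>\<^bsub>R\<^esub> projl y)),
    smult = (\<lambda>r x. Inl (r \<otimes>\<^bsub>R\<^esub> projl x))\<rparr>"
  have B_simps: "carrier B = Inl ` carrier R" "\<zero>\<^bsub>B\<^esub> = Inl \<zero>\<^bsub>R\<^esub>"
    "Inl x \<oplus>\<^bsub>B\<^esub> Inl y = Inl (x \<oplus>\<^bsub>R\<^esub> y)" "r \<odot>\<^bsub>B\<^esub> Inl x = Inl (r \<otimes>\<^bsub>R\<^esub> x)" for x y r
    by (simp_all add: B_def)
  have "abelian_group B"
  proof (rule abelian_groupI)
    fix x assume "x \<in> carrier B"
    then obtain y where "x = Inl y" "y \<in> carrier R" by (auto simp: B_simps)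
    then show "\<exists>y\<in>carrier B. y \<oplus>\<^bsub>B\<^esub> x = \<zero>\<^bsub>B\<^esub>"
      by (intro bexI[of _ "Inl (\<ominus>\<^bsub>R\<^esub> y)"]) (auto simp: B_simps E.R.l_neg)
  qed (auto simp: B_simps E.R.add.m_ac)
  then have B: "left_module R B"
    by (intro left_moduleI E.R.ring_axioms) (auto simp: B_simps E.R.l_distr E.R.r_distr E.R.m_assoc)
  interpret B: left_module R B by (rule B)
  have sub: "submodule (Inl ` J) R B"
    by (rule B.submoduleI) (use J in \<open>auto simp: B_simps\<close>)
  have "(\<lambda>x\<in>carrier (B\<lparr>carrier := Inl ` J\<rparr>). h (projl x)) \<in> lhom R (B\<lparr>carrier := Inl ` J\<rparr>) E"
    by (rule lhom_restrictI[OF B.submodule_left_module[OF sub]]) (auto simp: B_simps h)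
  then have "(\<lambda>x\<in>Inl ` J. h (projl x)) \<in> lhom R (B\<lparr>carrier := Inl ` J\<rparr>) E"
    by simp
  moreover have "inj_on (\<lambda>x\<in>Inl ` J. x) (carrier (B\<lparr>carrier := Inl ` J\<rparr>))"
    by (auto simp: inj_on_def)
  ultimately have "\<exists>g\<in>lhom R B E. \<forall>x\<in>carrier (B\<lparr>carrier := Inl ` J\<rparr>).
      g ((\<lambda>x\<in>Inl ` J. x) x) = (\<lambda>x\<in>Inl ` J. h (projl x)) x"
    using inj[unfolded injective_module_def, THEN conjunct2, rule_format,
        OF conjI[OF B.submodule_left_module[OF sub] conjI[OF B conjI[OF inclusion_lhom[OF B sub] conjI]]]]
    by blast
  then obtain g where g: "g \<in> lhom R B E"
    "\<forall>x\<in>carrier (B\<lparr>carrier := Inl ` J\<rparr>). g ((\<lambda>x\<in>Inl ` J. x) x) = (\<lambda>x\<in>Inl ` J. h (projl x)) x"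
    by (rule bexE)
  have "h x = x \<odot>\<^bsub>E\<^esub> g (Inl \<one>\<^bsub>R\<^esub>)" if "x \<in> J" for x
  proof -
    have x: "x \<in> carrier R" using that J by auto
    have "h x = g (Inl x)" using g(2) that by simp
    also have "Inl x = x \<odot>\<^bsub>B\<^esub> Inl \<one>\<^bsub>R\<^esub>" using x by (simp add: B_simps)
    also have "g \<dots> = x \<odot>\<^bsub>E\<^esub> g (Inl \<one>\<^bsub>R\<^esub>)"
      using x by (intro lhom_smult[OF g(1)]) (auto simp: B_simps)
    finally show ?thesis .
  qed
  then show ?thesis
    using lhom_closed[OF g(1), of "Inl \<one>\<^bsub>R\<^esub>"] by (auto simp: B_simps)
qed

text \<open>Graphs of homomorphisms from a submodule of \<open>Y\<close> to \<open>E\<close>: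
  submodules of Y \<times> E that meet 0 \<times> E in zero. As sets of pairs they are ordered by
  inclusion, which suits Zorn's lemma.\<close>

definition hom_graph where
  "hom_graph R Y E H \<longleftrightarrow> H \<subseteq> carrier Y \<times> carrier E \<and> (\<zero>\<^bsub>Y\<^esub>, \<zero>\<^bsub>E\<^esub>) \<in> H \<and>
    (\<forall>y e y' e'. (y, e) \<in> H \<longrightarrow> (y', e') \<in> H \<longrightarrow> (y \<oplus>\<^bsub>Y\<^esub> y', e \<oplus>\<^bsub>E\<^esub> e') \<in> H) \<and>
    (\<forall>r y e. r \<in> carrier R \<longrightarrow> (y, e) \<in> H \<longrightarrow> (r \<odot>\<^bsub>Y\<^esub> y, r \<odot>\<^bsub>E\<^esub> e) \<in> H) \<and>
    (\<forall>e. (\<zero>\<^bsub>Y\<^esub>, e) \<in> H \<longrightarrow> e = \<zero>\<^bsub>E\<^esub>)"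

lemma hom_graphD:
  assumes "hom_graph R Y E H"
  shows "(y, e) \<in> H \<Longrightarrow> y \<in> carrier Y" "(y, e) \<in> H \<Longrightarrow> e \<in> carrier E" "(\<zero>\<^bsub>Y\<^esub>, \<zero>\<^bsub>E\<^esub>) \<in> H"
    "(y, e) \<in> H \<Longrightarrow> (y', e') \<in> H \<Longrightarrow> (y \<oplus>\<^bsub>Y\<^esub> y', e \<oplus>\<^bsub>E\<^esub> e') \<in> H"
    "r \<in> carrier R \<Longrightarrow> (y, e) \<in> H \<Longrightarrow> (r \<odot>\<^bsub>Y\<^esub> y, r \<odot>\<^bsub>E\<^esub> e) \<in> H"
    "(\<zero>\<^bsub>Y\<^esub>, e) \<in> H \<Longrightarrow> e = \<zero>\<^bsub>E\<^esub>"
  using assms unfolding hom_graph_def by blast+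

lemma (in left_module) smult_minus_one: "x \<in> carrier M \<Longrightarrow> (\<ominus>\<^bsub>R\<^esub> \<one>\<^bsub>R\<^esub>) \<odot>\<^bsub>M\<^esub> x = \<ominus>\<^bsub>M\<^esub> x"
  using smult_l_distr[of "\<ominus>\<^bsub>R\<^esub> \<one>\<^bsub>R\<^esub>" "\<one>\<^bsub>R\<^esub>" x] smult_closed[of "\<ominus>\<^bsub>R\<^esub> \<one>\<^bsub>R\<^esub>" x]
    M.add.inv_equality[of "(\<ominus>\<^bsub>R\<^esub> \<one>\<^bsub>R\<^esub>) \<odot>\<^bsub>M\<^esub> x" x]
  by (simp add: R.l_neg smult_l_null smult_one)

lemma hom_graph_unique:
  assumes Y: "left_module R Y" and E: "left_module R E" and H: "hom_graph R Y E H"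
    and ye: "(y, e) \<in> H" "(y, e') \<in> H"
  shows "e = e'"
proof -
  interpret Y: left_module R Y by fact
  interpret E: left_module R E by fact
  note H = hom_graphD[OF H]
  have c: "y \<in> carrier Y" "e \<in> carrier E" "e' \<in> carrier E" using H(1,2) ye by auto
  have "(y \<oplus>\<^bsub>Y\<^esub> (\<ominus>\<^bsub>R\<^esub> \<one>\<^bsub>R\<^esub>) \<odot>\<^bsub>Y\<^esub> y, e \<oplus>\<^bsub>E\<^esub> (\<ominus>\<^bsub>R\<^esub> \<one>\<^bsub>R\<^esub>) \<odot>\<^bsub>E\<^esub> e') \<in> H"
    by (intro H(4,5) ye) simp
  then have "(\<zero>\<^bsub>Y\<^esub>, e \<ominus>\<^bsub>E\<^esub> e') \<in> H"
    using c by (simp add: Y.smult_minus_one E.smult_minus_one Y.M.r_neg a_minus_def)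
  then have "e \<ominus>\<^bsub>E\<^esub> e' = \<zero>\<^bsub>E\<^esub>" by (rule H(6))
  then show ?thesis
    using c E.M.add.inv_equality[of e "\<ominus>\<^bsub>E\<^esub> e'"] by (simp add: a_minus_def)
qed

text \<open>The scalars that send \<open>y\<close> into the domain form a left ideal
  \<open>J\<close>, on which the values of the partial homomorphism are x \<mapsto> x e for some
  \<open>e\<close> by Baer's criterion. This \<open>e\<close> is taken as the value at
  \<open>y\<close>.\<close>

lemma hom_graph_extend:
  assumes inj: "injective_module R E" and Y: "left_module R Y" and H: "hom_graph R Y E H"
    and y: "y \<in> carrier Y"
  obtains H' e where "hom_graph R Y E H'" "H \<subseteq> H'" "(y, e) \<in> H'"
proof -
  interpret Y: left_module R Y by fact
  interpret E: left_module R E using inj by (simp add: injective_module_def)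
  note HD = hom_graphD[OF H] and uniq = hom_graph_unique[OF Y E.left_module_axioms H]
  define J where "J = {r \<in> carrier R. \<exists>e. (r \<odot>\<^bsub>Y\<^esub> y, e) \<in> H}"
  define h where "h r = (THE e. (r \<odot>\<^bsub>Y\<^esub> y, e) \<in> H)" for r
  have h_eq: "h r = e" if "(r \<odot>\<^bsub>Y\<^esub> y, e) \<in> H" for r e
    unfolding h_def using that uniq by blast
  have h_mem: "(r \<odot>\<^bsub>Y\<^esub> y, h r) \<in> H" if "r \<in> J" for r
    using that h_eq by (auto simp: J_def)
  have add: "((r \<oplus>\<^bsub>R\<^esub> s) \<odot>\<^bsub>Y\<^esub> y, h r \<oplus>\<^bsub>E\<^esub> h s) \<in> H" if "r \<in> J" "s \<in> J" for r s
    using HD(4)[OF h_mem[OF that(1)] h_mem[OF that(2)]] that y by (simp add: J_def Y.smult_l_distr)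
  have smult: "((s \<otimes>\<^bsub>R\<^esub> r) \<odot>\<^bsub>Y\<^esub> y, s \<odot>\<^bsub>E\<^esub> h r) \<in> H" if "r \<in> J" "s \<in> carrier R" for r s
    using HD(5)[OF that(2) h_mem[OF that(1)]] that y by (simp add: J_def Y.smult_assoc)
  have "\<exists>e\<in>carrier E. \<forall>x\<in>J. h x = x \<odot>\<^bsub>E\<^esub> e"
  proof (rule injective_baer[OF inj])
    show "J \<subseteq> carrier R" by (auto simp: J_def)
    show "\<zero>\<^bsub>R\<^esub> \<in> J" using HD(3) y by (auto simp: J_def Y.smult_l_null)
    show "r \<oplus>\<^bsub>R\<^esub> s \<in> J" if "r \<in> J" "s \<in> J" for r s
      using add[OF that] that by (auto simp: J_def)
    show "s \<otimes>\<^bsub>R\<^esub> r \<in> J" if "s \<in> carrier R" "r \<in> J" for r s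
      using smult[OF that(2,1)] that by (auto simp: J_def)
    show "h r \<in> carrier E" if "r \<in> J" for r by (rule HD(2)[OF h_mem[OF that]])
    show "h (r \<oplus>\<^bsub>R\<^esub> s) = h r \<oplus>\<^bsub>E\<^esub> h s" if "r \<in> J" "s \<in> J" for r s
      by (rule h_eq[OF add[OF that]])
    show "h (s \<otimes>\<^bsub>R\<^esub> r) = s \<odot>\<^bsub>E\<^esub> h r" if "s \<in> carrier R" "r \<in> J" for r s
      by (rule h_eq[OF smult[OF that(2,1)]])
  qed
  then obtain e where e: "e \<in> carrier E" "\<And>x. x \<in> J \<Longrightarrow> h x = x \<odot>\<^bsub>E\<^esub> e" by blast
  define H' where "H' = {(a \<oplus>\<^bsub>Y\<^esub> r \<odot>\<^bsub>Y\<^esub> y, b \<oplus>\<^bsub>E\<^esub> r \<odot>\<^bsub>E\<^esub> e) | a b r. (a, b) \<in> H \<and> r \<in> carrier R}"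
  have H'I: "(a \<oplus>\<^bsub>Y\<^esub> r \<odot>\<^bsub>Y\<^esub> y, b \<oplus>\<^bsub>E\<^esub> r \<odot>\<^bsub>E\<^esub> e) \<in> H'" if "(a, b) \<in> H" "r \<in> carrier R" for a b r
    using that by (auto simp: H'_def)
  have HH': "(a, b) \<in> H'" if "(a, b) \<in> H" for a b
    using H'I[OF that, of "\<zero>\<^bsub>R\<^esub>"] HD(1,2)[OF that] y e(1)
    by (simp add: Y.smult_l_null E.smult_l_null)
  have "hom_graph R Y E H'"
    unfolding hom_graph_def
  proof (intro conjI allI impI)
    show "H' \<subseteq> carrier Y \<times> carrier E"
      using HD(1,2) y e(1) by (auto simp: H'_def intro!: Y.smult_closed E.smult_closed Y.M.a_closed E.M.a_closed)
    show "(\<zero>\<^bsub>Y\<^esub>, \<zero>\<^bsub>E\<^esub>) \<in> H'" by (rule HH'[OF HD(3)])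
  next
    fix u v u' v' assume "(u, v) \<in> H'" "(u', v') \<in> H'"
    then obtain a b r a' b' r' where *: "(a, b) \<in> H" "r \<in> carrier R" "u = a \<oplus>\<^bsub>Y\<^esub> r \<odot>\<^bsub>Y\<^esub> y" "v = b \<oplus>\<^bsub>E\<^esub> r \<odot>\<^bsub>E\<^esub> e"
      "(a', b') \<in> H" "r' \<in> carrier R" "u' = a' \<oplus>\<^bsub>Y\<^esub> r' \<odot>\<^bsub>Y\<^esub> y" "v' = b' \<oplus>\<^bsub>E\<^esub> r' \<odot>\<^bsub>E\<^esub> e"
      by (auto simp: H'_def)
    have c: "a \<in> carrier Y" "b \<in> carrier E" "a' \<in> carrier Y" "b' \<in> carrier E"
      using HD(1,2) * by auto
    have "((a \<oplus>\<^bsub>Y\<^esub> a') \<oplus>\<^bsub>Y\<^esub> (r \<oplus>\<^bsub>R\<^esub> r') \<odot>\<^bsub>Y\<^esub> y, (b \<oplus>\<^bsub>E\<^esub> b') \<oplus>\<^bsub>E\<^esub> (r \<oplus>\<^bsub>R\<^esub> r') \<odot>\<^bsub>E\<^esub> e) \<in> H'"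
      using * by (intro H'I HD(4)) auto
    then show "(u \<oplus>\<^bsub>Y\<^esub> u', v \<oplus>\<^bsub>E\<^esub> v') \<in> H'"
      using * c y e(1) by (simp add: Y.smult_l_distr E.smult_l_distr Y.smult_closed E.smult_closed
          Y.M.add.m_ac E.M.add.m_ac)
  next
    fix s u v assume s: "s \<in> carrier R" and "(u, v) \<in> H'"
    then obtain a b r where *: "(a, b) \<in> H" "r \<in> carrier R" "u = a \<oplus>\<^bsub>Y\<^esub> r \<odot>\<^bsub>Y\<^esub> y" "v = b \<oplus>\<^bsub>E\<^esub> r \<odot>\<^bsub>E\<^esub> e"
      by (auto simp: H'_def)
    have c: "a \<in> carrier Y" "b \<in> carrier E" using HD(1,2) * by auto
    have "(s \<odot>\<^bsub>Y\<^esub> a \<oplus>\<^bsub>Y\<^esub> (s \<otimes>\<^bsub>R\<^esub> r) \<odot>\<^bsub>Y\<^esub> y, s \<odot>\<^bsub>E\<^esub> b \<oplus>\<^bsub>E\<^esub> (s \<otimes>\<^bsub>R\<^esub> r) \<odot>\<^bsub>E\<^esub> e) \<in> H'"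
      using * s by (intro H'I HD(5)) auto
    then show "(s \<odot>\<^bsub>Y\<^esub> u, s \<odot>\<^bsub>E\<^esub> v) \<in> H'"
      using * c s y e(1) by (simp add: Y.smult_r_distr E.smult_r_distr Y.smult_closed E.smult_closed
          Y.smult_assoc E.smult_assoc)
  next
    \<comment> \<open>Single-valuedness: if a + r y = 0, then r y = -a lies in the domain, so
      \<open>r\<close> belongs to \<open>J\<close> and r e equals -b by the choice of
      \<open>e\<close>.\<close>
    fix v assume "(\<zero>\<^bsub>Y\<^esub>, v) \<in> H'"
    then obtain a b r where *: "(a, b) \<in> H" "r \<in> carrier R" "\<zero>\<^bsub>Y\<^esub> = a \<oplus>\<^bsub>Y\<^esub> r \<odot>\<^bsub>Y\<^esub> y" "v = b \<oplus>\<^bsub>E\<^esub> r \<odot>\<^bsub>E\<^esub> e"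
      by (auto simp: H'_def)
    have c: "a \<in> carrier Y" "b \<in> carrier E" "r \<odot>\<^bsub>Y\<^esub> y \<in> carrier Y"
      using HD(1,2) * y by (auto simp: Y.smult_closed)
    have "\<ominus>\<^bsub>Y\<^esub> a = r \<odot>\<^bsub>Y\<^esub> y"
      using *(3) c by (metis Y.M.minus_equality Y.M.a_comm)
    then have "(r \<odot>\<^bsub>Y\<^esub> y, \<ominus>\<^bsub>E\<^esub> b) \<in> H"
      using HD(5)[OF _ *(1), of "\<ominus>\<^bsub>R\<^esub> \<one>\<^bsub>R\<^esub>"] c by (simp add: Y.smult_minus_one E.smult_minus_one)
    then have "r \<in> J" "h r = \<ominus>\<^bsub>E\<^esub> b"
      using *(2) h_eq by (auto simp: J_def)
    then have "r \<odot>\<^bsub>E\<^esub> e = \<ominus>\<^bsub>E\<^esub> b" using e(2) by simp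
    then show "v = \<zero>\<^bsub>E\<^esub>" using * c by (simp add: E.M.r_neg)
  qed
  moreover have "(y, e) \<in> H'"
    using H'I[OF HD(3), of "\<one>\<^bsub>R\<^esub>"] y e(1) by (simp add: Y.smult_one E.smult_one)
  ultimately show ?thesis
    by (intro that[of H' e]) (use HH' in auto)
qed

text \<open>\<open>Y\<close> may have elements of any type, in particular be a module of
  homomorphisms. A graph is taken instead of a map on a submodule because the data to be extended
  arise as pairs, such as a composite g d with an evaluation at \<open>g\<close>.\<close>

lemma injective_extension:
  assumes inj: "injective_module R E" and Y: "left_module R Y" and G: "hom_graph R Y E G"
  obtains \<Psi> where "\<Psi> \<in> lhom R Y E" "\<And>y e. (y, e) \<in> G \<Longrightarrow> \<Psi> y = e"
proof -
  interpret Y: left_module R Y by fact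
  interpret E: left_module R E using inj by (simp add: injective_module_def)
  let ?\<A> = "{H. hom_graph R Y E H \<and> G \<subseteq> H}"
  have "\<exists>M\<in>?\<A>. \<forall>X\<in>?\<A>. M \<subseteq> X \<longrightarrow> X = M"
  proof (rule subset_Zorn_nonempty)
    show "?\<A> \<noteq> {}" using G by blast
    fix \<C> assume C: "\<C> \<noteq> {}" "subset.chain ?\<A> \<C>"
    then have hg: "hom_graph R Y E H" "G \<subseteq> H" if "H \<in> \<C>" for H
      using that by (auto simp: subset.chain_def)
    obtain H0 where H0: "H0 \<in> \<C>" using C by blast
    have two: "\<exists>H\<in>\<C>. p \<in> H \<and> p' \<in> H" if "p \<in> \<Union>\<C>" "p' \<in> \<Union>\<C>" for p p'
      using that C(2) unfolding subset_chain_def by blast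
    have "hom_graph R Y E (\<Union>\<C>)"
      unfolding hom_graph_def
    proof (intro conjI allI impI)
      show "\<Union>\<C> \<subseteq> carrier Y \<times> carrier E"
        by (rule Union_least) (use hg(1) in \<open>simp add: hom_graph_def\<close>)
      show "(\<zero>\<^bsub>Y\<^esub>, \<zero>\<^bsub>E\<^esub>) \<in> \<Union>\<C>" by (rule UnionI[OF H0 hom_graphD(3)[OF hg(1)[OF H0]]])
    next
      fix y e y' e' assume "(y, e) \<in> \<Union>\<C>" "(y', e') \<in> \<Union>\<C>"
      then obtain H where H: "H \<in> \<C>" "(y, e) \<in> H" "(y', e') \<in> H" using two by blast
      then show "(y \<oplus>\<^bsub>Y\<^esub> y', e \<oplus>\<^bsub>E\<^esub> e') \<in> \<Union>\<C>" by (intro UnionI[OF H(1) hom_graphD(4)[OF hg(1)[OF H(1)] H(2,3)]])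
    next
      fix r y e assume r: "r \<in> carrier R" and "(y, e) \<in> \<Union>\<C>"
      then obtain H where H: "H \<in> \<C>" "(y, e) \<in> H" by blast
      then show "(r \<odot>\<^bsub>Y\<^esub> y, r \<odot>\<^bsub>E\<^esub> e) \<in> \<Union>\<C>"
        by (intro UnionI[OF H(1) hom_graphD(5)[OF hg(1)[OF H(1)] r H(2)]])
    next
      fix e assume "(\<zero>\<^bsub>Y\<^esub>, e) \<in> \<Union>\<C>"
      then obtain H where H: "H \<in> \<C>" "(\<zero>\<^bsub>Y\<^esub>, e) \<in> H" by blast
      then show "e = \<zero>\<^bsub>E\<^esub>" by (intro hom_graphD(6)[OF hg(1)])
    qed
    then show "\<Union>\<C> \<in> ?\<A>" using hg(2)[OF H0] H0 by blast
  qed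
  then obtain M where M': "M \<in> ?\<A>" "\<forall>X\<in>?\<A>. M \<subseteq> X \<longrightarrow> X = M"
    by (rule bexE)
  then have M: "hom_graph R Y E M" "G \<subseteq> M"
    and max: "\<And>X. hom_graph R Y E X \<Longrightarrow> G \<subseteq> X \<Longrightarrow> M \<subseteq> X \<Longrightarrow> X = M"
    by simp_all
  have total: "\<exists>e. (y, e) \<in> M" if y: "y \<in> carrier Y" for y
  proof -
    obtain H' e where "hom_graph R Y E H'" "M \<subseteq> H'" "(y, e) \<in> H'"
      using hom_graph_extend[OF inj Y M(1) y] .
    moreover from this have "H' = M"
      using M(2) by (intro max) auto
    ultimately show ?thesis by auto
  qed
  define \<Psi> where "\<Psi> = (\<lambda>y\<in>carrier Y. THE e. (y, e) \<in> M)"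
  have eq: "\<Psi> y = e" if "(y, e) \<in> M" for y e
  proof -
    have "(THE e. (y, e) \<in> M) = e"
      using that hom_graph_unique[OF Y E.left_module_axioms M(1)] by blast
    then show ?thesis using hom_graphD(1)[OF M(1) that] by (simp add: \<Psi>_def)
  qed
  have mem: "(y, \<Psi> y) \<in> M" if "y \<in> carrier Y" for y
    using total[OF that] eq by blast
  have "(\<lambda>y\<in>carrier Y. \<Psi> y) \<in> lhom R Y E"
  proof (rule lhom_restrictI[OF Y])
    show "\<Psi> y \<in> carrier E" if "y \<in> carrier Y" for y
      by (rule hom_graphD(2)[OF M(1) mem[OF that]])
    show "\<Psi> (y \<oplus>\<^bsub>Y\<^esub> y') = \<Psi> y \<oplus>\<^bsub>E\<^esub> \<Psi> y'" if "y \<in> carrier Y" "y' \<in> carrier Y" for y y'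
      by (rule eq[OF hom_graphD(4)[OF M(1) mem[OF that(1)] mem[OF that(2)]]])
    show "\<Psi> (r \<odot>\<^bsub>Y\<^esub> y) = r \<odot>\<^bsub>E\<^esub> \<Psi> y" if "r \<in> carrier R" "y \<in> carrier Y" for r y
      by (rule eq[OF hom_graphD(5)[OF M(1) that(1) mem[OF that(2)]]])
  qed
  then show ?thesis
  proof (rule that)
    fix y e assume "(y, e) \<in> G"
    with M(2) have "(y, e) \<in> M" by blast
    then show "(\<lambda>y\<in>carrier Y. \<Psi> y) y = e"
      using eq hom_graphD(1)[OF M(1)] by simp
  qed
qed

section \<open>The modules Hom_R(C, -) and Hom_S(-, C), and evaluation\<close>

section \<open>Hom modules of a bimodule\<close>

lemma right_mod_simps [simp]:
  "carrier (right_mod C) = carrier C" "\<zero>\<^bsub>right_mod C\<^esub> = \<zero>\<^bsub>C\<^esub>" "x \<oplus>\<^bsub>right_mod C\<^esub> y = x \<oplus>\<^bsub>C\<^esub> y"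
  "s \<odot>\<^bsub>right_mod C\<^esub> c = rsmult C c s"
  by (simp_all add: right_mod_def)

definition Hom_right :: "'r ring \<Rightarrow> 's ring \<Rightarrow> ('r, 's, 'c) bimodule \<Rightarrow> ('s, 'q) module \<Rightarrow> ('r, 'q \<Rightarrow> 'c) module" where
  "Hom_right R S C Q = \<lparr>carrier = lhom (opposite_ring S) Q (right_mod C), monoid.mult = undefined, one = undefined,
     ring.zero = (\<lambda>p\<in>carrier Q. \<zero>\<^bsub>C\<^esub>), add = (\<lambda>g h. \<lambda>p\<in>carrier Q. g p \<oplus>\<^bsub>C\<^esub> h p),
     smult = (\<lambda>r g. \<lambda>p\<in>carrier Q. r \<odot>\<^bsub>C\<^esub> g p)\<rparr>"

locale bimod =
  fixes R :: "'r ring" and S :: "'s ring" and C :: "('r, 's, 'c) bimodule"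
  assumes bimodule: "is_bimodule R S C"
begin

lemma ring_R: "ring R" and ring_S: "ring S" and left_C: "left_module R C"
  and right_C: "right_module S (right_mod C)"
  using bimodule by (auto simp: is_bimodule_def)

sublocale C: left_module R C by (rule left_C)
sublocale rC: left_module "opposite_ring S" "right_mod C" by (rule right_C)

lemma rsmult_closed: "s \<in> carrier S \<Longrightarrow> c \<in> carrier C \<Longrightarrow> rsmult C c s \<in> carrier C"
  and rsmult_add: "s \<in> carrier S \<Longrightarrow> c \<in> carrier C \<Longrightarrow> c' \<in> carrier C \<Longrightarrow>
    rsmult C (c \<oplus>\<^bsub>C\<^esub> c') s = rsmult C c s \<oplus>\<^bsub>C\<^esub> rsmult C c' s"
  and rsmult_distrib: "s \<in> carrier S \<Longrightarrow> t \<in> carrier S \<Longrightarrow> c \<in> carrier C \<Longrightarrow>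
    rsmult C c (s \<oplus>\<^bsub>S\<^esub> t) = rsmult C c s \<oplus>\<^bsub>C\<^esub> rsmult C c t"
  and rsmult_assoc: "s \<in> carrier S \<Longrightarrow> t \<in> carrier S \<Longrightarrow> c \<in> carrier C \<Longrightarrow>
    rsmult C c (s \<otimes>\<^bsub>S\<^esub> t) = rsmult C (rsmult C c s) t"
  and rsmult_one: "c \<in> carrier C \<Longrightarrow> rsmult C c \<one>\<^bsub>S\<^esub> = c"
  and rsmult_smult: "r \<in> carrier R \<Longrightarrow> s \<in> carrier S \<Longrightarrow> c \<in> carrier C \<Longrightarrow>
    rsmult C (r \<odot>\<^bsub>C\<^esub> c) s = r \<odot>\<^bsub>C\<^esub> rsmult C c s"
  using rC.smult_closed[of s c] rC.smult_r_distr[of s c c'] rC.smult_l_distr[of s t c]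
    rC.smult_assoc[of t s c] rC.smult_one[of c] bimodule
  by (auto simp: is_bimodule_def)

lemma Hom_from_simps:
  "carrier (Hom_from R C M) = lhom R C M" "\<zero>\<^bsub>Hom_from R C M\<^esub> = (\<lambda>c\<in>carrier C. \<zero>\<^bsub>M\<^esub>)"
  "g \<oplus>\<^bsub>Hom_from R C M\<^esub> h = (\<lambda>c\<in>carrier C. g c \<oplus>\<^bsub>M\<^esub> h c)"
  "s \<odot>\<^bsub>Hom_from R C M\<^esub> h = (\<lambda>c\<in>carrier C. h (rsmult C c s))"
  by (simp_all add: Hom_from_def)

lemma left_module_Hom_from:
  assumes M: "left_module R M"
  shows "left_module S (Hom_from R C M)"
proof -
  interpret M: left_module R M by fact
  have ext: "g = h" if "g \<in> extensional (carrier C)" "h \<in> extensional (carrier C)"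
      "\<And>c. c \<in> carrier C \<Longrightarrow> g c = h c" for g h :: "'c \<Rightarrow> 'a"
    using that by (rule extensionalityI)
  have add_cl: "g \<oplus>\<^bsub>Hom_from R C M\<^esub> h \<in> lhom R C M" if "g \<in> lhom R C M" "h \<in> lhom R C M" for g h
    unfolding Hom_from_simps
    by (rule lhom_restrictI[OF left_C])
      (auto simp: lhom_closed[OF that(1)] lhom_closed[OF that(2)] lhom_add[OF that(1)] lhom_add[OF that(2)]
        lhom_smult[OF that(1)] lhom_smult[OF that(2)] M.M.add.m_ac M.smult_r_distr)
  have smult_cl: "s \<odot>\<^bsub>Hom_from R C M\<^esub> h \<in> lhom R C M" if "s \<in> carrier S" "h \<in> lhom R C M" for s h
    unfolding Hom_from_simps
    by (rule lhom_restrictI[OF left_C])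
      (auto simp: lhom_closed[OF that(2)] lhom_add[OF that(2)] lhom_smult[OF that(2)] that(1)
        rsmult_closed rsmult_add rsmult_smult)
  have "abelian_group (Hom_from R C M)"
  proof (rule abelian_groupI)
    show "\<zero>\<^bsub>Hom_from R C M\<^esub> \<in> carrier (Hom_from R C M)"
      unfolding Hom_from_simps by (rule lhom_restrictI[OF left_C]) (auto simp: M.smult_r_null)
  next
    fix h assume "h \<in> carrier (Hom_from R C M)"
    then have h: "h \<in> lhom R C M" by (simp add: Hom_from_simps)
    have "(\<lambda>c\<in>carrier C. \<ominus>\<^bsub>M\<^esub> h c) \<in> lhom R C M"
      by (rule lhom_restrictI[OF left_C])
        (auto simp: lhom_closed[OF h] lhom_add[OF h] lhom_smult[OF h] M.M.minus_add M.smult_r_minus)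
    then show "\<exists>g\<in>carrier (Hom_from R C M). g \<oplus>\<^bsub>Hom_from R C M\<^esub> h = \<zero>\<^bsub>Hom_from R C M\<^esub>"
      by (intro bexI[of _ "\<lambda>c\<in>carrier C. \<ominus>\<^bsub>M\<^esub> h c"])
        (auto simp: Hom_from_simps lhom_closed[OF h] M.M.l_neg intro!: ext)
  next
    fix h assume "h \<in> carrier (Hom_from R C M)"
    then have h: "h \<in> lhom R C M" by (simp add: Hom_from_simps)
    show "\<zero>\<^bsub>Hom_from R C M\<^esub> \<oplus>\<^bsub>Hom_from R C M\<^esub> h = h"
      by (rule ext) (auto simp: Hom_from_simps lhom_closed[OF h] lhom_extensional[OF h])
  qed (auto simp: Hom_from_simps(1) intro: add_cl, auto simp: Hom_from_simps lhom_closed M.M.add.m_ac intro!: ext)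
  then show ?thesis
  proof (rule left_moduleI[OF ring_S])
    fix h assume "h \<in> carrier (Hom_from R C M)"
    then have h: "h \<in> lhom R C M" by (simp add: Hom_from_simps)
    show "\<one>\<^bsub>S\<^esub> \<odot>\<^bsub>Hom_from R C M\<^esub> h = h"
      by (rule ext) (auto simp: Hom_from_simps rsmult_one lhom_extensional[OF h])
  next
    fix s t h assume "s \<in> carrier S" "t \<in> carrier S" "h \<in> carrier (Hom_from R C M)"
    then have h: "h \<in> lhom R C M" "s \<in> carrier S" "t \<in> carrier S" by (auto simp: Hom_from_simps)
    show "(s \<oplus>\<^bsub>S\<^esub> t) \<odot>\<^bsub>Hom_from R C M\<^esub> h = s \<odot>\<^bsub>Hom_from R C M\<^esub> h \<oplus>\<^bsub>Hom_from R C M\<^esub> t \<odot>\<^bsub>Hom_from R C M\<^esub> h"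
      by (rule ext) (auto simp: Hom_from_simps rsmult_distrib rsmult_closed lhom_add[OF h(1)] h)
  qed (auto simp: Hom_from_simps(1) intro: smult_cl,
      auto simp: Hom_from_simps lhom_closed rsmult_closed rsmult_assoc intro!: ext)
qed

lemma Hom_from_pairing:
  assumes M: "left_module R M"
  shows "balanced_pairing R S (right_mod C) (Hom_from R C M) M (\<lambda>c h. h c)"
  by (intro balanced_pairing.intro balanced_pairing_axioms.intro right_C left_module_Hom_from M)
    (auto simp: Hom_from_simps lhom_closed lhom_add)

lemma Hom_from_map_lhom:
  assumes M: "left_module R M" "left_module R M'" and f: "f \<in> lhom R M M'"
  shows "restrict (Hom_from_map C f) (lhom R C M) \<in> lhom S (Hom_from R C M) (Hom_from R C M')"
proof -
  have "(\<lambda>h\<in>carrier (Hom_from R C M). Hom_from_map C f h) \<in> lhom S (Hom_from R C M) (Hom_from R C M')"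
  proof (rule lhom_restrictI[OF left_module_Hom_from[OF M(1)]])
    show "Hom_from_map C f h \<in> carrier (Hom_from R C M')" if "h \<in> carrier (Hom_from R C M)" for h
      using lhom_compose[OF left_C _ f] that by (simp add: Hom_from_simps Hom_from_map_def)
  qed (auto simp: Hom_from_simps Hom_from_map_def compose_def lhom_closed lhom_add[OF f] rsmult_closed intro!: ext)
  then show ?thesis by (simp add: Hom_from_simps)
qed

lemma Hom_right_simps:
  "carrier (Hom_right R S C Q) = lhom (opposite_ring S) Q (right_mod C)"
  "\<zero>\<^bsub>Hom_right R S C Q\<^esub> = (\<lambda>p\<in>carrier Q. \<zero>\<^bsub>C\<^esub>)"
  "g \<oplus>\<^bsub>Hom_right R S C Q\<^esub> h = (\<lambda>p\<in>carrier Q. g p \<oplus>\<^bsub>C\<^esub> h p)"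
  "r \<odot>\<^bsub>Hom_right R S C Q\<^esub> h = (\<lambda>p\<in>carrier Q. r \<odot>\<^bsub>C\<^esub> h p)"
  by (simp_all add: Hom_right_def)

lemma lhom_right_C:
  assumes "g \<in> lhom (opposite_ring S) Q (right_mod C)"
  shows "p \<in> carrier Q \<Longrightarrow> g p \<in> carrier C"
    and "p \<in> carrier Q \<Longrightarrow> p' \<in> carrier Q \<Longrightarrow> g (p \<oplus>\<^bsub>Q\<^esub> p') = g p \<oplus>\<^bsub>C\<^esub> g p'"
    and "s \<in> carrier S \<Longrightarrow> p \<in> carrier Q \<Longrightarrow> g (s \<odot>\<^bsub>Q\<^esub> p) = rsmult C (g p) s"
  using lhom_closed[OF assms] lhom_add[OF assms] lhom_smult[OF assms] by auto

lemma left_module_Hom_right: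
  assumes Q: "right_module S Q"
  shows "left_module R (Hom_right R S C Q)"
proof -
  let ?H = "Hom_right R S C Q" and ?L = "lhom (opposite_ring S) Q (right_mod C)"
  have add_cl: "g \<oplus>\<^bsub>?H\<^esub> h \<in> ?L" if "g \<in> ?L" "h \<in> ?L" for g h
    unfolding Hom_right_simps
    by (rule lhom_restrictI[OF Q])
      (auto simp: lhom_right_C[OF that(1)] lhom_right_C[OF that(2)] rsmult_add C.M.add.m_ac)
  have smult_cl: "r \<odot>\<^bsub>?H\<^esub> h \<in> ?L" if "r \<in> carrier R" "h \<in> ?L" for r h
    unfolding Hom_right_simps
    by (rule lhom_restrictI[OF Q])
      (auto simp: lhom_right_C[OF that(2)] that(1) C.smult_closed C.smult_r_distr rsmult_smult)
  have "abelian_group ?H"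
  proof (rule abelian_groupI)
    show "\<zero>\<^bsub>?H\<^esub> \<in> carrier ?H"
      unfolding Hom_right_simps by (rule lhom_restrictI[OF Q]) (use rC.smult_r_null in auto)
  next
    fix h assume "h \<in> carrier ?H"
    then have h: "h \<in> ?L" by (simp add: Hom_right_simps)
    have neg: "(\<ominus>\<^bsub>R\<^esub> \<one>\<^bsub>R\<^esub>) \<odot>\<^bsub>C\<^esub> x \<oplus>\<^bsub>C\<^esub> x = \<zero>\<^bsub>C\<^esub>" if "x \<in> carrier C" for x
      using that by (simp add: C.smult_minus_one C.M.l_neg)
    have "(\<ominus>\<^bsub>R\<^esub> \<one>\<^bsub>R\<^esub>) \<odot>\<^bsub>?H\<^esub> h \<in> carrier ?H"
      using smult_cl[OF _ h] by (simp add: Hom_right_simps(1))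
    moreover have "(\<ominus>\<^bsub>R\<^esub> \<one>\<^bsub>R\<^esub>) \<odot>\<^bsub>?H\<^esub> h \<oplus>\<^bsub>?H\<^esub> h = \<zero>\<^bsub>?H\<^esub>"
      by (auto simp: Hom_right_simps lhom_right_C[OF h] neg)
    ultimately show "\<exists>g\<in>carrier ?H. g \<oplus>\<^bsub>?H\<^esub> h = \<zero>\<^bsub>?H\<^esub>" by blast
  next
    fix h assume "h \<in> carrier ?H"
    then have h: "h \<in> ?L" by (simp add: Hom_right_simps)
    show "\<zero>\<^bsub>?H\<^esub> \<oplus>\<^bsub>?H\<^esub> h = h"
      by (rule extensionalityI[OF _ lhom_extensional[OF h]]) (auto simp: Hom_right_simps lhom_right_C[OF h])
  qed (auto simp: Hom_right_simps(1) intro: add_cl, auto simp: Hom_right_simps lhom_right_C C.M.add.m_ac)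
  then show ?thesis
  proof (rule left_moduleI[OF ring_R])
    fix h assume "h \<in> carrier ?H"
    then have h: "h \<in> ?L" by (simp add: Hom_right_simps)
    show "\<one>\<^bsub>R\<^esub> \<odot>\<^bsub>?H\<^esub> h = h"
      by (rule extensionalityI[OF _ lhom_extensional[OF h]]) (auto simp: Hom_right_simps lhom_right_C[OF h] C.smult_one)
  qed (auto simp: Hom_right_simps(1) intro: smult_cl,
      auto simp: Hom_right_simps lhom_right_C C.smult_closed C.smult_l_distr C.smult_r_distr C.smult_assoc)
qed

lemma finsum_right_mod:
  assumes "finite X" "\<And>x. x \<in> X \<Longrightarrow> f x \<in> carrier C"
  shows "finsum (right_mod C) f X = finsum C f X"
  using assms by (induction X rule: finite_induct) (auto simp: Pi_def)

text \<open>A tensor \<open>z\<close> in Q \<otimes> Hom(C, E) defines a functional on Hom_S(Q, C)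
  with values in \<open>E\<close>, sending \<open>g\<close> to \<open>ev_map E g z\<close>; for z =
  p \<otimes> h the value is h(g(p)).\<close>

definition ev_map :: "('r, 'e) module \<Rightarrow> ('q \<Rightarrow> 'c) \<Rightarrow> ('q \<times> ('c \<Rightarrow> 'e) \<Rightarrow>\<^sub>0 int) \<Rightarrow> 'e" where
  "ev_map E g z = msum E (tensor_eval (\<lambda>c h. h c) g z)"

text \<open>The x-th coordinate functional of \<open>Q\<close> followed by s \<mapsto> c s; for
  fixed \<open>x\<close> this embeds the elements of \<open>C\<close> as test homomorphisms Q
  \<rightarrow> C.\<close>

definition coord_map :: "('q \<Rightarrow> 'p \<Rightarrow> 's) \<Rightarrow> ('s, 'q) module \<Rightarrow> 'p \<Rightarrow> 'c \<Rightarrow> 'q \<Rightarrow> 'c" where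
  "coord_map \<phi> Q x c = (\<lambda>p\<in>carrier Q. rsmult C c (\<phi> p x))"

lemma coord_map_lhom:
  assumes \<phi>: "dual_basis (opposite_ring S) Q G \<phi>" and c: "c \<in> carrier C"
  shows "coord_map \<phi> Q x c \<in> lhom (opposite_ring S) Q (right_mod C)"
proof -
  have Q: "right_module S Q" and \<phi>h: "\<phi> \<in> lhom (opposite_ring S) Q (free_mod (opposite_ring S) G)"
    using \<phi> by (auto simp: dual_basis_def)
  have cl: "\<phi> p x \<in> carrier S" if "p \<in> carrier Q" for p
    using lhom_closed[OF \<phi>h that] by (simp add: mem_free_mod)
  show ?thesis
    unfolding coord_map_def
    by (rule lhom_restrictI[OF Q])
      (auto simp: cl c rsmult_closed lhom_add[OF \<phi>h] free_mod_add rsmult_distrib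
        lhom_smult[OF \<phi>h, simplified] free_mod_smult rsmult_assoc)
qed

lemma coord_map_R_linear:
  assumes \<phi>: "dual_basis (opposite_ring S) Q G \<phi>" and c: "c \<in> carrier C"
  shows "c' \<in> carrier C \<Longrightarrow> coord_map \<phi> Q x (c \<oplus>\<^bsub>C\<^esub> c') =
      coord_map \<phi> Q x c \<oplus>\<^bsub>Hom_right R S C Q\<^esub> coord_map \<phi> Q x c'"
    and "r \<in> carrier R \<Longrightarrow> coord_map \<phi> Q x (r \<odot>\<^bsub>C\<^esub> c) = r \<odot>\<^bsub>Hom_right R S C Q\<^esub> coord_map \<phi> Q x c"
proof -
  have \<phi>h: "\<phi> \<in> lhom (opposite_ring S) Q (free_mod (opposite_ring S) G)"
    using \<phi> by (auto simp: dual_basis_def)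
  have cl: "\<phi> p x \<in> carrier S" if "p \<in> carrier Q" for p
    using lhom_closed[OF \<phi>h that] by (simp add: mem_free_mod)
  show "c' \<in> carrier C \<Longrightarrow> coord_map \<phi> Q x (c \<oplus>\<^bsub>C\<^esub> c') =
      coord_map \<phi> Q x c \<oplus>\<^bsub>Hom_right R S C Q\<^esub> coord_map \<phi> Q x c'"
    using c by (auto simp: coord_map_def Hom_right_simps cl rsmult_add)
  show "r \<in> carrier R \<Longrightarrow> coord_map \<phi> Q x (r \<odot>\<^bsub>C\<^esub> c) = r \<odot>\<^bsub>Hom_right R S C Q\<^esub> coord_map \<phi> Q x c"
    using c by (auto simp: coord_map_def Hom_right_simps cl rsmult_smult)
qed

text \<open>Apply \<open>g\<close> to p = \<Sum> \<phi>(p, x) x. Finiteness of \<open>G\<close>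
  makes this one sum of homomorphisms, valid for all \<open>p\<close> at once.\<close>

lemma coord_map_expansion:
  assumes \<phi>: "dual_basis (opposite_ring S) Q G \<phi>" and G: "finite G"
    and g: "g \<in> lhom (opposite_ring S) Q (right_mod C)"
  shows "finsum (Hom_right R S C Q) (\<lambda>x. coord_map \<phi> Q x (g x)) G = g"
proof -
  let ?H = "Hom_right R S C Q"
  have Q: "right_module S Q" and \<phi>h: "\<phi> \<in> lhom (opposite_ring S) Q (free_mod (opposite_ring S) G)"
    and GQ: "G \<subseteq> carrier Q" and \<phi>p: "\<And>p. p \<in> carrier Q \<Longrightarrow> lin_comb (opposite_ring S) Q (\<phi> p) (\<lambda>x. x) = p"
    using \<phi> by (auto simp: dual_basis_def)
  interpret Q: left_module "opposite_ring S" Q by fact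
  interpret H: left_module R ?H by (rule left_module_Hom_right[OF Q])
  have cl: "\<phi> p x \<in> carrier S" if "p \<in> carrier Q" for p x
    using lhom_closed[OF \<phi>h that] by (simp add: mem_free_mod)
  have gx: "g x \<in> carrier C" if "x \<in> G" for x using lhom_right_C(1)[OF g] that GQ by auto
  have hom: "(\<lambda>x. coord_map \<phi> Q x (g x)) \<in> G \<rightarrow> carrier ?H"
    using coord_map_lhom[OF \<phi> gx] by (auto simp: Hom_right_simps)
  have sumH: "finsum ?H (\<lambda>x. coord_map \<phi> Q x (g x)) G \<in> lhom (opposite_ring S) Q (right_mod C)"
    using H.M.finsum_closed[OF hom] by (simp add: Hom_right_simps)
  show ?thesis
  proof (rule lhom_eqI[OF sumH g])
    fix p assume p: "p \<in> carrier Q"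
    have ev: "(\<lambda>g\<in>carrier ?H. g p) \<in> lhom R ?H C"
      by (rule lhom_restrictI[OF H.left_module_axioms])
        (use p in \<open>auto simp: Hom_right_simps lhom_right_C\<close>)
    have "finsum ?H (\<lambda>x. coord_map \<phi> Q x (g x)) G p
        = (\<lambda>g\<in>carrier ?H. g p) (finsum ?H (\<lambda>x. coord_map \<phi> Q x (g x)) G)"
      using H.M.finsum_closed[OF hom] by simp
    also have "\<dots> = finsum C (\<lambda>x. (\<lambda>g\<in>carrier ?H. g p) (coord_map \<phi> Q x (g x))) G"
      by (rule lhom_finsum[OF H.left_module_axioms left_C ev G hom])
    also have "\<dots> = finsum C (\<lambda>x. rsmult C (g x) (\<phi> p x)) G"
      by (rule C.M.finsum_cong')
        (use hom p gx cl in \<open>auto simp: Pi_iff coord_map_def rsmult_closed\<close>)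
    also have "\<dots> = finsum (right_mod C) (\<lambda>x. g (\<phi> p x \<odot>\<^bsub>Q\<^esub> x)) G"
    proof -
      have "finsum (right_mod C) (\<lambda>x. g (\<phi> p x \<odot>\<^bsub>Q\<^esub> x)) G = finsum (right_mod C) (\<lambda>x. rsmult C (g x) (\<phi> p x)) G"
        by (rule rC.M.finsum_cong')
          (use p cl gx GQ in \<open>auto simp: lhom_right_C(3)[OF g] rsmult_closed subset_iff\<close>)
      then show ?thesis
        using finsum_right_mod[OF G, of "\<lambda>x. rsmult C (g x) (\<phi> p x)"] cl[OF p] gx rsmult_closed by simp
    qed
    also have "\<dots> = g (finsum Q (\<lambda>x. \<phi> p x \<odot>\<^bsub>Q\<^esub> x) G)"
      by (rule lhom_finsum[OF Q right_C g G, symmetric])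
        (use p cl GQ Q.smult_closed in \<open>auto simp: subset_iff\<close>)
    also have "finsum Q (\<lambda>x. \<phi> p x \<odot>\<^bsub>Q\<^esub> x) G = lin_comb (opposite_ring S) Q (\<phi> p) (\<lambda>x. x)"
      by (rule Q.lin_comb_superset[OF lhom_closed[OF \<phi>h p] _ G _ order_refl, symmetric])
        (use GQ lhom_closed[OF \<phi>h p] in \<open>auto simp: mem_free_mod\<close>)
    also note \<phi>p[OF p]
    finally show "finsum ?H (\<lambda>x. coord_map \<phi> Q x (g x)) G p = g p" .
  qed
qed

section \<open>Duality between Q \<otimes> Hom(C, E) and Hom(Hom(Q, C), E)\<close>

section \<open>Exactness for injective coefficients\<close>

context
  fixes E :: "('r, 'e) module"
  assumes inj: "injective_module R E"
begin

lemma injective_left_module: "left_module R E"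
  using inj by (simp add: injective_module_def)

interpretation E: left_module R E by (rule injective_left_module)
interpretation pair: balanced_pairing R S "right_mod C" "Hom_from R C E" E "\<lambda>c h. h c"
  by (rule Hom_from_pairing[OF injective_left_module])

abbreviation tf where "tf Q \<equiv> frags (carrier Q \<times> lhom R C E)"

lemma ev_map_closed:
  assumes "g \<in> lhom (opposite_ring S) Q (right_mod C)" "z \<in> tf Q"
  shows "ev_map E g z \<in> carrier E"
  unfolding ev_map_def
  by (rule msum(2)[OF injective_left_module pair.tensor_eval_mem[OF assms(1)]]) (use assms(2) in \<open>simp add: Hom_from_simps\<close>)

lemma ev_map_diff:
  assumes "g \<in> lhom (opposite_ring S) Q (right_mod C)" "z \<in> tf Q" "w \<in> tf Q"
  shows "ev_map E g (z - w) = ev_map E g z \<ominus>\<^bsub>E\<^esub> ev_map E g w"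
  unfolding ev_map_def frag_extend_diff
  by (rule msum(4)[OF injective_left_module]) (use assms pair.tensor_eval_mem[OF assms(1)] in \<open>simp_all add: Hom_from_simps\<close>)

lemma ev_map_zero: "ev_map E g 0 = \<zero>\<^bsub>E\<^esub>"
  by (simp add: ev_map_def msum(3)[OF injective_left_module])

lemma ev_map_of:
  assumes "g \<in> lhom (opposite_ring S) Q (right_mod C)" "p \<in> carrier Q" "h \<in> lhom R C E"
  shows "ev_map E g (frag_of (p, h)) = h (g p)"
  using assms by (simp add: ev_map_def msum(1)[OF injective_left_module] lhom_closed[OF assms(3)] lhom_right_C(1))

lemma ev_map_relations:
  assumes "right_module S Q" "g \<in> lhom (opposite_ring S) Q (right_mod C)"
    "z \<in> tensor_relations S Q (Hom_from R C E)"
  shows "ev_map E g z = \<zero>\<^bsub>E\<^esub>"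
  using pair.tensor_eval_relations[OF assms] by (simp add: ev_map_def sum_relations_def)

lemma ev_map_sum:
  assumes g: "g \<in> lhom (opposite_ring S) Q (right_mod C)"
    and X: "finite X" "\<And>x. x \<in> X \<Longrightarrow> p x \<in> carrier Q" "\<And>x. x \<in> X \<Longrightarrow> h x \<in> lhom R C E"
  shows "ev_map E g (\<Sum>x\<in>X. frag_of (p x, h x)) = finsum E (\<lambda>x. h x (g (p x))) X"
  using X
proof (induction X rule: finite_induct)
  case empty
  then show ?case by (simp add: ev_map_zero)
next
  case (insert x X)
  let ?s = "\<Sum>x\<in>X. frag_of (p x, h x)"
  have s: "?s \<in> tf Q" "frag_of (p x, h x) \<in> tf Q"
    using insert by (auto simp: frag_of_mem_frags intro!: diff_closed_sum[OF diff_closed_frags])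
  have s': "frag_of (p x, h x) + ?s \<in> tf Q" by (rule diff_closed_add[OF diff_closed_frags s(2,1)])
  have "ev_map E g (frag_of (p x, h x)) = ev_map E g (frag_of (p x, h x) + ?s) \<ominus>\<^bsub>E\<^esub> ev_map E g ?s"
    using ev_map_diff[OF g s' s(1)] by simp
  then have "ev_map E g (frag_of (p x, h x) + ?s) = ev_map E g (frag_of (p x, h x)) \<oplus>\<^bsub>E\<^esub> ev_map E g ?s"
    using ev_map_closed[OF g s'] ev_map_closed[OF g s(1)]
    by (simp add: a_minus_def E.M.add.m_assoc E.M.l_neg)
  moreover have "h y (g (p y)) \<in> carrier E" if "y \<in> insert x X" for y
    by (rule lhom_closed[OF insert.prems(2) lhom_right_C(1)[OF g insert.prems(1)]]) (rule that)+
  then have "(\<lambda>x. h x (g (p x))) \<in> X \<rightarrow> carrier E" "h x (g (p x)) \<in> carrier E" by auto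
  ultimately show ?case
    using insert by (simp add: ev_map_of[OF g])
qed

lemma ev_map_add:
  assumes g: "g \<in> lhom (opposite_ring S) Q (right_mod C)" and g': "g' \<in> lhom (opposite_ring S) Q (right_mod C)"
    and Q: "right_module S Q" and z: "z \<in> tf Q"
  shows "ev_map E (g \<oplus>\<^bsub>Hom_right R S C Q\<^esub> g') z = ev_map E g z \<oplus>\<^bsub>E\<^esub> ev_map E g' z"
  using z
proof (induction rule: frags_induct)
  interpret H: left_module R "Hom_right R S C Q" by (rule left_module_Hom_right[OF Q])
  have gg: "g \<oplus>\<^bsub>Hom_right R S C Q\<^esub> g' \<in> lhom (opposite_ring S) Q (right_mod C)"
    using H.M.a_closed[of g g'] g g' by (simp add: Hom_right_simps(1))
  {
    case zero
    then show ?case by (simp add: ev_map_zero)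
  next
    case (of x)
    then show ?case
      by (auto simp: ev_map_of[OF gg] ev_map_of[OF g] ev_map_of[OF g'])
        (auto simp: Hom_right_simps lhom_right_C[OF g] lhom_right_C[OF g'] lhom_add)
  next
    case (diff u v)
    then show ?case
      using ev_map_closed[OF g] ev_map_closed[OF g']
      by (simp add: ev_map_diff[OF gg] ev_map_diff[OF g] ev_map_diff[OF g'] a_minus_def E.M.minus_add E.M.add.m_ac)
  }
qed

lemma ev_map_smult:
  assumes g: "g \<in> lhom (opposite_ring S) Q (right_mod C)" and r: "r \<in> carrier R"
    and Q: "right_module S Q" and z: "z \<in> tf Q"
  shows "ev_map E (r \<odot>\<^bsub>Hom_right R S C Q\<^esub> g) z = r \<odot>\<^bsub>E\<^esub> ev_map E g z"
  using z
proof (induction rule: frags_induct)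
  interpret H: left_module R "Hom_right R S C Q" by (rule left_module_Hom_right[OF Q])
  have gg: "r \<odot>\<^bsub>Hom_right R S C Q\<^esub> g \<in> lhom (opposite_ring S) Q (right_mod C)"
    using H.smult_closed[of r g] g r by (simp add: Hom_right_simps(1))
  {
    case zero
    then show ?case using r by (simp add: ev_map_zero E.smult_r_null)
  next
    case (of x)
    then show ?case
      using r by (auto simp: ev_map_of[OF gg] ev_map_of[OF g])
        (auto simp: Hom_right_simps lhom_right_C[OF g] lhom_smult)
  next
    case (diff u v)
    then show ?case
      using ev_map_closed[OF g] r
      by (simp add: ev_map_diff[OF gg] ev_map_diff[OF g] a_minus_def E.smult_r_distr E.smult_r_minus)
  }
qed

lemma ev_map_tmap:
  assumes d: "d \<in> lhom (opposite_ring S) Q' Q" and Q': "right_module S Q'"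
    and g: "g \<in> lhom (opposite_ring S) Q (right_mod C)" and z: "z \<in> tf Q'"
  shows "ev_map E g (tmap d (\<lambda>n. n) z) = ev_map E (compose (carrier Q') g d) z"
proof -
  have "tensor_eval (\<lambda>c h. h c) g (tmap d (\<lambda>n. n) z) = tensor_eval (\<lambda>c h. h c) (compose (carrier Q') g d) z"
    using z by (induction rule: frags_induct) (auto simp: frag_extend_diff compose_def)
  then show ?thesis by (simp add: ev_map_def)
qed

text \<open>The next two lemmas say that \<open>Q \<otimes> Hom(C, E) \<rightarrow> Hom(Hom(Q, C), E)\<close> is injective, respectively surjective.\<close>

lemma ev_map_injective:
  assumes Q: "projective_module (opposite_ring S) Q" and z: "z \<in> tf Q"
    and zero: "\<And>g. g \<in> lhom (opposite_ring S) Q (right_mod C) \<Longrightarrow> ev_map E g z = \<zero>\<^bsub>E\<^esub>"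
  shows "z \<in> tensor_relations S Q (Hom_from R C E)"
proof -
  obtain \<phi> where \<phi>: "dual_basis (opposite_ring S) Q (carrier Q) \<phi>"
    using projective_dual_basis_carrier[OF Q] .
  have \<phi>h: "\<phi> \<in> lhom (opposite_ring S) Q (free_mod (opposite_ring S) (carrier Q))"
    using \<phi> by (auto simp: dual_basis_def)
  have N: "left_module S (Hom_from R C E)" by (rule left_module_Hom_from[OF injective_left_module])
  obtain cc where cc: "\<And>x. tensor_coord S Q (Hom_from R C E) \<phi> x (cc x)"
    using tensor_coord_exists[OF \<phi> N] by metis
  have cl: "cc x v \<in> lhom R C E" if "v \<in> tf Q" for x v
    using cc[of x] that by (simp add: tensor_coord_def Hom_from_simps)
  have sub: "(a \<ominus>\<^bsub>Hom_from R C E\<^esub> b) c = a c \<ominus>\<^bsub>E\<^esub> b c" if "a \<in> lhom R C E" "b \<in> lhom R C E" "c \<in> carrier C" for a b c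
  proof -
    have *: "a \<in> carrier (Hom_from R C E)" "b \<in> carrier (Hom_from R C E)" using that by (auto simp: Hom_from_simps)
    then have m: "a \<ominus>\<^bsub>Hom_from R C E\<^esub> b \<in> lhom R C E"
      using pair.N.M.a_closed[OF _ pair.N.M.a_inv_closed, of a b] by (simp add: Hom_from_simps(1) a_minus_def)
    have "(a \<ominus>\<^bsub>Hom_from R C E\<^esub> b) \<oplus>\<^bsub>Hom_from R C E\<^esub> b = a"
      using * by (simp add: a_minus_def pair.N.M.add.m_assoc pair.N.M.l_neg)
    then have eq: "(a \<ominus>\<^bsub>Hom_from R C E\<^esub> b) c \<oplus>\<^bsub>E\<^esub> b c = a c"
      using that(3) by (simp add: Hom_from_simps(3) fun_eq_iff restrict_def split: if_splits)
    have "((a \<ominus>\<^bsub>Hom_from R C E\<^esub> b) c \<oplus>\<^bsub>E\<^esub> b c) \<oplus>\<^bsub>E\<^esub> \<ominus>\<^bsub>E\<^esub> b c = (a \<ominus>\<^bsub>Hom_from R C E\<^esub> b) c"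
      using lhom_closed[OF m that(3)] lhom_closed[OF that(2,3)] by (simp add: E.M.add.m_assoc E.M.r_neg)
    then show ?thesis
      unfolding eq by (simp add: a_minus_def[of E])
  qed
  \<comment> \<open>Each coordinate of a tensor, evaluated at \<open>c\<close>, is its evaluation at
    a test homomorphism, so vanishing of all evaluations forces all coordinates to vanish.\<close>
  have "cc x v c = ev_map E (coord_map \<phi> Q x c) v" if v: "v \<in> tf Q" and c: "c \<in> carrier C" for x v c
    using v
  proof (induction rule: frags_induct)
    case zero
    then show ?case using cc[of x] c by (simp add: tensor_coord_def Hom_from_simps ev_map_zero)
  next
    case (of ph)
    then obtain p h where ph: "ph = (p, h)" "p \<in> carrier Q" "h \<in> lhom R C E" by auto
    have "cc x (frag_of (p, h)) = \<phi> p x \<odot>\<^bsub>Hom_from R C E\<^esub> h"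
      using cc[of x] ph by (simp add: tensor_coord_def Hom_from_simps(1))
    then show ?case
      using ph c by (simp add: ev_map_of[OF coord_map_lhom[OF \<phi> c]]) (simp add: coord_map_def Hom_from_simps)
  next
    case (diff u v)
    have "cc x (u - v) = cc x u \<ominus>\<^bsub>Hom_from R C E\<^esub> cc x v"
      using cc[of x] diff.hyps by (simp add: tensor_coord_def Hom_from_simps(1))
    then show ?case
      using diff sub[OF cl[OF diff.hyps(1)] cl[OF diff.hyps(2)] c]
      by (simp add: ev_map_diff[OF coord_map_lhom[OF \<phi> c]])
  qed
  then have "cc x z = \<zero>\<^bsub>Hom_from R C E\<^esub>" for x
    using zero[OF coord_map_lhom[OF \<phi>]] z
    by (intro extensionalityI[OF lhom_extensional[OF cl[OF z]]]) (auto simp: Hom_from_simps)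
  then show ?thesis
    using tensor_coord_injective[OF \<phi> N cc] z by (simp add: Hom_from_simps(1))
qed

lemma ev_map_surjective:
  assumes Q: "projective_module (opposite_ring S) Q" and fg: "finitely_generated_module (opposite_ring S) Q"
    and \<Psi>: "\<Psi> \<in> lhom R (Hom_right R S C Q) E"
  shows "\<exists>z\<in>tf Q. \<forall>g\<in>lhom (opposite_ring S) Q (right_mod C). ev_map E g z = \<Psi> g"
proof -
  interpret Q: left_module "opposite_ring S" Q using Q by (simp add: projective_module_def)
  interpret H: left_module R "Hom_right R S C Q" by (rule left_module_Hom_right[OF Q.left_module_axioms])
  obtain G where G: "finite G" "G \<subseteq> carrier Q"
    and gen: "\<Inter>{N. submodule N (opposite_ring S) Q \<and> G \<subseteq> N} = carrier Q"
    using fg unfolding finitely_generated_module_def by blast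
  have "N = carrier Q" if "submodule N (opposite_ring S) Q" "G \<subseteq> N" for N
    using that gen Q.submoduleD(1)[OF that(1)] by blast
  then obtain \<phi> where \<phi>: "dual_basis (opposite_ring S) Q G \<phi>"
    using projective_dual_basis[OF Q G(2)] by blast
  \<comment> \<open>\<open>\<theta> x\<close> is \<Psi> seen through the x-th coordinate, a
    homomorphism C \<rightarrow> E; the sum of the x \<otimes> \<theta> x recovers \<Psi> by
    \<open>coord_map_expansion\<close>.\<close>
  define \<theta> where "\<theta> x = (\<lambda>c\<in>carrier C. \<Psi> (coord_map \<phi> Q x c))" for x
  have hc: "coord_map \<phi> Q x c \<in> carrier (Hom_right R S C Q)" if "c \<in> carrier C" for x c
    using coord_map_lhom[OF \<phi> that] by (simp add: Hom_right_simps(1))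
  have \<theta>: "\<theta> x \<in> lhom R C E" for x
    unfolding \<theta>_def
    by (rule lhom_restrictI[OF left_C])
      (auto simp: lhom_closed[OF \<Psi> hc] coord_map_R_linear[OF \<phi>] lhom_add[OF \<Psi> hc hc] lhom_smult[OF \<Psi> _ hc])
  let ?z = "\<Sum>x\<in>G. frag_of (x, \<theta> x)"
  have "?z \<in> tf Q"
    using G \<theta> by (intro diff_closed_sum[OF diff_closed_frags]) (auto simp: frag_of_mem_frags)
  moreover have "ev_map E g ?z = \<Psi> g" if g: "g \<in> lhom (opposite_ring S) Q (right_mod C)" for g
  proof -
    have gx: "g x \<in> carrier C" if "x \<in> G" for x using lhom_right_C(1)[OF g] that G(2) by auto
    have "ev_map E g ?z = finsum E (\<lambda>x. \<theta> x (g x)) G"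
      by (rule ev_map_sum[OF g G(1)]) (use G(2) \<theta> in auto)
    also have "\<dots> = finsum E (\<lambda>x. \<Psi> (coord_map \<phi> Q x (g x))) G"
      by (rule E.M.finsum_cong') (use gx lhom_closed[OF \<Psi> hc] in \<open>auto simp: \<theta>_def\<close>)
    also have "\<dots> = \<Psi> (finsum (Hom_right R S C Q) (\<lambda>x. coord_map \<phi> Q x (g x)) G)"
      by (rule lhom_finsum[OF H.left_module_axioms injective_left_module \<Psi> G(1), symmetric]) (use hc gx in auto)
    also have "\<dots> = \<Psi> g" by (simp add: coord_map_expansion[OF \<phi> G(1) g])
    finally show ?thesis .
  qed
  ultimately show ?thesis by blast
qed

text \<open>By \<open>cocycle\<close>, the functional of \<open>z\<close> on Hom(Q, C) vanishes on
  the kernel of g \<mapsto> g d, so it factors through the image in Hom(Q', C). Injectivity of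
  \<open>E\<close> extends it to Hom(Q', C), and since \<open>Q'\<close> is finitely generated the
  extension is the functional of some \<open>w\<close>.\<close>

lemma ev_map_boundary:
  assumes Q: "projective_module (opposite_ring S) Q" and Q': "projective_module (opposite_ring S) Q'"
    and fg: "finitely_generated_module (opposite_ring S) Q'"
    and d: "d \<in> lhom (opposite_ring S) Q' Q" and z: "z \<in> tf Q"
    and cocycle: "\<And>g. g \<in> lhom (opposite_ring S) Q (right_mod C) \<Longrightarrow> (\<And>x. x \<in> carrier Q' \<Longrightarrow> g (d x) = \<zero>\<^bsub>C\<^esub>) \<Longrightarrow>
      ev_map E g z = \<zero>\<^bsub>E\<^esub>"
  shows "\<exists>w\<in>tf Q'. z - tmap d (\<lambda>n. n) w \<in> tensor_relations S Q (Hom_from R C E)"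
proof -
  let ?L = "lhom (opposite_ring S) Q (right_mod C)" and ?H' = "Hom_right R S C Q'" and ?H = "Hom_right R S C Q"
  interpret Q: left_module "opposite_ring S" Q using Q by (simp add: projective_module_def)
  interpret Q': left_module "opposite_ring S" Q' using Q' by (simp add: projective_module_def)
  note QM = Q.left_module_axioms and QM' = Q'.left_module_axioms
  interpret H: left_module R ?H by (rule left_module_Hom_right[OF QM])
  interpret H': left_module R ?H' by (rule left_module_Hom_right[OF QM'])
  let ?c = "\<lambda>g. compose (carrier Q') g d"
  have c: "?c g \<in> lhom (opposite_ring S) Q' (right_mod C)" if "g \<in> ?L" for g
    by (rule lhom_compose[OF QM' d that])
  have add_cl: "g \<oplus>\<^bsub>?H\<^esub> g' \<in> ?L" if "g \<in> ?L" "g' \<in> ?L" for g g'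
    using H.M.a_closed[of g g'] that by (simp add: Hom_right_simps(1))
  have smult_cl: "r \<odot>\<^bsub>?H\<^esub> g \<in> ?L" if "r \<in> carrier R" "g \<in> ?L" for r g
    using H.smult_closed[of r g] that by (simp add: Hom_right_simps(1))
  \<comment> \<open>The graph of the factored functional on the image of g \<mapsto> g d; its
    single-valuedness is \<open>cocycle\<close>.\<close>
  let ?G = "{(?c g, ev_map E g z) | g. g \<in> ?L}"
  have "hom_graph R ?H' E ?G"
    unfolding hom_graph_def
  proof (intro conjI allI impI)
    show "?G \<subseteq> carrier ?H' \<times> carrier E"
      using c ev_map_closed[OF _ z] by (auto simp: Hom_right_simps(1))
  next
    have "\<zero>\<^bsub>?H\<^esub> \<in> ?L" using H.M.zero_closed by (simp add: Hom_right_simps(1))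
    moreover have "?c \<zero>\<^bsub>?H\<^esub> = \<zero>\<^bsub>?H'\<^esub>"
      by (auto simp: Hom_right_simps compose_def lhom_closed[OF d])
    moreover have "ev_map E \<zero>\<^bsub>?H\<^esub> z = \<zero>\<^bsub>E\<^esub>"
      using calculation(1) by (rule cocycle) (simp add: Hom_right_simps lhom_closed[OF d])
    ultimately show "(\<zero>\<^bsub>?H'\<^esub>, \<zero>\<^bsub>E\<^esub>) \<in> ?G" by force
  next
    fix y e y' e' assume "(y, e) \<in> ?G" "(y', e') \<in> ?G"
    then obtain g g' where g: "g \<in> ?L" "y = ?c g" "e = ev_map E g z" "g' \<in> ?L" "y' = ?c g'" "e' = ev_map E g' z"
      by auto
    have "?c g \<oplus>\<^bsub>?H'\<^esub> ?c g' = ?c (g \<oplus>\<^bsub>?H\<^esub> g')"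
      by (auto simp: Hom_right_simps compose_def lhom_closed[OF d])
    then show "(y \<oplus>\<^bsub>?H'\<^esub> y', e \<oplus>\<^bsub>E\<^esub> e') \<in> ?G"
      using g add_cl ev_map_add[OF g(1,4) QM z] by auto
  next
    fix r y e assume r: "r \<in> carrier R" and "(y, e) \<in> ?G"
    then obtain g where g: "g \<in> ?L" "y = ?c g" "e = ev_map E g z" by auto
    have "r \<odot>\<^bsub>?H'\<^esub> ?c g = ?c (r \<odot>\<^bsub>?H\<^esub> g)"
      by (auto simp: Hom_right_simps compose_def lhom_closed[OF d])
    then show "(r \<odot>\<^bsub>?H'\<^esub> y, r \<odot>\<^bsub>E\<^esub> e) \<in> ?G"
      using g r smult_cl ev_map_smult[OF g(1) r QM z] by auto
  next
    fix e assume "(\<zero>\<^bsub>?H'\<^esub>, e) \<in> ?G"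
    then obtain g where g: "g \<in> ?L" "\<zero>\<^bsub>?H'\<^esub> = ?c g" "e = ev_map E g z" by auto
    have "g (d x) = \<zero>\<^bsub>C\<^esub>" if "x \<in> carrier Q'" for x
      using fun_cong[OF g(2), of x] that by (simp add: Hom_right_simps compose_def)
    then show "e = \<zero>\<^bsub>E\<^esub>" using cocycle g by simp
  qed
  then obtain \<Psi> where \<Psi>: "\<Psi> \<in> lhom R ?H' E" "\<And>y e. (y, e) \<in> ?G \<Longrightarrow> \<Psi> y = e"
    using injective_extension[OF inj H'.left_module_axioms] by blast
  obtain w where w: "w \<in> tf Q'" "\<And>g. g \<in> lhom (opposite_ring S) Q' (right_mod C) \<Longrightarrow> ev_map E g w = \<Psi> g"
    using ev_map_surjective[OF Q' fg \<Psi>(1)] by blast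
  have dw: "tmap d (\<lambda>n. n) w \<in> tf Q" by (rule tmap_left_mem[OF d w(1)])
  have "z - tmap d (\<lambda>n. n) w \<in> tensor_relations S Q (Hom_from R C E)"
  proof (rule ev_map_injective[OF Q diff_closed_diff[OF diff_closed_frags z dw]])
    fix g assume g: "g \<in> ?L"
    have "ev_map E g (tmap d (\<lambda>n. n) w) = \<Psi> (?c g)"
      by (simp add: ev_map_tmap[OF d QM' g w(1)] w(2)[OF c[OF g]])
    also have "\<dots> = ev_map E g z" using \<Psi>(2) g by auto
    finally show "ev_map E g (z - tmap d (\<lambda>n. n) w) = \<zero>\<^bsub>E\<^esub>"
      using ev_map_closed[OF g z] by (simp add: ev_map_diff[OF g z dw] a_minus_def E.M.r_neg)
  qed
  then show ?thesis using w(1) by blast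
qed

end

end

section \<open>Semidualizing bimodules and exactness of \<open>X(E)\<close> for injective
  \<open>E\<close>\<close>

lemma lhom_factor:
  assumes A: "left_module R A" and B: "left_module R B" and D: "left_module R D"
    and q: "q \<in> lhom R A B" "q ` carrier A = carrier B" and g: "g \<in> lhom R A D"
    and ker: "\<And>x. x \<in> carrier A \<Longrightarrow> q x = \<zero>\<^bsub>B\<^esub> \<Longrightarrow> g x = \<zero>\<^bsub>D\<^esub>"
  shows "\<exists>\<gamma>\<in>lhom R B D. \<forall>x\<in>carrier A. \<gamma> (q x) = g x"
proof -
  interpret A: left_module R A by fact
  interpret B: left_module R B by fact
  interpret D: left_module R D by fact
  define \<gamma> where "\<gamma> y = g (inv_into (carrier A) q y)" for y
  have eq: "\<gamma> (q x) = g x" if x: "x \<in> carrier A" for x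
  proof -
    let ?s = "inv_into (carrier A) q (q x)"
    have s: "?s \<in> carrier A" "q ?s = q x"
      using x by (auto intro: inv_into_into f_inv_into_f)
    have "q (?s \<ominus>\<^bsub>A\<^esub> x) = \<zero>\<^bsub>B\<^esub>"
      using lhom_diff[OF A B q(1) s(1) x] s(2) B.M.r_neg[OF lhom_closed[OF q(1) x]] by (simp add: a_minus_def)
    then have "g ?s \<ominus>\<^bsub>D\<^esub> g x = \<zero>\<^bsub>D\<^esub>"
      using lhom_diff[OF A D g s(1) x] ker[of "?s \<ominus>\<^bsub>A\<^esub> x"] s(1) x by (simp add: a_minus_def)
    then show ?thesis
      using D.M.add.inv_equality[of "g ?s" "\<ominus>\<^bsub>D\<^esub> g x"] lhom_closed[OF g s(1)] lhom_closed[OF g x]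
      by (simp add: \<gamma>_def a_minus_def)
  qed
  have "(\<lambda>y\<in>carrier B. \<gamma> y) \<in> lhom R B D"
  proof (rule lhom_restrictI[OF B])
    fix x y assume "x \<in> carrier B" "y \<in> carrier B"
    then obtain a b where "a \<in> carrier A" "b \<in> carrier A" "x = q a" "y = q b"
      unfolding q(2)[symmetric] by blast
    then show "\<gamma> (x \<oplus>\<^bsub>B\<^esub> y) = \<gamma> x \<oplus>\<^bsub>D\<^esub> \<gamma> y"
      using eq[of "a \<oplus>\<^bsub>A\<^esub> b"] by (simp add: lhom_add[OF q(1)] lhom_add[OF g] eq)
  next
    fix r x assume "r \<in> carrier R" "x \<in> carrier B"
    moreover from this obtain a where "a \<in> carrier A" "x = q a"
      unfolding q(2)[symmetric] by blast
    ultimately show "\<gamma> (r \<odot>\<^bsub>B\<^esub> x) = r \<odot>\<^bsub>D\<^esub> \<gamma> x"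
      using eq[of "r \<odot>\<^bsub>A\<^esub> a"] by (simp add: lhom_smult[OF q(1)] lhom_smult[OF g] eq A.smult_closed)
  next
    fix x assume "x \<in> carrier B"
    then obtain a where "a \<in> carrier A" "x = q a"
      unfolding q(2)[symmetric] by blast
    then show "\<gamma> x \<in> carrier D" by (simp add: eq lhom_closed[OF g])
  qed
  then show ?thesis
    using eq lhom_closed[OF q(1)] by (intro bexI[of _ "\<lambda>y\<in>carrier B. \<gamma> y"]) auto
qed

text \<open>Fixes the resolution that \<open>proj_res\<close> picks, so that \<open>Tor\<close> and
  \<open>Ext_group\<close> refer to the same \<open>P\<close> and \<open>d\<close> throughout. Its
  terms need not be finitely generated.\<close>

locale semidualizing_bimodule =
  fixes R :: "'r ring" and S :: "'s ring" and C :: "('r, 's, 'c) bimodule"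
    and P :: "nat \<Rightarrow> ('s, ('s, 'c) res_elem) module" and \<epsilon> d
  assumes semidualizing: "semidualizing R S C"
    and proj_res_eq: "proj_res (opposite_ring S) (right_mod C) = (P, d)"
    and resolution: "projective_resolution (opposite_ring S) (right_mod C) P \<epsilon> d"
begin

sublocale bimod R S C
  using semidualizing by unfold_locales (simp add: semidualizing_def)

sublocale P: proj_resolution "opposite_ring S" "right_mod C" P \<epsilon> d
  by unfold_locales (rule resolution)

abbreviation Hom_exact :: "('r, 'k) module \<Rightarrow> nat \<Rightarrow> bool" where
  "Hom_exact K \<equiv> aug_exact S P \<epsilon> d (Hom_from R C K) K (\<lambda>c h. h c)"

lemma endomorphism_homothety:
  assumes "\<gamma> \<in> lhom (opposite_ring S) (right_mod C) (right_mod C)"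
  shows "\<exists>r\<in>carrier R. \<forall>c\<in>carrier C. \<gamma> c = r \<odot>\<^bsub>C\<^esub> c"
proof -
  have "\<gamma> \<in> (\<lambda>r. \<lambda>c\<in>carrier C. r \<odot>\<^bsub>C\<^esub> c) ` carrier R"
    using semidualizing assms unfolding semidualizing_def bij_betw_def by (simp only:)
  then show ?thesis by auto
qed

lemma faithful:
  assumes "r \<in> carrier R" "\<And>c. c \<in> carrier C \<Longrightarrow> r \<odot>\<^bsub>C\<^esub> c = \<zero>\<^bsub>C\<^esub>"
  shows "r = \<zero>\<^bsub>R\<^esub>"
proof (rule inj_onD)
  show "inj_on (\<lambda>r. \<lambda>c\<in>carrier C. r \<odot>\<^bsub>C\<^esub> c) (carrier R)"
    using semidualizing unfolding semidualizing_def bij_betw_def by (simp only:)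
  show "(\<lambda>c\<in>carrier C. r \<odot>\<^bsub>C\<^esub> c) = (\<lambda>c\<in>carrier C. \<zero>\<^bsub>R\<^esub> \<odot>\<^bsub>C\<^esub> c)"
    by (rule restrict_ext) (simp add: assms C.smult_l_null)
qed (use assms in auto)

text \<open>The duality is applied to a resolution \<open>Q\<close> with finitely generated terms,
  and the result is transferred to \<open>P\<close> at the end.\<close>

lemma Hom_exact_injective:
  fixes E :: "('r, 'e) module"
  assumes inj: "injective_module R E"
  shows "Hom_exact E k"
proof -
  obtain Q :: "nat \<Rightarrow> ('s, ('s, 'c) res_elem) module" and \<epsilon>' d'
    where resQ: "projective_resolution (opposite_ring S) (right_mod C) Q \<epsilon>' d'"
    and fg: "\<And>i. finitely_generated_module (opposite_ring S) (Q i)"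
    using semidualizing unfolding semidualizing_def has_fg_projective_resolution_def by blast
  have E: "left_module R E" by (rule injective_left_module[OF inj])
  interpret E: left_module R E by (rule E)
  interpret Q: augmented_complex R S "right_mod C" "Hom_from R C E" E "\<lambda>c h. h c" Q \<epsilon>' d'
    by (intro augmented_complex.intro Hom_from_pairing E proj_resolution.intro resQ)
  let ?H = "Hom_right R S C (Q 0)"
  interpret H: left_module R ?H by (rule left_module_Hom_right[OF Q.P])
  have \<epsilon>H: "\<epsilon>' \<in> carrier ?H" using Q.\<epsilon> by (simp add: Hom_right_simps(1))
  \<comment> \<open>Hom(Q, C) is exact in positive degrees: the vanishing of Ext_S(C, C), moved from
    \<open>P\<close> to \<open>Q\<close>.\<close>
  have ext: "\<exists>w\<in>lhom (opposite_ring S) (Q j) (right_mod C). \<forall>x\<in>carrier (Q (Suc j)). g x = w (d' j x)"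
    if g: "g \<in> lhom (opposite_ring S) (Q (Suc j)) (right_mod C)"
      "\<And>x. x \<in> carrier (Q (Suc (Suc j))) \<Longrightarrow> g (d' (Suc j) x) = \<zero>\<^bsub>C\<^esub>" for g j
  proof (rule cocycle_transfer[OF resolution resQ right_C])
    have tr: "trivial_group (Ext_group (opposite_ring S) (right_mod C) (right_mod C) (Suc j))"
      using semidualizing unfolding semidualizing_def by simp
    show "\<exists>w\<in>lhom (opposite_ring S) (P j) (right_mod C). \<forall>x\<in>carrier (P (Suc j)). g x = w (d j x)"
      if "g \<in> lhom (opposite_ring S) (P (Suc j)) (right_mod C)"
        "\<And>x. x \<in> carrier (P (Suc (Suc j))) \<Longrightarrow> g (d (Suc j) x) = \<zero>\<^bsub>right_mod C\<^esub>" for g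
      by (rule Ext_trivialD[OF P.proj_resolution_axioms proj_res_eq right_C tr that])
  qed (use g in auto)
  \<comment> \<open>In degree 0 a cocycle factors through an endomorphism of \<open>C\<close> over
    \<open>S\<close>, which is a homothety; so the cocycles are the multiples of
    \<epsilon>'.\<close>
  have ext0: "\<exists>r\<in>carrier R. g = r \<odot>\<^bsub>?H\<^esub> \<epsilon>'"
    if g: "g \<in> lhom (opposite_ring S) (Q 0) (right_mod C)" "\<And>x. x \<in> carrier (Q (Suc 0)) \<Longrightarrow> g (d' 0 x) = \<zero>\<^bsub>C\<^esub>"
    for g
  proof -
    have "\<exists>\<gamma>\<in>lhom (opposite_ring S) (right_mod C) (right_mod C). \<forall>x\<in>carrier (Q 0). \<gamma> (\<epsilon>' x) = g x"
    proof (rule lhom_factor[OF Q.P right_C right_C Q.\<epsilon> Q.\<epsilon>_surj g(1)])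
      fix x assume "x \<in> carrier (Q 0)" "\<epsilon>' x = \<zero>\<^bsub>right_mod C\<^esub>"
      then have "x \<in> d' 0 ` carrier (Q (Suc 0))" unfolding Q.image_d0 mem_a_kernel by simp
      then show "g x = \<zero>\<^bsub>right_mod C\<^esub>" using g(2) by auto
    qed
    then obtain \<gamma> where \<gamma>: "\<gamma> \<in> lhom (opposite_ring S) (right_mod C) (right_mod C)"
      "\<And>x. x \<in> carrier (Q 0) \<Longrightarrow> \<gamma> (\<epsilon>' x) = g x" by blast
    obtain r where r: "r \<in> carrier R" "\<And>c. c \<in> carrier C \<Longrightarrow> \<gamma> c = r \<odot>\<^bsub>C\<^esub> c"
      using endomorphism_homothety[OF \<gamma>(1)] by blast
    have "g = r \<odot>\<^bsub>?H\<^esub> \<epsilon>'"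
      by (rule extensionalityI[OF lhom_extensional[OF g(1)]])
        (use \<gamma>(2) r(2) lhom_right_C(1)[OF Q.\<epsilon>] in \<open>auto simp: Hom_right_simps\<close>)
    then show ?thesis using r(1) by blast
  qed
  have "aug_exact S Q \<epsilon>' d' (Hom_from R C E) E (\<lambda>c h. h c) k"
  proof (cases k rule: nat_cases3)
    case 1
    show ?thesis
      unfolding aug_exact_def 1 Q.exact_at_0_iff
    proof
      fix v assume v: "v \<in> frags (carrier E)"
      let ?x = "msum E v"
      have x: "?x \<in> carrier E" by (rule msum(2)[OF E v])
      \<comment> \<open>The partial functional r \<epsilon>' \<mapsto> r x. It is well defined
        because \<open>C\<close> is faithful over \<open>R\<close>, and a tensor realizing its
        extension evaluates at \<epsilon>' to \<open>?x\<close>.\<close>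
      let ?G = "{(r \<odot>\<^bsub>?H\<^esub> \<epsilon>', r \<odot>\<^bsub>E\<^esub> ?x) | r. r \<in> carrier R}"
      have GI: "(r \<odot>\<^bsub>?H\<^esub> \<epsilon>', r \<odot>\<^bsub>E\<^esub> ?x) \<in> ?G" if "r \<in> carrier R" for r using that by blast
      have "hom_graph R ?H E ?G"
        unfolding hom_graph_def
      proof (intro conjI allI impI)
        show "?G \<subseteq> carrier ?H \<times> carrier E"
          using x \<epsilon>H by (auto intro: H.smult_closed E.smult_closed)
        show "(\<zero>\<^bsub>?H\<^esub>, \<zero>\<^bsub>E\<^esub>) \<in> ?G"
          using GI[of "\<zero>\<^bsub>R\<^esub>"] x \<epsilon>H by (simp add: H.smult_l_null E.smult_l_null)
      next
        fix y e y' e' assume "(y, e) \<in> ?G" "(y', e') \<in> ?G"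
        then obtain r r' where "r \<in> carrier R" "y = r \<odot>\<^bsub>?H\<^esub> \<epsilon>'" "e = r \<odot>\<^bsub>E\<^esub> ?x"
          "r' \<in> carrier R" "y' = r' \<odot>\<^bsub>?H\<^esub> \<epsilon>'" "e' = r' \<odot>\<^bsub>E\<^esub> ?x" by auto
        then show "(y \<oplus>\<^bsub>?H\<^esub> y', e \<oplus>\<^bsub>E\<^esub> e') \<in> ?G"
          using GI[of "r \<oplus>\<^bsub>R\<^esub> r'"] x \<epsilon>H by (simp add: H.smult_l_distr E.smult_l_distr)
      next
        fix s y e assume s: "s \<in> carrier R" and "(y, e) \<in> ?G"
        then obtain r where "r \<in> carrier R" "y = r \<odot>\<^bsub>?H\<^esub> \<epsilon>'" "e = r \<odot>\<^bsub>E\<^esub> ?x" by auto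
        then show "(s \<odot>\<^bsub>?H\<^esub> y, s \<odot>\<^bsub>E\<^esub> e) \<in> ?G"
          using GI[of "s \<otimes>\<^bsub>R\<^esub> r"] s x \<epsilon>H by (simp add: H.smult_assoc E.smult_assoc)
      next
        fix e assume "(\<zero>\<^bsub>?H\<^esub>, e) \<in> ?G"
        then obtain r where r: "r \<in> carrier R" "\<zero>\<^bsub>?H\<^esub> = r \<odot>\<^bsub>?H\<^esub> \<epsilon>'" "e = r \<odot>\<^bsub>E\<^esub> ?x" by auto
        have "r \<odot>\<^bsub>C\<^esub> c = \<zero>\<^bsub>C\<^esub>" if "c \<in> carrier C" for c
        proof -
          have "c \<in> \<epsilon>' ` carrier (Q 0)" using that by (simp add: Q.\<epsilon>_surj)
          then obtain p where "p \<in> carrier (Q 0)" "c = \<epsilon>' p" by blast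
          then show ?thesis using fun_cong[OF r(2), of p] by (simp add: Hom_right_simps)
        qed
        then have "r = \<zero>\<^bsub>R\<^esub>" by (rule faithful[OF r(1)])
        then show "e = \<zero>\<^bsub>E\<^esub>" using r(3) x by (simp add: E.smult_l_null)
      qed
      then obtain \<Psi> where \<Psi>: "\<Psi> \<in> lhom R ?H E" "\<And>y e. (y, e) \<in> ?G \<Longrightarrow> \<Psi> y = e"
        using injective_extension[OF inj H.left_module_axioms] by blast
      obtain u where u: "u \<in> frags (carrier (Q 0) \<times> lhom R C E)" "ev_map E \<epsilon>' u = \<Psi> \<epsilon>'"
        using ev_map_surjective[OF inj Q.proj fg \<Psi>(1)] Q.\<epsilon> by blast
      have "\<Psi> \<epsilon>' = ?x"
        using \<Psi>(2)[OF GI[of "\<one>\<^bsub>R\<^esub>"]] \<epsilon>H x by (simp add: H.smult_one E.smult_one)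
      then have *: "msum E (tensor_eval (\<lambda>c h. h c) \<epsilon>' u) = ?x" using u(2) by (simp add: ev_map_def)
      have u': "u \<in> frags (carrier (Q 0) \<times> carrier (Hom_from R C E))" using u(1) by (simp add: Hom_from_simps(1))
      have "v - tensor_eval (\<lambda>c h. h c) \<epsilon>' u \<in> sum_relations E"
        using v x Q.tensor_eval_mem[OF Q.\<epsilon> u'] *
        by (simp add: sum_relations_def diff_closed_diff[OF diff_closed_frags] msum(4)[OF E] a_minus_def E.M.r_neg)
      with u' show "\<exists>u\<in>frags (carrier (Q 0) \<times> carrier (Hom_from R C E)).
          v - tensor_eval (\<lambda>c h. h c) \<epsilon>' u \<in> sum_relations E" by blast
    qed
  next
    case 2
    show ?thesis
      unfolding aug_exact_def 2 Q.exact_at_1_iff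
    proof (intro ballI impI)
      fix z assume "z \<in> frags (carrier (Q 0) \<times> carrier (Hom_from R C E))"
        and z0: "tensor_eval (\<lambda>c h. h c) \<epsilon>' z \<in> sum_relations E"
      then have z: "z \<in> frags (carrier (Q 0) \<times> lhom R C E)" by (simp add: Hom_from_simps(1))
      \<comment> \<open>Cocycles are multiples of \<epsilon>', at which \<open>z\<close> evaluates
        to zero by \<open>z0\<close>.\<close>
      have "ev_map E g z = \<zero>\<^bsub>E\<^esub>"
        if g: "g \<in> lhom (opposite_ring S) (Q 0) (right_mod C)" "\<And>x. x \<in> carrier (Q (Suc 0)) \<Longrightarrow> g (d' 0 x) = \<zero>\<^bsub>C\<^esub>"
        for g
      proof -
        obtain r where r: "r \<in> carrier R" "g = r \<odot>\<^bsub>?H\<^esub> \<epsilon>'" using ext0[OF g] by blast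
        have "ev_map E g z = r \<odot>\<^bsub>E\<^esub> ev_map E \<epsilon>' z"
          unfolding r(2) by (rule ev_map_smult[OF inj Q.\<epsilon> r(1) Q.P z])
        also have "ev_map E \<epsilon>' z = \<zero>\<^bsub>E\<^esub>" using z0 by (simp add: ev_map_def sum_relations_def)
        finally show ?thesis using r(1) by (simp add: E.smult_r_null)
      qed
      then show "\<exists>w\<in>frags (carrier (Q (Suc 0)) \<times> carrier (Hom_from R C E)).
          z - tmap (d' 0) (\<lambda>n. n) w \<in> tensor_relations S (Q 0) (Hom_from R C E)"
        unfolding Hom_from_simps(1) by (rule ev_map_boundary[OF inj Q.proj Q.proj fg Q.d z])
    qed
  next
    case (3 j)
    show ?thesis
      unfolding aug_exact_def 3 Q.exact_at_Suc_iff
    proof (intro ballI impI)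
      fix z assume "z \<in> frags (carrier (Q (Suc j)) \<times> carrier (Hom_from R C E))"
        and z0: "tmap (d' j) (\<lambda>n. n) z \<in> tensor_relations S (Q j) (Hom_from R C E)"
      then have z: "z \<in> frags (carrier (Q (Suc j)) \<times> lhom R C E)" by (simp add: Hom_from_simps(1))
      \<comment> \<open>A cocycle is some \<open>w\<close> composed with \<open>d' j\<close>, so
        evaluating \<open>z\<close> at it is evaluating the boundary of \<open>z\<close> at
        \<open>w\<close>, and this boundary is a relation.\<close>
      have "ev_map E g z = \<zero>\<^bsub>E\<^esub>"
        if g: "g \<in> lhom (opposite_ring S) (Q (Suc j)) (right_mod C)"
          "\<And>x. x \<in> carrier (Q (Suc (Suc j))) \<Longrightarrow> g (d' (Suc j) x) = \<zero>\<^bsub>C\<^esub>" for g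
      proof -
        obtain w where w: "w \<in> lhom (opposite_ring S) (Q j) (right_mod C)"
          "\<And>x. x \<in> carrier (Q (Suc j)) \<Longrightarrow> g x = w (d' j x)" using ext[OF g] by blast
        have "g = compose (carrier (Q (Suc j))) w (d' j)"
          by (rule extensionalityI[OF lhom_extensional[OF g(1)]]) (auto simp: compose_def w(2))
        then have "ev_map E g z = ev_map E w (tmap (d' j) (\<lambda>n. n) z)"
          by (simp add: ev_map_tmap[OF inj Q.d Q.P w(1) z])
        also have "\<dots> = \<zero>\<^bsub>E\<^esub>" by (rule ev_map_relations[OF inj Q.P w(1) z0])
        finally show ?thesis .
      qed
      then show "\<exists>w\<in>frags (carrier (Q (Suc (Suc j))) \<times> carrier (Hom_from R C E)).
          z - tmap (d' (Suc j)) (\<lambda>n. n) w \<in> tensor_relations S (Q (Suc j)) (Hom_from R C E)"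
        unfolding Hom_from_simps(1) by (rule ev_map_boundary[OF inj Q.proj Q.proj fg Q.d z])
    qed
  qed
  then show ?thesis
    by (rule aug_exact_transfer[OF Hom_from_pairing[OF E] resolution resQ])
qed

end

section \<open>Dimension shifting along an injective resolution\<close>

section \<open>Cosyzygies\<close>

text \<open>The augmentation is the inclusion of the image of \<open>f m\<close>, which is the
  kernel of \<open>f (Suc m)\<close> by exactness. Results on one module thus apply to all its
  cosyzygies.\<close>

lemma injective_resolution_truncate:
  assumes "injective_resolution R M I \<eta> f"
  shows "injective_resolution R (cosyzygy I f (Suc m)) (\<lambda>j. I (Suc m + j))
    (\<lambda>x\<in>carrier (cosyzygy I f (Suc m)). x) (\<lambda>j. f (Suc m + j))"
proof -
  have inj: "\<And>i. injective_module R (I i)" and f: "\<And>i. f i \<in> lhom R (I i) (I (Suc i))"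
    and im: "\<And>i. f i ` carrier (I i) = a_kernel (I (Suc i)) (I (Suc (Suc i))) (f (Suc i))"
    using assms by (auto simp: injective_resolution_def)
  have I: "left_module R (I i)" for i using inj[of i] by (simp add: injective_module_def)
  have sub: "submodule (f m ` carrier (I m)) R (I (Suc m))"
    by (rule submodule_image[OF I I f])
  show ?thesis
    unfolding injective_resolution_def cosyzygy_def
    using inj f im left_module.submodule_left_module[OF I sub] inclusion_lhom[OF I sub]
    by (auto simp: inj_on_def)
qed

text \<open>The new augmentation has the same image as \<open>f m\<close>, whose essentiality is
  part of the minimality of the given resolution.\<close>

lemma minimal_injective_resolution_truncate:
  assumes "minimal_injective_resolution R M I \<eta> f"
  shows "minimal_injective_resolution R (cosyzygy I f (Suc m)) (\<lambda>j. I (Suc m + j))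
    (\<lambda>x\<in>carrier (cosyzygy I f (Suc m)). x) (\<lambda>j. f (Suc m + j))"
  using assms injective_resolution_truncate[of R M I \<eta> f m]
  unfolding minimal_injective_resolution_def by (simp add: cosyzygy_def)

context semidualizing_bimodule
begin

text \<open>The augmented complex of the image of Hom(C, I 0) in Hom(C, I 1), paired with the first
  cosyzygy. This image may be smaller than Hom(C, co\<Omega> K); the quotient is Ext^1(C,
  K).\<close>

abbreviation image_exact :: "(nat \<Rightarrow> ('r, 'e) module) \<Rightarrow> (nat \<Rightarrow> 'e \<Rightarrow> 'e) \<Rightarrow> nat \<Rightarrow> bool" where
  "image_exact I f \<equiv> aug_exact S P \<epsilon> d
    ((Hom_from R C (I (Suc 0)))\<lparr>carrier := Hom_from_map C (f 0) ` carrier (Hom_from R C (I 0))\<rparr>)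
    (cosyzygy I f (Suc 0)) (\<lambda>c h. h c)"

context
  fixes K :: "('r, 'a) module" and I :: "nat \<Rightarrow> ('r, 'e) module" and \<eta> :: "'a \<Rightarrow> 'e" and f :: "nat \<Rightarrow> 'e \<Rightarrow> 'e"
  assumes inj_res: "injective_resolution R K I \<eta> f"
begin

lemma source_module: "left_module R K" and term_injective: "injective_module R (I i)" and term_module: "left_module R (I i)"
  and augmentation: "\<eta> \<in> lhom R K (I 0)" "inj_on \<eta> (carrier K)" "\<eta> ` carrier K = a_kernel (I 0) (I (Suc 0)) (f 0)"
  and differential: "f i \<in> lhom R (I i) (I (Suc i))"
  and image_differential: "f i ` carrier (I i) = a_kernel (I (Suc i)) (I (Suc (Suc i))) (f (Suc i))"
  using inj_res by (auto simp: injective_resolution_def injective_module_def)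

text \<open>Left exactness of Hom(C, -): a homomorphism into the kernel of \<open>f 0\<close> lifts
  uniquely along the injective \<eta>. \<open>restrict\<close> appears because \<open>lhom\<close>
  consists of extensional maps.\<close>

lemma Hom_from_map_kernel:
  "restrict (Hom_from_map C \<eta>) (lhom R C K) ` carrier (Hom_from R C K)
    = a_kernel (Hom_from R C (I 0)) (Hom_from R C (I (Suc 0))) (restrict (Hom_from_map C (f 0)) (lhom R C (I 0)))"
    (is "?L = ?R")
proof
  show "?L \<subseteq> ?R"
  proof safe
    fix h assume "h \<in> carrier (Hom_from R C K)"
    then have h: "h \<in> lhom R C K" by (simp add: Hom_from_simps(1))
    have "f 0 (\<eta> x) = \<zero>\<^bsub>I (Suc 0)\<^esub>" if "x \<in> carrier K" for x
      using imageI[OF that, of \<eta>] unfolding augmentation(3) mem_a_kernel by simp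
    then show "restrict (Hom_from_map C \<eta>) (lhom R C K) h \<in> ?R"
      using h lhom_compose[OF left_C h augmentation(1)] lhom_closed[OF h]
      by (auto simp: mem_a_kernel Hom_from_simps Hom_from_map_def compose_def)
  qed
  show "?R \<subseteq> ?L"
  proof
    fix h assume "h \<in> ?R"
    then have h: "h \<in> lhom R C (I 0)" and "Hom_from_map C (f 0) h = (\<lambda>c\<in>carrier C. \<zero>\<^bsub>I (Suc 0)\<^esub>)"
      by (auto simp: mem_a_kernel Hom_from_simps)
    then have "f 0 (h c) = \<zero>\<^bsub>I (Suc 0)\<^esub>" if "c \<in> carrier C" for c
      using that by (auto simp: Hom_from_map_def compose_def fun_eq_iff restrict_def split: if_splits)
    then have hc: "h c \<in> \<eta> ` carrier K" if "c \<in> carrier C" for c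
      unfolding augmentation(3) mem_a_kernel using lhom_closed[OF h that] that by simp
    define k where "k c = inv_into (carrier K) \<eta> (h c)" for c
    have k: "k c \<in> carrier K" "\<eta> (k c) = h c" if "c \<in> carrier C" for c
      using hc[OF that] by (auto simp: k_def inv_into_into f_inv_into_f)
    interpret K: left_module R K by (rule source_module)
    have "(\<lambda>c\<in>carrier C. k c) \<in> lhom R C K"
    proof (rule lhom_restrictI[OF left_C])
      show "k c \<in> carrier K" if "c \<in> carrier C" for c by (rule k(1)[OF that])
      show "k (c \<oplus>\<^bsub>C\<^esub> c') = k c \<oplus>\<^bsub>K\<^esub> k c'" if "c \<in> carrier C" "c' \<in> carrier C" for c c'
        by (rule inj_onD[OF augmentation(2)]) (simp_all add: that k lhom_add[OF augmentation(1)] lhom_add[OF h])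
      show "k (r \<odot>\<^bsub>C\<^esub> c) = r \<odot>\<^bsub>K\<^esub> k c" if "r \<in> carrier R" "c \<in> carrier C" for r c
        by (rule inj_onD[OF augmentation(2)])
          (simp_all add: that k lhom_smult[OF augmentation(1)] lhom_smult[OF h] C.smult_closed K.smult_closed)
    qed
    moreover have "Hom_from_map C \<eta> (\<lambda>c\<in>carrier C. k c) = h"
      by (rule extensionalityI[OF _ lhom_extensional[OF h]]) (auto simp: Hom_from_map_def compose_def k)
    ultimately show "h \<in> ?L"
      by (intro image_eqI[of _ _ "\<lambda>c\<in>carrier C. k c"]) (simp_all add: Hom_from_simps(1))
  qed
qed

text \<open>The first degree shift, with the exact complex X(I 0) in the middle. At index 0 nothing
  is asked of \<open>K\<close>, because surjectivity passes to the quotient.\<close>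

lemma image_exact_iff: "image_exact I f 0" "image_exact I f (Suc k) \<longleftrightarrow> Hom_exact K k"
proof -
  interpret ses: pairing_ses R S "right_mod C" "Hom_from R C K" K "\<lambda>c h. h c" "Hom_from R C (I 0)" "I 0" "\<lambda>c h. h c"
    "(Hom_from R C (I (Suc 0)))\<lparr>carrier := restrict (Hom_from_map C (f 0)) (lhom R C (I 0)) ` carrier (Hom_from R C (I 0))\<rparr>"
    "(I (Suc 0))\<lparr>carrier := f 0 ` carrier (I 0)\<rparr>" "\<lambda>c h. h c"
    "restrict (Hom_from_map C \<eta>) (lhom R C K)" \<eta> "restrict (Hom_from_map C (f 0)) (lhom R C (I 0))" "f 0"
  proof (rule kernel_image_ses[OF Hom_from_pairing[OF source_module] Hom_from_pairing[OF term_module] Hom_from_pairing[OF term_module]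
        Hom_from_map_lhom[OF source_module term_module augmentation(1)] _ Hom_from_map_kernel augmentation Hom_from_map_lhom[OF term_module term_module differential] differential])
    show "inj_on (restrict (Hom_from_map C \<eta>) (lhom R C K)) (carrier (Hom_from R C K))"
    proof (rule inj_onI)
      fix g h assume "g \<in> carrier (Hom_from R C K)" "h \<in> carrier (Hom_from R C K)"
        and eq: "restrict (Hom_from_map C \<eta>) (lhom R C K) g = restrict (Hom_from_map C \<eta>) (lhom R C K) h"
      then have gh: "g \<in> lhom R C K" "h \<in> lhom R C K" by (auto simp: Hom_from_simps(1))
      show "g = h"
      proof (rule lhom_eqI[OF gh])
        fix c assume c: "c \<in> carrier C"
        have "\<eta> (g c) = \<eta> (h c)"
          using fun_cong[OF eq, of c] gh c by (simp add: Hom_from_map_def compose_def)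
        then show "g c = h c"
          using inj_onD[OF augmentation(2)] lhom_closed[OF gh(1) c] lhom_closed[OF gh(2) c] by simp
      qed
    qed
  qed (auto simp: Hom_from_simps(1) Hom_from_map_def compose_def)
  have eq: "restrict (Hom_from_map C (f 0)) (lhom R C (I 0)) ` carrier (Hom_from R C (I 0))
      = Hom_from_map C (f 0) ` carrier (Hom_from R C (I 0))"
    by (auto simp: Hom_from_simps(1))
  have eq': "(I (Suc 0))\<lparr>carrier := f 0 ` carrier (I 0)\<rparr> = cosyzygy I f (Suc 0)"
    by (simp add: cosyzygy_def)
  note les = ses.aug_exact_ses[OF resolution, unfolded eq eq']
  show "image_exact I f 0"
    by (rule les(2)[OF Hom_exact_injective[OF term_injective]])
  show "image_exact I f (Suc k) \<longleftrightarrow> Hom_exact K k"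
    using les(3)[OF Hom_exact_injective[OF term_injective]] les(4)[OF _ Hom_exact_injective[OF term_injective]] by (rule iffI[rotated])
qed

lemma image_pairing_sub:
  "submodule (Hom_from_map C (f 0) ` carrier (Hom_from R C (I 0))) S (Hom_from R C (I (Suc 0)))"
  "submodule (f 0 ` carrier (I 0)) R (I (Suc 0))"
  "c \<in> carrier C \<Longrightarrow> h \<in> Hom_from_map C (f 0) ` carrier (Hom_from R C (I 0)) \<Longrightarrow> h c \<in> f 0 ` carrier (I 0)"
proof -
  show "submodule (Hom_from_map C (f 0) ` carrier (Hom_from R C (I 0))) S (Hom_from R C (I (Suc 0)))"
    using submodule_image[OF left_module_Hom_from[OF term_module] left_module_Hom_from[OF term_module] Hom_from_map_lhom[OF term_module term_module differential]]
    by (simp add: Hom_from_simps(1))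
  show "submodule (f 0 ` carrier (I 0)) R (I (Suc 0))"
    by (rule submodule_image[OF term_module term_module differential])
  show "c \<in> carrier C \<Longrightarrow> h \<in> Hom_from_map C (f 0) ` carrier (Hom_from R C (I 0)) \<Longrightarrow> h c \<in> f 0 ` carrier (I 0)"
    by (auto simp: Hom_from_simps(1) Hom_from_map_def compose_def dest: lhom_closed)
qed

text \<open>The second degree shift, with X(I 1) in the middle. The cokernel is paired with I 1
  modulo the cosyzygy, which Tor in positive degrees does not see. As the injective resolution is
  arbitrary, the lemma applies to whichever one \<open>min_inj_res\<close> picks.\<close>

lemma cokernel_Tor:
  "trivial_group (Tor S (right_mod C) (quotient_module (Hom_from R C (I (Suc 0)))
    (Hom_from_map C (f 0) ` carrier (Hom_from R C (I 0)))) (Suc k)) \<longleftrightarrow> Hom_exact K k"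
proof -
  let ?B = "Hom_from_map C (f 0) ` carrier (Hom_from R C (I 0))" and ?D = "f 0 ` carrier (I 0)"
  let ?N = "Hom_from R C (I (Suc 0))" and ?e = "quotient_pairing (I (Suc 0)) (f 0 ` carrier (I 0)) (\<lambda>c h. h c)"
  interpret ses: pairing_ses R S "right_mod C" "?N\<lparr>carrier := ?B\<rparr>" "(I (Suc 0))\<lparr>carrier := ?D\<rparr>" "\<lambda>c h. h c"
    ?N "I (Suc 0)" "\<lambda>c h. h c" "quotient_module ?N ?B" "quotient_module (I (Suc 0)) ?D" ?e
    "\<lambda>n\<in>?B. n" "\<lambda>k\<in>?D. k" "\<lambda>n\<in>carrier ?N. ?B +>\<^bsub>?N\<^esub> n" "\<lambda>k\<in>carrier (I (Suc 0)). ?D +>\<^bsub>I (Suc 0)\<^esub> k"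
    by (rule sub_quotient_ses[OF Hom_from_pairing[OF term_module] image_pairing_sub(1,2)])
      (use image_pairing_sub(3) in simp)
  have eq': "(I (Suc 0))\<lparr>carrier := ?D\<rparr> = cosyzygy I f (Suc 0)"
    by (simp add: cosyzygy_def)
  note les = ses.aug_exact_ses[OF resolution, unfolded eq']
  have "trivial_group (Tor S (right_mod C) (quotient_module ?N ?B) (Suc k)) \<longleftrightarrow>
      aug_exact S P \<epsilon> d (quotient_module ?N ?B) (quotient_module (I (Suc 0)) ?D) ?e (Suc (Suc k))"
    by (rule Tor_trivial_iff(1)[OF augmented_complex.intro[OF ses.Z.balanced_pairing_axioms P.proj_resolution_axioms]
          proj_res_eq])
  also have "\<dots> \<longleftrightarrow> image_exact I f (Suc k)"
    using les(3)[OF Hom_exact_injective[OF term_injective]] les(4)[OF _ Hom_exact_injective[OF term_injective]] by (rule iffI[rotated])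
  finally show ?thesis by (simp only: image_exact_iff(2))
qed

text \<open>This identifies the cocycles in \<open>Ext_module\<close> at degree one, making Ext^1(C,
  K) the quotient of Hom(C, co\<Omega> K) by the image of Hom(C, I 0).\<close>

lemma kernel_eq_Hom_cosyzygy:
  "a_kernel (Hom_from R C (I (Suc 0))) (Hom_from R C (I (Suc (Suc 0)))) (Hom_from_map C (f (Suc 0)))
    = lhom R C (cosyzygy I f (Suc 0))"
proof -
  have "h \<in> lhom R C (cosyzygy I f (Suc 0)) \<longleftrightarrow>
      h \<in> lhom R C (I (Suc 0)) \<and> (\<forall>c\<in>carrier C. f (Suc 0) (h c) = \<zero>\<^bsub>I (Suc (Suc 0))\<^esub>)" for h
    by (auto simp: cosyzygy_def image_differential mem_a_kernel lhom_def PiE_def Pi_def)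
  moreover have "Hom_from_map C (f (Suc 0)) h = (\<lambda>c\<in>carrier C. \<zero>\<^bsub>I (Suc (Suc 0))\<^esub>) \<longleftrightarrow>
      (\<forall>c\<in>carrier C. f (Suc 0) (h c) = \<zero>\<^bsub>I (Suc (Suc 0))\<^esub>)" for h
    by (auto simp: Hom_from_map_def compose_def fun_eq_iff restrict_def)
  ultimately show ?thesis
    by (auto simp: mem_a_kernel Hom_from_simps)
qed

text \<open>The long exact sequence of \<open>0 \<rightarrow> B \<rightarrow> Hom(C, co\<Omega> K) \<rightarrow> Ext\<^sup>1(C, K) \<rightarrow> 0\<close>, with \<open>B\<close> the image of \<open>Hom(C, I 0)\<close>.\<close>

lemma Ext_step:
  assumes K_exact: "\<And>k. k < m \<Longrightarrow> Hom_exact K k"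
  shows "(\<forall>k<Suc m. Hom_exact (cosyzygy I f (Suc 0)) k) \<longleftrightarrow>
    (\<forall>j<m. trivial_group (Tor S (right_mod C) (Ext_module R C I f (Suc 0)) j))"
proof -
  let ?B = "Hom_from_map C (f 0) ` carrier (Hom_from R C (I 0))" and ?L = "cosyzygy I f (Suc 0)"
  let ?N = "Hom_from R C ?L" and ?D = "carrier (cosyzygy I f (Suc 0))"
  let ?e = "quotient_pairing ?L ?D (\<lambda>c h. h c)"
  have L: "left_module R ?L"
    unfolding cosyzygy_def using left_module.submodule_left_module[OF term_module image_pairing_sub(2)] by simp
  interpret L: left_module R ?L by (rule L)
  have N_eq: "?N = (Hom_from R C (I (Suc 0)))\<lparr>carrier := lhom R C ?L\<rparr>"
    by (simp add: Hom_from_def cosyzygy_def)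
  have N_B: "?N\<lparr>carrier := ?B\<rparr> = (Hom_from R C (I (Suc 0)))\<lparr>carrier := ?B\<rparr>"
    by (simp add: N_eq)
  have subN: "submodule (lhom R C ?L) S (Hom_from R C (I (Suc 0)))"
    unfolding kernel_eq_Hom_cosyzygy[symmetric]
    using submodule_kernel[OF left_module_Hom_from[OF term_module] left_module_Hom_from[OF term_module] Hom_from_map_lhom[OF term_module term_module differential], of "Suc 0"]
    by (simp add: a_kernel_def kernel_def Hom_from_simps(1) cong: conj_cong)
  have B_sub: "?B \<subseteq> lhom R C ?L"
  proof -
    have "Hom_from_map C (f 0) h \<in> lhom R C ?L" if h: "h \<in> lhom R C (I 0)" for h
      using lhom_compose[OF left_C h differential[of 0]] lhom_closed[OF h]
      by (auto simp: Hom_from_map_def cosyzygy_def lhom_def PiE_def Pi_def compose_def)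
    then show ?thesis by (auto simp: Hom_from_simps(1))
  qed
  interpret N: left_module S ?N by (rule left_module_Hom_from[OF L])
  interpret NI: left_module S "Hom_from R C (I (Suc 0))" by (rule left_module_Hom_from[OF term_module])
  have subB: "submodule ?B S ?N"
  proof (rule N.submoduleI)
    show "?B \<subseteq> carrier ?N" using B_sub by (simp add: Hom_from_simps(1))
  qed (use NI.submoduleD[OF image_pairing_sub(1)] in \<open>simp_all add: N_eq\<close>)
  \<comment> \<open>The whole cosyzygy serves as the submodule, so that the quotient pairing takes
    values in the zero module.\<close>
  have subD: "submodule ?D R ?L"
    by (rule L.submoduleI) (auto simp: L.smult_closed)
  interpret ses: pairing_ses R S "right_mod C" "?N\<lparr>carrier := ?B\<rparr>" "?L\<lparr>carrier := ?D\<rparr>" "\<lambda>c h. h c"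
    ?N ?L "\<lambda>c h. h c" "quotient_module ?N ?B" "quotient_module ?L ?D" ?e
    "\<lambda>n\<in>?B. n" "\<lambda>k\<in>?D. k" "\<lambda>n\<in>carrier ?N. ?B +>\<^bsub>?N\<^esub> n" "\<lambda>k\<in>carrier ?L. ?D +>\<^bsub>?L\<^esub> k"
    by (rule sub_quotient_ses[OF Hom_from_pairing[OF L] subB subD])
      (use B_sub in \<open>auto intro: lhom_closed\<close>)
  have D_eq: "?L\<lparr>carrier := ?D\<rparr> = ?L" by simp
  note les = ses.aug_exact_ses[OF resolution, unfolded D_eq N_B]
  have Ext_eq: "Ext_module R C I f (Suc 0) = quotient_module ?N ?B"
    unfolding Ext_module_def Let_def nat.case kernel_eq_Hom_cosyzygy N_eq ..
  interpret aug: augmented_complex R S "right_mod C" "quotient_module ?N ?B" "quotient_module ?L ?D" ?e P \<epsilon> d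
    by (rule augmented_complex.intro[OF ses.Z.balanced_pairing_axioms P.proj_resolution_axioms])
  have zero: "carrier (quotient_module ?L ?D) = {\<zero>\<^bsub>quotient_module ?L ?D\<^esub>}"
  proof -
    interpret QL: left_submodule R ?L ?D
      by (intro left_submodule.intro left_submodule_axioms.intro L subD)
    show ?thesis
      unfolding QL.carrier_quotient QL.zero_quotient using QL.cls_eq_zero_iff L.M.zero_closed by auto
  qed
  let ?X = "aug_exact S P \<epsilon> d (quotient_module ?N ?B) (quotient_module ?L ?D) ?e"
  \<comment> \<open>With zero in place of \<open>K\<close>, index 1 already computes Tor_0; hence
    index j + 1 stands for Tor_j for all \<open>j\<close>.\<close>
  have X_Tor: "?X (Suc j) \<longleftrightarrow> trivial_group (Tor S (right_mod C) (Ext_module R C I f (Suc 0)) j)" for j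
    using Tor_trivial_iff(2)[OF aug.augmented_complex_axioms proj_res_eq zero]
      Tor_trivial_iff(1)[OF aug.augmented_complex_axioms proj_res_eq] unfolding Ext_eq by (cases j) auto
  have X0: "?X 0"
    unfolding aug_exact_def aug.exact_at_0_iff
  proof
    fix v assume v: "v \<in> frags (carrier (quotient_module ?L ?D))"
    have "v \<in> sum_relations (quotient_module ?L ?D)"
      using v msum(2)[OF ses.Z.K.left_module_axioms v] zero by (simp add: sum_relations_def)
    then show "\<exists>u\<in>frags (carrier (P 0) \<times> carrier (quotient_module ?N ?B)).
        v - tensor_eval ?e \<epsilon> u \<in> sum_relations (quotient_module ?L ?D)"
      using diff_closed_zero[OF diff_closed_frags] by (intro bexI[of _ 0]) auto
  qed
  \<comment> \<open>\<open>m\<close> exact degrees for \<open>K\<close> become m + 1 for the image,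
    by the shift and the automatic index 0.\<close>
  have B_exact: "image_exact I f k" if "k < Suc m" for k
    using that K_exact image_exact_iff by (cases k) auto
  \<comment> \<open>Passing from the quotient to the middle uses the image at index
    \<open>k\<close>; the converse uses it at index k - 1, and at k = 0 it is
    \<open>X0\<close>.\<close>
  have "Hom_exact ?L k \<longleftrightarrow> ?X k" if k: "k < Suc m" for k
  proof
    assume "?X k"
    with B_exact[OF k] show "Hom_exact ?L k" by (rule les(1))
  next
    assume *: "Hom_exact ?L k"
    show "?X k"
    proof (cases k)
      case 0
      then show ?thesis using X0 by simp
    next
      case (Suc l)
      then show ?thesis using * les(3) B_exact k by simp
    qed
  qed
  then have "(\<forall>k<Suc m. Hom_exact ?L k) \<longleftrightarrow> (\<forall>k<Suc m. ?X k)" by simp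
  also have "\<dots> \<longleftrightarrow> (\<forall>j<m. ?X (Suc j))"
    using X0 by (auto simp: less_Suc_eq_0_disj)
  finally show ?thesis by (simp only: X_Tor)
qed

end

text \<open>The assumption guarantees that \<open>min_inj_res\<close>, which searches the type of
  elements of \<open>K\<close>, picks a genuine minimal injective resolution; it may differ from
  \<open>I\<close>.\<close>

lemma cotorsionfree_iff:
  fixes K :: "('r, 'e) module" and I :: "nat \<Rightarrow> ('r, 'e) module"
  assumes "minimal_injective_resolution R K I \<eta> f"
  shows "cotorsionfree R S C n K \<longleftrightarrow> (\<forall>k<n. Hom_exact K k)"
proof -
  obtain I' f' where If: "min_inj_res R K = (I', f')" by fastforce
  have "\<exists>p :: (nat \<Rightarrow> ('r, 'e) module) \<times> (nat \<Rightarrow> 'e \<Rightarrow> 'e). case p of (I, f) \<Rightarrow> \<exists>\<eta>. minimal_injective_resolution R K I \<eta> f"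
    using assms by (intro exI[of _ "(I, f)"]) auto
  from someI_ex[OF this] obtain \<eta>' where "minimal_injective_resolution R K I' \<eta>' f'"
    unfolding min_inj_res_def[symmetric] If by auto
  then have "injective_resolution R K I' \<eta>' f'"
    by (simp add: minimal_injective_resolution_def)
  note Tor = cokernel_Tor[OF this]
  have "cotorsionfree R S C n K \<longleftrightarrow> (\<forall>i\<in>{1..n}. trivial_group (Tor S (right_mod C) (cTr R C K) i))"
    by (simp add: cotorsionfree_def)
  also have "\<dots> \<longleftrightarrow> (\<forall>k<n. trivial_group (Tor S (right_mod C) (cTr R C K) (Suc k)))"
    unfolding image_Suc_lessThan[symmetric] by auto
  finally show ?thesis
    by (simp add: cTr_def If Tor)
qed

lemma cograde_iff:
  "cograde S C N \<ge> enat m \<longleftrightarrow> (\<forall>j<m. trivial_group (Tor S (right_mod C) N j))"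
proof -
  have "cograde S C N \<ge> enat m \<longleftrightarrow> (\<forall>x\<in>{enat i | i. \<not> trivial_group (Tor S (right_mod C) N i)}. enat m \<le> x)"
    unfolding cograde_def by (rule le_Inf_iff)
  also have "\<dots> \<longleftrightarrow> (\<forall>i. \<not> trivial_group (Tor S (right_mod C) N i) \<longrightarrow> m \<le> i)" by auto
  finally show ?thesis by (meson not_le)
qed

end

theorem theorem4p3:
  fixes R :: "'r ring" and S :: "'s ring" and C :: "('r, 's, 'c) bimodule"
    and M :: "('r, 'a) module"
    and I :: "nat \<Rightarrow> ('r, 'e) module" and \<eta> :: "'a \<Rightarrow> 'e" and f :: "nat \<Rightarrow> 'e \<Rightarrow> 'e"
    and n :: nat
  assumes "semidualizing R S C"
    and "left_module R M"
    and "minimal_injective_resolution R M I \<eta> f"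
    and "n \<ge> 1"
  shows "(\<forall>i\<in>{1..n}. cotorsionfree R S C i (cosyzygy I f i)) \<longleftrightarrow>
         (\<forall>i\<in>{1..n}. cograde S C (Ext_module R C I f i) \<ge> enat (i - 1))"
proof -
  obtain P d where Pd: "proj_res (opposite_ring S) (right_mod C) = (P, d)" by fastforce
  \<comment> \<open>The finitely generated resolution witnesses that the choice in
    \<open>proj_res\<close> is from a nonempty set.\<close>
  have "\<exists>p :: (nat \<Rightarrow> ('s, ('s, 'c) res_elem) module) \<times> (nat \<Rightarrow> ('s, 'c) res_elem \<Rightarrow> ('s, 'c) res_elem).
      case p of (P, d) \<Rightarrow> \<exists>\<epsilon>. projective_resolution (opposite_ring S) (right_mod C) P \<epsilon> d"
    using assms(1) unfolding semidualizing_def has_fg_projective_resolution_def by fast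
  from someI_ex[OF this] obtain \<epsilon> where "projective_resolution (opposite_ring S) (right_mod C) P \<epsilon> d"
    unfolding proj_res_def[symmetric] Pd by auto
  then interpret semidualizing_bimodule R S C P \<epsilon> d
    using assms(1) Pd by unfold_locales
  have res: "injective_resolution R M I \<eta> f"
    using assms(3) by (simp add: minimal_injective_resolution_def)
  define a where "a i \<longleftrightarrow> (\<forall>k<i. Hom_exact (cosyzygy I f i) k)" for i
  define b where "b i \<longleftrightarrow> (\<forall>j<i - 1. trivial_group (Tor S (right_mod C) (Ext_module R C I f i) j))" for i
  have a: "cotorsionfree R S C (Suc m) (cosyzygy I f (Suc m)) \<longleftrightarrow> a (Suc m)" for m
    unfolding a_def by (rule cotorsionfree_iff[OF minimal_injective_resolution_truncate[OF assms(3)]])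
  \<comment> \<open>For i = 1 the Tor condition is empty and \<open>Ext_step\<close> with m = 0 has
    no premise: both sides are true.\<close>
  have 0: "a (Suc 0) \<longleftrightarrow> b (Suc 0)"
    using Ext_step[OF res, of 0] by (simp add: a_def b_def)
  \<comment> \<open>\<open>Ext_step\<close> for K = co\<Omega>^{m+1} M, whose premise is
    \<open>a (Suc m)\<close>. By mere unfolding, Ext^1(C, K) formed from the truncated resolution is
    Ext^{m+2}(C, M).\<close>
  have step: "a (Suc (Suc m)) \<longleftrightarrow> b (Suc (Suc m))" if "a (Suc m)" for m
    using Ext_step[OF injective_resolution_truncate[OF res, of m], of "Suc m"] that
    by (simp add: a_def b_def cosyzygy_def Ext_module_def)
  \<comment> \<open>Since \<open>step\<close> presupposes \<open>a (Suc m)\<close>, conjunctions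
    over initial segments are compared instead of the single conditions.\<close>
  have "(\<forall>i\<le>m. a (Suc i)) \<longleftrightarrow> (\<forall>i\<le>m. b (Suc i))" for m
  proof (induction m)
    case 0
    then show ?case using \<open>a (Suc 0) \<longleftrightarrow> b (Suc 0)\<close> by simp
  next
    case (Suc m)
    then show ?case using step by (auto simp: le_Suc_eq)
  qed
  from this[of "n - 1"] show ?thesis
  proof -
    assume *: "(\<forall>i\<le>n - 1. a (Suc i)) \<longleftrightarrow> (\<forall>i\<le>n - 1. b (Suc i))"
    have range: "(\<forall>i\<in>{1..n}. Q i) \<longleftrightarrow> (\<forall>i\<le>n - 1. Q (Suc i))" for Q
    proof -
      have "{1..n} = Suc ` {..n - 1}"
        using assms(4) by (simp add: image_Suc_atMost)
      then show ?thesis by auto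
    qed
    show ?thesis
      unfolding range cograde_iff a using * by (simp add: b_def)
  qed
qed

end
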